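(* Let $n\ge 2$ be an integer and let $1\le p,q<\infty$. There exists a constant $C_n>0$, independent of $f$, such that $$\|\hat f|_{\mathbb{T}^n}\|_{L^q(\mathbb{T}^n,d\sigma_n)}\le C_n\,\|f\|_{L^p(\mathbb{R}^{2n})}$$ for all $f\in L^p(\mathbb{R}^{2n})$ if and only if $1\le p<\frac43$ and $q\le p'/3$.
   Context: The $n$-torus is the subset $\mathbb{T}^n=\{(x_{1,1},x_{1,2},\dots,x_{n,1},x_{n,2})\in\mathbb{R}^{2n}: x_{\ell,1}^2+x_{\ell,2}^2=1,\ 1\le\ell\le n\}=(\mathbb{S}^1)^n$ of $\mathbb{R}^{2n}$. It carries the product surface measure $d\sigma_n=\bigotimes_{j=1}^n d\sigma(\xi_{j,1},\xi_{j,2})$, where on $\mathbb{S}^1$ the measure $d\sigma$ is arc length normalized to total mass 1, i.e. $d\sigma(\xi_1,\xi_2)=d\varkappa$ for $(\xi_1,\xi_2)=(\cos 2\pi\varkappa,\sin 2\pi\varkappa)$, $0\le\varkappa<1$. The Fourier transform on $\mathbb{R}^{2n}$ is $\hat f(\xi)=\int_{\mathbb{R}^{2n}}e^{-2\pi i x\cdot\xi}f(x)\,dx$, and $\|\hat f|_{\mathbb{T}^n}\|_{L^q(\mathbb{T}^n,d\sigma_n)}=\left(\int_{\mathbb{T}^n}|\hat f(\xi)|^q\,d\sigma_n(\xi)\right)^{1/q}$. The conjugate exponent is $p'=p/(p-1)$, with $p'=\infty$ if $p=1$ (in which case $q\le p'/3$ imposes no restriction on $q<\infty$). The constant $C_n$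 may depend on $n,p,q$. Meaning of the estimate for $f\in L^p$: since $\mathbb{T}^n$ is a null set, the inequality is understood as an a priori estimate, i.e. it holds with one constant for all $f\in C_c^\infty(\mathbb{R}^{2n})$ (complex-valued), a dense subspace of $L^p(\mathbb{R}^{2n})$; equivalently, the restriction map $f\mapsto\hat f|_{\mathbb{T}^n}$ extends from $C_c^\infty(\mathbb{R}^{2n})$ to a bounded operator $L^p(\mathbb{R}^{2n})\to L^q(\mathbb{T}^n,d\sigma_n)$. *)

theory Defs
  imports "HOL-Analysis.Analysis"
begin

text \<open>
  The space of dimension \<open>2n\<close> is \<^typ>\<open>real^2^'n\<close>, with \<open>CARD('n) = n\<close>: the coordinate
  written \<open>x_{l,i}\<close> on paper is \<open>x $ l $ i\<close>, where \<open>l :: 'n\<close> and \<open>i :: 2\<close>.  Its inner product is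
  the Euclidean one and \<open>lborel\<close> is Lebesgue measure.
\<close>

definition unit_circle :: "(real^2) set" where
  "unit_circle = {y. (y $ 1)\<^sup>2 + (y $ 2)\<^sup>2 = 1}"

definition torus :: "(real^2^'n) set" where
  "torus = {x. \<forall>l. (x $ l $ 1)\<^sup>2 + (x $ l $ 2)\<^sup>2 = 1}"

definition circle_measure :: "(real^2) measure" where
  "circle_measure =
     distr (restrict_space lborel {0..<1}) (restrict_space borel unit_circle)
       (\<lambda>t. vector [cos (2 * pi * t), sin (2 * pi * t)])"

text \<open>
  \<^const>\<open>PiM\<close> gives the product measure on functions \<open>'n \<Rightarrow> real^2\<close>; \<open>vec_lambda\<close> transports it
  to the torus inside \<open>real^2^'n\<close>.
\<close>

definition torus_measure :: "(real^2^'n::finite) measure" where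
  "torus_measure =
     distr (PiM UNIV (\<lambda>_::'n. circle_measure)) (restrict_space borel torus) vec_lambda"

definition fourier_transform :: "('a::euclidean_space \<Rightarrow> complex) \<Rightarrow> 'a \<Rightarrow> complex" where
  "fourier_transform f \<xi> =
     (LINT x|lborel. exp (- 2 * complex_of_real pi * \<i> * complex_of_real (x \<bullet> \<xi>)) * f x)"

definition Lp_norm :: "'a measure \<Rightarrow> real \<Rightarrow> ('a \<Rightarrow> complex) \<Rightarrow> real" where
  "Lp_norm M p f = (LINT x|M. cmod (f x) powr p) powr (1 / p)"

text \<open>
  \<open>f\<close> is of class \<open>C^(k+1)\<close> iff it is differentiable everywhere and each of its directional
  derivatives is of class \<open>C^k\<close>.
\<close>

primrec C_class :: "nat \<Rightarrow> ('a::euclidean_space \<Rightarrow> complex) \<Rightarrow> bool" where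
  "C_class 0 f \<longleftrightarrow> continuous_on UNIV f"
| "C_class (Suc k) f \<longleftrightarrow>
     (\<forall>x. f differentiable (at x)) \<and> (\<forall>v. C_class k (\<lambda>x. frechet_derivative f (at x) v))"

definition test_functions :: "('a::euclidean_space \<Rightarrow> complex) set" where
  "test_functions = {f. (\<forall>k. C_class k f) \<and> compact (closure {x. f x \<noteq> 0})}"

text \<open>
  The case distinction is needed because \<open>p / (p - 1) = 0\<close> in HOL when \<open>p = 1\<close>.
\<close>

definition conjugate_exponent :: "real \<Rightarrow> ereal" where
  "conjugate_exponent p = (if p = 1 then \<infinity> else ereal (p / (p - 1)))"

end

theory Submission
  imports Defs "HOL-Probability.Characteristic_Functions"
begin

text \<open>
  Sufficiency. On an arc, the square of the extension operator is the Fourier transform of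
  \<open>g s * g t\<close> carried by \<open>(s, t) \<mapsto> circ s + circ t\<close>, whose Jacobian is comparable to
  \<open>\<bar>s - t\<bar>\<close>. Hausdorff-Young with exponent \<open>m = p / (2 - p)\<close> and the Hardy-Littlewood-Sobolev
  inequality bound it in \<open>L\<^sup>p'\<close> for \<open>p < 4/3\<close>, and duality gives the circle estimate at
  \<open>q = p' / 3\<close>. There \<open>q \<ge> p\<close>, so Minkowski's inequality tensorizes the estimate to the torus;
  smaller \<open>q\<close> follow since the torus has total mass one.

  Necessity. Tensor powers reduce the torus estimate to the circle. Testing against
  \<open>\<bar>G\<bar>\<^sup>2 * cnj G\<close>, where \<open>G\<close> is the Fourier transform of the circle measure, would put \<open>G\<close>
  into \<open>L\<^sup>4\<close> if \<open>p \<ge> 4/3\<close>, and Knapp's example, a modulated bump on a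
  \<open>d\<^sup>-\<^sup>2 \<times> d\<^sup>-\<^sup>1\<close> rectangle, gives \<open>q \<le> p' / 3\<close>.
\<close>

section \<open>Lebesgue measure, circle and torus in coordinates\<close>

text \<open>The number 4/3 enters twice. Against the weight \<open>s - t\<close>, the density on the
  sums of two points is \<open>g s * g t / (s - t)\<close>. Its \<open>m\<close>-th power therefore
  leaves the kernel \<open>\<bar>s - t\<bar> powr (-(m - 1))\<close>, which is locally integrable
  exactly for \<open>m < 2\<close>, that is \<open>p < 4/3\<close>. Conversely,
  \<open>p' = 4\<close> is the exponent at which a function decaying like
  \<open>\<bar>x\<bar> powr (-1/2)\<close> just fails to lie in the Lebesgue space of the plane.
  \<open>Lp_norm\<close> is 0 when its integral diverges, so the positive direction compares
  nonnegative integrals with values in \<open>ennreal\<close>, for all integrable functions, and is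
  converted to norms only at the end. Plancherel's theorem and Bessel asymptotics are replaced by
  one identity for Gaussian-weighted squares: Schur's test turns it into an upper bound, and for the
  circle measure its kernel gives a lower bound. The functions that refute an estimate (tensor
  powers, tents, cut-off powers of a transform) are merely continuous, so an estimate on test
  functions is first extended to continuous functions of compact support.\<close>

lemma measurable_vec_lambda:
  "vec_lambda \<in> PiM UNIV (\<lambda>_::'n::finite. borel :: 'a::euclidean_space measure) \<rightarrow>\<^sub>M borel"
proof (rule borel_measurable_euclidean_space[THEN iffD2], intro ballI)
  fix b :: "'a^'n" assume "b \<in> Basis"
  then obtain i c where b: "b = axis i c" by (auto simp: Basis_vec_def)
  show "(\<lambda>x. vec_lambda x \<bullet> b) \<in> borel_measurable (PiM UNIV (\<lambda>_. borel))"
    unfolding b inner_axis by simp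
qed

text \<open>\<open>lborel\<close> is determined by its values on boxes, and a box in
  \<open>'a^'n\<close> is the product of the boxes of its blocks. This is what lets Fourier
  integrals over the large space iterate block by block.\<close>

lemma distr_PiM_lborel_vec:
  "distr (PiM UNIV (\<lambda>_::'n::finite. lborel :: 'a::euclidean_space measure)) borel vec_lambda = lborel"
proof (rule lborel_eqI[symmetric])
  interpret product_sigma_finite "\<lambda>_::'n. lborel :: 'a measure"
    by standard
  have m: "vec_lambda \<in> PiM UNIV (\<lambda>_::'n. lborel :: 'a measure) \<rightarrow>\<^sub>M borel"
    using measurable_vec_lambda by (simp cong: measurable_cong_sets sets_PiM_cong)
  fix l u :: "'a^'n" assume le: "\<And>b. b \<in> Basis \<Longrightarrow> l \<bullet> b \<le> u \<bullet> b"
  have le': "l $ i \<bullet> b \<le> u $ i \<bullet> b" if "b \<in> Basis" for i b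
    using le[of "axis i b"] that by (auto simp: inner_axis Basis_vec_def)
  have eq: "vec_lambda -` box l u \<inter> space (PiM UNIV (\<lambda>_::'n. lborel :: 'a measure)) = 
     PiE UNIV (\<lambda>i. box (l $ i) (u $ i))"
    by (auto simp: mem_box space_PiM Basis_vec_def inner_axis PiE_def Pi_def)
  have "emeasure (distr (PiM UNIV (\<lambda>_::'n. lborel :: 'a measure)) borel vec_lambda) (box l u)
     = (\<Prod>i\<in>UNIV. emeasure lborel (box (l $ i) (u $ i)))"
    by (subst emeasure_distr) (use m in \<open>auto simp: eq emeasure_PiM\<close>)
  also have "\<dots> = (\<Prod>i\<in>UNIV. ennreal (\<Prod>b\<in>Basis. (u $ i - l $ i) \<bullet> b))"
    by (intro prod.cong refl) (simp add: emeasure_lborel_box_eq le' prod_nonneg)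
  also have "\<dots> = ennreal (\<Prod>i\<in>UNIV. (\<Prod>b\<in>Basis. (u $ i - l $ i) \<bullet> b))"
    by (subst prod_ennreal) (auto intro!: prod_nonneg simp: le' inner_diff_left)
  also have "(\<Prod>i\<in>UNIV. (\<Prod>b\<in>Basis. (u $ i - l $ i) \<bullet> b)) = (\<Prod>b\<in>Basis. (u - l) \<bullet> b)"
  proof -
    \<comment> \<open>The basis is the disjoint union of the copies \<open>axis i\<close> of the
      basis of the block space, so one product becomes a double product.\<close>
    have "(\<Prod>b\<in>Basis. (u - l) \<bullet> b) = (\<Prod>i\<in>UNIV. \<Prod>b\<in>(\<lambda>c. axis i c) ` Basis. (u - l) \<bullet> b)"
      unfolding Basis_vec_def
      by (subst prod.UNION_disjoint[symmetric])
         (auto simp: axis_eq_axis nonzero_Basis intro!: prod.cong)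
    also have "\<dots> = (\<Prod>i\<in>UNIV. (\<Prod>b\<in>Basis. (u $ i - l $ i) \<bullet> b))"
      by (intro prod.cong refl, subst prod.reindex) (auto simp: inj_on_def axis_eq_axis inner_axis)
    finally show ?thesis by simp
  qed
  finally show "emeasure (distr (PiM UNIV (\<lambda>_::'n. lborel :: 'a measure)) borel vec_lambda) (box l u) = ennreal (\<Prod>b\<in>Basis. (u - l) \<bullet> b)" .
qed simp

text \<open>Moves planar integrals to a product of two lines, where Tonelli and Fubini apply to the
  two coordinates.\<close>

definition pt :: "real \<times> real \<Rightarrow> real^2" where "pt z = vector [fst z, snd z]"

lemma pt_nth [simp]: "pt z $ 1 = fst z" "pt z $ 2 = snd z"
  by (auto simp: pt_def vector_2)

lemma inner_real2: "(x::real^2) \<bullet> y = x $ 1 * y $ 1 + x $ 2 * y $ 2"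
  by (simp add: inner_vec_def UNIV_2)

lemma pt_eq: "pt z = (\<chi> i. if i = 1 then fst z else snd z)"
  by (simp add: vec_eq_iff forall_2)

lemma continuous_on_pt [continuous_intros]:
  "continuous_on S f \<Longrightarrow> continuous_on S g \<Longrightarrow> continuous_on S (\<lambda>x. pt (f x, g x))"
  unfolding pt_eq by (intro continuous_on_vec_lambda, case_tac "i = 1") auto

lemma measurable_pt [measurable]: "pt \<in> borel_measurable borel"
  using continuous_on_pt[OF continuous_on_fst[OF continuous_on_id] continuous_on_snd[OF continuous_on_id], of UNIV]
  by (intro borel_measurable_continuous_onI) simp

lemma distr_pair_lborel_pt: "distr (lborel \<Otimes>\<^sub>M lborel) borel pt = lborel"
proof (rule lborel_eqI[symmetric])
  fix l u :: "real^2" assume le: "\<And>b. b \<in> Basis \<Longrightarrow> l \<bullet> b \<le> u \<bullet> b"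
  have le': "l $ i \<le> u $ i" for i
    using le[of "axis i 1"] by (auto simp: inner_axis Basis_vec_def)
  have eq: "pt -` box l u = {l $ 1<..<u $ 1} \<times> {l $ 2<..<u $ 2}"
    by (auto simp: mem_box_cart forall_2)
  have B: "(Basis :: (real^2) set) = {axis 1 1, axis 2 1}"
    by (auto simp: Basis_vec_def UNIV_2)
  have "emeasure (distr (lborel \<Otimes>\<^sub>M lborel) borel pt) (box l u) = ennreal (u $ 1 - l $ 1) * ennreal (u $ 2 - l $ 2)"
    by (subst emeasure_distr)
       (simp_all add: lborel_prod eq, simp add: lborel_prod[symmetric] lborel.emeasure_pair_measure_Times le')
  also have "\<dots> = ennreal (\<Prod>b\<in>Basis. (u - l) \<bullet> b)"
    unfolding B by (subst prod.insert) (auto simp: axis_eq_axis inner_axis ennreal_mult le')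
  finally show "emeasure (distr (lborel \<Otimes>\<^sub>M lborel) borel pt) (box l u) = ennreal (\<Prod>b\<in>Basis. (u - l) \<bullet> b)" .
qed simp

lemma nn_integral_real2:
  assumes [measurable]: "f \<in> borel_measurable borel"
  shows "(\<integral>\<^sup>+x. f x \<partial>(lborel::(real^2) measure)) = (\<integral>\<^sup>+s. \<integral>\<^sup>+t. f (pt (s,t)) \<partial>lborel \<partial>lborel)"
  by (subst distr_pair_lborel_pt[symmetric], subst nn_integral_distr)
     (simp_all add: lborel_prod, subst lborel_prod[symmetric], subst lborel.nn_integral_fst[symmetric], simp_all add: lborel_prod)

lemma nn_integral_vec:
  fixes f :: "'a::euclidean_space^'n::finite \<Rightarrow> ennreal"
  assumes [measurable]: "f \<in> borel_measurable borel"
  shows "(\<integral>\<^sup>+x. f x \<partial>lborel) = (\<integral>\<^sup>+x. f (vec_lambda x) \<partial>PiM UNIV (\<lambda>_. lborel))"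
proof -
  have "vec_lambda \<in> PiM UNIV (\<lambda>_::'n. lborel :: 'a measure) \<rightarrow>\<^sub>M borel"
    using measurable_vec_lambda by (simp cong: measurable_cong_sets sets_PiM_cong)
  then show ?thesis
    by (subst distr_PiM_lborel_vec[symmetric], subst nn_integral_distr) simp_all
qed

lemma
  fixes f :: "'a::euclidean_space^'n::finite \<Rightarrow> 'b::{banach, second_countable_topology}"
  assumes [measurable]: "f \<in> borel_measurable borel"
  shows integral_vec: "(LINT x|lborel. f x) = (LINT x|PiM UNIV (\<lambda>_. lborel). f (vec_lambda x))"
    and integrable_vec: "integrable lborel f \<longleftrightarrow> integrable (PiM UNIV (\<lambda>_. lborel)) (\<lambda>x. f (vec_lambda x))"
proof -
  have "vec_lambda \<in> PiM UNIV (\<lambda>_::'n. lborel :: 'a measure) \<rightarrow>\<^sub>M borel"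
    using measurable_vec_lambda by (simp cong: measurable_cong_sets sets_PiM_cong)
  then show "(LINT x|lborel. f x) = (LINT x|PiM UNIV (\<lambda>_. lborel). f (vec_lambda x))"
    "integrable lborel f \<longleftrightarrow> integrable (PiM UNIV (\<lambda>_. lborel)) (\<lambda>x. f (vec_lambda x))"
    by (subst distr_PiM_lborel_vec[symmetric], simp add: integral_distr integrable_distr_eq)+
qed

lemma
  fixes f :: "real^2 \<Rightarrow> 'b::{banach, second_countable_topology}"
  assumes [measurable]: "f \<in> borel_measurable borel"
  shows integral_real2: "(LINT x|lborel. f x) = (LINT z|(lborel \<Otimes>\<^sub>M lborel). f (pt z))"
    and integrable_real2: "integrable lborel f \<longleftrightarrow> integrable (lborel \<Otimes>\<^sub>M lborel) (\<lambda>z. f (pt z))"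
  by (subst distr_pair_lborel_pt[symmetric], 
      simp add: lborel_prod integral_distr integrable_distr_eq)+

section \<open>Parametrised circle, integration over the circle and the torus\<close>

definition circ :: "real \<Rightarrow> real^2" where "circ t = pt (cos (2 * pi * t), sin (2 * pi * t))"

lemma circ_nth [simp]: "circ t $ 1 = cos (2 * pi * t)" "circ t $ 2 = sin (2 * pi * t)"
  by (simp_all add: circ_def)

lemma continuous_on_circ [continuous_intros]:
  assumes "continuous_on S f"
  shows "continuous_on S (\<lambda>x. circ (f x))"
proof -
  have "continuous_on UNIV circ"
    unfolding circ_def by (intro continuous_intros)
  then show ?thesis
    by (rule continuous_on_compose2) (use assms in auto)
qed

lemma measurable_circ [measurable]: "circ \<in> borel_measurable borel"
  by (intro borel_measurable_continuous_onI continuous_intros)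

abbreviation unit_interval_measure :: "real measure" where
  "unit_interval_measure \<equiv> restrict_space lborel {0..<1}"

lemma circ_in: "circ t \<in> unit_circle"
  by (simp add: unit_circle_def)

lemma measurable_circ_restrict: "circ \<in> unit_interval_measure \<rightarrow>\<^sub>M restrict_space borel unit_circle"
  by (intro measurable_restrict_space2 measurable_restrict_space1) (auto simp: circ_in)

lemma circle_measure_eq: "circle_measure = distr unit_interval_measure (restrict_space borel unit_circle) circ"
  unfolding circle_measure_def circ_def pt_def by simp

lemma prob_space_unit_interval: "prob_space unit_interval_measure"
  by (intro prob_spaceI) (simp add: emeasure_restrict_space space_restrict_space)

lemma prob_space_circle: "prob_space circle_measure"
  unfolding circle_measure_eq
  by (intro prob_space.prob_space_distr prob_space_unit_interval measurable_circ_restrict)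

lemma sets_circle_measure [simp, measurable_cong]: "sets circle_measure = sets (restrict_space borel unit_circle)"
  by (simp add: circle_measure_def)

lemma measurable_vec_lambda_torus:
  "vec_lambda \<in> PiM UNIV (\<lambda>_::'n::finite. circle_measure) \<rightarrow>\<^sub>M restrict_space borel torus"
proof (rule measurable_restrict_space2)
  have "space circle_measure = unit_circle"
    by (simp add: circle_measure_def space_restrict_space)
  then show "vec_lambda \<in> space (Pi\<^sub>M UNIV (\<lambda>_::'n. circle_measure)) \<rightarrow> torus"
    by (auto simp: space_PiM torus_def unit_circle_def PiE_def Pi_def)
  have "(\<lambda>x. x) \<in> PiM UNIV (\<lambda>_::'n. circle_measure) \<rightarrow>\<^sub>M PiM UNIV (\<lambda>_. borel)"
  proof (rule measurable_PiM_single')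
    fix i :: 'n
    have "(\<lambda>x. x) \<in> circle_measure \<rightarrow>\<^sub>M borel"
      by (auto simp: measurable_restrict_space1 cong: measurable_cong_sets)
    then show "(\<lambda>x. x i) \<in> PiM UNIV (\<lambda>_::'n. circle_measure) \<rightarrow>\<^sub>M borel"
      by (rule measurable_compose[rotated]) simp
  qed auto
  from measurable_compose[OF this measurable_vec_lambda]
  show "vec_lambda \<in> PiM UNIV (\<lambda>_::'n. circle_measure) \<rightarrow>\<^sub>M borel" by simp
qed

lemma prob_space_torus: "prob_space (torus_measure :: (real^2^'n::finite) measure)"
proof -
  interpret product_prob_space "\<lambda>_::'n. circle_measure" UNIV
    by (simp add: product_prob_spaceI prob_space_circle)
  show ?thesis unfolding torus_measure_def
    by (intro prob_space_distr measurable_vec_lambda_torus)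
qed

lemma nn_integral_circle:
  assumes [measurable]: "f \<in> borel_measurable borel"
  shows "(\<integral>\<^sup>+x. f x \<partial>circle_measure) = (\<integral>\<^sup>+t. f (circ t) * indicator {0..<1} t \<partial>lborel)"
  unfolding circle_measure_eq
  by (subst nn_integral_distr[OF measurable_circ_restrict])
     (auto simp: measurable_restrict_space1 nn_integral_restrict_space)

lemma nn_integral_torus:
  fixes f :: "real^2^'n::finite \<Rightarrow> ennreal"
  assumes [measurable]: "f \<in> borel_measurable borel"
  shows "(\<integral>\<^sup>+x. f x \<partial>torus_measure) = (\<integral>\<^sup>+x. f (vec_lambda x) \<partial>PiM UNIV (\<lambda>_. circle_measure))"
  unfolding torus_measure_def
  by (subst nn_integral_distr[OF measurable_vec_lambda_torus]) (auto simp: measurable_restrict_space1)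

section \<open>Gaussians and Bessel's inequality\<close>

lemma measurable_cnj [measurable]: "cnj \<in> borel_measurable borel"
  by (intro borel_measurable_continuous_onI continuous_intros)

lemma measurable_cis [measurable]: "cis \<in> borel_measurable borel"
  by (intro borel_measurable_continuous_onI continuous_intros)

lemma (in pair_sigma_finite)
  fixes f :: "'a \<Rightarrow> 'c::{real_normed_field, banach, second_countable_topology}"
  assumes f: "integrable M1 f" and g: "integrable M2 g"
  shows integrable_mult_fst_snd: "integrable (M1 \<Otimes>\<^sub>M M2) (\<lambda>(x, y). f x * g y)"
    and integral_mult_fst_snd: "(LINT z|(M1 \<Otimes>\<^sub>M M2). (case z of (x, y) \<Rightarrow> f x * g y)) = (LINT x|M1. f x) * (LINT y|M2. g y)"
proof -
  have [measurable]: "f \<in> borel_measurable M1" "g \<in> borel_measurable M2" using f g by auto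
  show *: "integrable (M1 \<Otimes>\<^sub>M M2) (\<lambda>(x, y). f x * g y)"
  proof (rule Fubini_integrable)
    show "integrable M1 (\<lambda>x. LINT y|M2. norm (case (x, y) of (x, y) \<Rightarrow> f x * g y))"
      using f g by (simp add: norm_mult)
    show "AE x in M1. integrable M2 (\<lambda>y. case (x, y) of (x, y) \<Rightarrow> f x * g y)"
      using g by simp
  qed simp
  from integral_fst[OF *] show "(LINT z|(M1 \<Otimes>\<^sub>M M2). (case z of (x, y) \<Rightarrow> f x * g y)) = (LINT x|M1. f x) * (LINT y|M2. g y)"
    using f g by simp
qed

text \<open>For \<open>e = 1\<close> this is the characteristic function of the standard normal
  distribution; the substitution \<open>x \<mapsto> e * x\<close> gives the general case.\<close>

lemma
  fixes e t :: real assumes e: "0 < e"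
  shows integrable_gauss_cis: "integrable lborel (\<lambda>x. complex_of_real (exp (-(e\<^sup>2 * x\<^sup>2) / 2)) * cis (t * x))"
    and integral_gauss_cis: "(LINT x|lborel. complex_of_real (exp (-(e\<^sup>2 * x\<^sup>2) / 2)) * cis (t * x)) = complex_of_real (sqrt (2*pi) / e * exp (-t\<^sup>2/(2 * e\<^sup>2)))"
proof -
  define G where "G s = (\<lambda>x. complex_of_real (exp (-(x\<^sup>2) / 2)) * cis (s * x))" for s
  have D: "G s x = sqrt (2*pi) *\<^sub>R (std_normal_density x *\<^sub>R cis (s * x))" for s x
    by (simp add: std_normal_density_def G_def scaleR_conv_of_real)
  have G: "integrable lborel (G s)" for s
    unfolding D[abs_def]
    by (intro integrable_scaleR_right, rule Bochner_Integration.integrable_bound[OF integrable_normal_density[of 1 0]]) auto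
  have GI: "(LINT x|lborel. G s x) = sqrt (2*pi) * exp (-(s\<^sup>2)/2)" for s
  proof -
    have "complex_of_real (exp (-(s\<^sup>2)/2)) = (LINT x|std_normal_distribution. cis (s * x))"
      using fun_cong[OF char_std_normal_distribution, of s] by (simp add: char_def cis_conv_exp del: of_real_mult)
    also have "\<dots> = (LINT x|lborel. std_normal_density x *\<^sub>R cis (s * x))"
      by (rule integral_density) auto
    finally show ?thesis unfolding D by (simp add: scaleR_conv_of_real)
  qed
  have eq: "G (t/e) (0 + e * x) = complex_of_real (exp (-(e\<^sup>2 * x\<^sup>2) / 2)) * cis (t * x)" for x
    using e by (simp add: G_def power_mult_distrib)
  show "integrable lborel (\<lambda>x. complex_of_real (exp (-(e\<^sup>2 * x\<^sup>2) / 2)) * cis (t * x))"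
    using lborel_integrable_real_affine[OF G[of "t/e"], of e 0] e unfolding eq by simp
  have "(LINT x|lborel. G (t/e) x) = \<bar>e\<bar> *\<^sub>R (LINT x|lborel. G (t/e) (0 + e * x))"
    by (rule lborel_integral_real_affine) (use e in auto)
  then show "(LINT x|lborel. complex_of_real (exp (-(e\<^sup>2 * x\<^sup>2) / 2)) * cis (t * x)) = complex_of_real (sqrt (2*pi) / e * exp (-t\<^sup>2/(2 * e\<^sup>2)))"
    unfolding eq GI using e by (simp add: scaleR_conv_of_real field_simps power_divide)
qed

text \<open>The weight tends to 1 as \<open>e\<close> tends to 0, while its transform concentrates
  at the origin with width of order \<open>e\<close>.\<close>

definition gauss :: "real \<Rightarrow> real^2 \<Rightarrow> real" where
  "gauss e x = exp (-(e\<^sup>2 * (x \<bullet> x)) / 2)"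

text \<open>The transform of \<open>gauss e\<close> at the angular frequency \<open>t\<close>; a
  factor \<open>2 * pi\<close> from the Fourier kernel has to be supplied in the argument.\<close>

definition gauss_hat :: "real \<Rightarrow> real^2 \<Rightarrow> real" where
  "gauss_hat e t = 2 * pi / e\<^sup>2 * exp (-(t \<bullet> t) / (2 * e\<^sup>2))"

lemma measurable_gauss [measurable]: "gauss e \<in> borel_measurable borel" "gauss_hat e \<in> borel_measurable borel"
  by (auto simp: gauss_def[abs_def] gauss_hat_def[abs_def] intro!: borel_measurable_continuous_onI continuous_intros)

lemma gauss_pos: "0 < gauss e x" and gauss_le_1: "gauss e x \<le> 1" and gauss_hat_nonneg: "0 \<le> gauss_hat e t"
  by (auto simp: gauss_def gauss_hat_def)

lemma
  fixes e :: real and t :: "real^2"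
  assumes e: "0 < e"
  shows integrable_gauss2: "integrable lborel (\<lambda>x. complex_of_real (gauss e x) * cis (x \<bullet> t))"
    and integral_gauss2: "(LINT x|lborel. complex_of_real (gauss e x) * cis (x \<bullet> t)) = complex_of_real (gauss_hat e t)"
proof -
  let ?g = "\<lambda>t x. complex_of_real (exp (-(e\<^sup>2 * x\<^sup>2) / 2)) * cis (t * x)"
  have eq: "complex_of_real (gauss e (pt z)) * cis (pt z \<bullet> t) = (case z of (x, y) \<Rightarrow> ?g (t $ 1) x * ?g (t $ 2) y)" for z
    by (simp add: gauss_def inner_real2 case_prod_beta cis_mult[symmetric] of_real_mult[symmetric] exp_add[symmetric] 
           mult.commute mult.left_commute power2_eq_square distrib_left add_divide_distrib del: of_real_mult)
  show "integrable lborel (\<lambda>x. complex_of_real (gauss e x) * cis (x \<bullet> t))"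
    using lborel_pair.integrable_mult_fst_snd[OF integrable_gauss_cis[OF e] integrable_gauss_cis[OF e], of "t $ 1" "t $ 2"]
    by (subst integrable_real2) (simp_all only: eq, measurable)
  have "(LINT x|lborel. complex_of_real (gauss e x) * cis (x \<bullet> t)) = complex_of_real (sqrt (2*pi) / e * exp (-(t $ 1)\<^sup>2/(2 * e\<^sup>2))) * complex_of_real (sqrt (2*pi) / e * exp (-(t $ 2)\<^sup>2/(2 * e\<^sup>2)))"
    using lborel_pair.integral_mult_fst_snd[OF integrable_gauss_cis[OF e] integrable_gauss_cis[OF e], of "t $ 1" "t $ 2"]
    unfolding integral_gauss_cis[OF e] by (subst integral_real2) (simp_all only: eq, measurable)
  also have "\<dots> = complex_of_real (gauss_hat e t)"
  proof -
    have "(sqrt (2*pi) / e * exp (-(t $ 1)\<^sup>2/(2 * e\<^sup>2))) * (sqrt (2*pi) / e * exp (-(t $ 2)\<^sup>2/(2 * e\<^sup>2)))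
       = (sqrt (2*pi) * sqrt (2*pi)) / e\<^sup>2 * exp (-(t $ 1)\<^sup>2/(2 * e\<^sup>2) + -(t $ 2)\<^sup>2/(2 * e\<^sup>2))"
      unfolding exp_add by (simp add: power2_eq_square)
    also have "\<dots> = gauss_hat e t"
      by (simp add: gauss_hat_def inner_real2 power2_eq_square add_divide_distrib diff_divide_distrib)
    finally show ?thesis by (simp only: of_real_mult[symmetric])
  qed
  finally show "(LINT x|lborel. complex_of_real (gauss e x) * cis (x \<bullet> t)) = complex_of_real (gauss_hat e t)" .
qed

text \<open>After the scaling by \<open>2 * pi\<close> the kernel is a product of two normal
  densities of standard deviation \<open>e / (2 * pi)\<close>. That the mass is the same for every
  \<open>e\<close> is what makes the limit \<open>e \<rightarrow> 0\<close> harmless.\<close>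

lemma nn_integral_gauss_hat:
  fixes e :: real and y :: "real^2"
  assumes e: "0 < e"
  shows "(\<integral>\<^sup>+z. ennreal (gauss_hat e ((2 * pi) *\<^sub>R (z - y))) \<partial>lborel) = 1"
proof -
  let ?n = "\<lambda>i. normal_density (y $ i) (e / (2 * pi))"
  have n: "(\<integral>\<^sup>+z. ennreal (?n i z) \<partial>lborel) = 1" for i
  proof -
    interpret prob_space "density lborel (?n i)"
      using e by (intro prob_space_normal_density) simp
    show ?thesis using emeasure_space_1 by (simp add: emeasure_density)
  qed
  have eq: "gauss_hat e ((2 * pi) *\<^sub>R (pt (a,b) - y)) = ?n 1 a * ?n 2 b" for a b
  proof -
    have "?n 1 a * ?n 2 b = (1 / sqrt (2 * pi * (e / (2 * pi))\<^sup>2))\<^sup>2 * exp (- (a - y $ 1)\<^sup>2 / (2 * (e / (2*pi))\<^sup>2) + - (b - y $ 2)\<^sup>2 / (2 * (e / (2*pi))\<^sup>2))"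
      unfolding exp_add by (simp add: normal_density_def power2_eq_square)
    also have "(1 / sqrt (2 * pi * (e / (2 * pi))\<^sup>2))\<^sup>2 = 2 * pi / e\<^sup>2"
      using e by (simp add: power_divide field_simps power2_eq_square)
    also have "- (a - y $ 1)\<^sup>2 / (2 * (e / (2*pi))\<^sup>2) + - (b - y $ 2)\<^sup>2 / (2 * (e / (2*pi))\<^sup>2) = - (((2 * pi) *\<^sub>R (pt (a,b) - y)) \<bullet> ((2 * pi) *\<^sub>R (pt (a,b) - y))) / (2 * e\<^sup>2)"
      using e by (simp add: inner_real2 power_divide field_simps power2_eq_square)
    finally show ?thesis unfolding gauss_hat_def by simp
  qed
  have "(\<integral>\<^sup>+z. ennreal (gauss_hat e ((2 * pi) *\<^sub>R (z - y))) \<partial>lborel) = (\<integral>\<^sup>+a. \<integral>\<^sup>+b. ennreal (?n 1 a) * ennreal (?n 2 b) \<partial>lborel \<partial>lborel)"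
    by (subst nn_integral_real2) (simp_all add: eq ennreal_mult)
  also have "\<dots> = 1" by (simp add: nn_integral_cmult n)
  finally show ?thesis .
qed

lemma (in pair_sigma_finite) nn_integral_cmult_add:
  fixes c :: ennreal
  assumes [measurable]: "(\<lambda>(x, y). f x y) \<in> borel_measurable (M1 \<Otimes>\<^sub>M M2)" "(\<lambda>(x, y). g x y) \<in> borel_measurable (M1 \<Otimes>\<^sub>M M2)"
  shows "(\<integral>\<^sup>+x. \<integral>\<^sup>+y. c * (f x y + g x y) \<partial>M2 \<partial>M1) = c * ((\<integral>\<^sup>+x. \<integral>\<^sup>+y. f x y \<partial>M2 \<partial>M1) + (\<integral>\<^sup>+x. \<integral>\<^sup>+y. g x y \<partial>M2 \<partial>M1))"
proof -
  have "(\<integral>\<^sup>+y. c * (f x y + g x y) \<partial>M2) = c * ((\<integral>\<^sup>+y. f x y \<partial>M2) + (\<integral>\<^sup>+y. g x y \<partial>M2))" if [measurable]: "x \<in> space M1" for x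
    by (subst nn_integral_cmult, measurable) (subst nn_integral_add, auto)
  then have "(\<integral>\<^sup>+x. \<integral>\<^sup>+y. c * (f x y + g x y) \<partial>M2 \<partial>M1) = (\<integral>\<^sup>+x. c * ((\<integral>\<^sup>+y. f x y \<partial>M2) + (\<integral>\<^sup>+y. g x y \<partial>M2)) \<partial>M1)"
    by (rule nn_integral_cong)
  then show ?thesis
    by (simp add: nn_integral_cmult nn_integral_add)
qed

text \<open>Fatou's lemma along \<open>e = 1 / (n + 1)\<close>, for which the weights tend to 1
  pointwise.\<close>

lemma nn_integral_le_if_gauss_weighted_le:
  fixes u :: "real^2 \<Rightarrow> ennreal"
  assumes [measurable]: "u \<in> borel_measurable borel"
    and le: "\<And>e. 0 < e \<Longrightarrow> (\<integral>\<^sup>+x. ennreal (gauss e x) * u x \<partial>lborel) \<le> B"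
  shows "(\<integral>\<^sup>+x. u x \<partial>lborel) \<le> B"
proof -
  define f where "f n x = ennreal (gauss (1 / real (Suc n)) x) * u x" for n x
  have [measurable]: "f n \<in> borel_measurable borel" for n unfolding f_def by measurable
  have lim: "(\<lambda>n. f n x) \<longlonglongrightarrow> u x" for x
  proof -
    have "(\<lambda>n. gauss (1 / real (Suc n)) x) \<longlonglongrightarrow> exp (-(0\<^sup>2 * (x \<bullet> x)) / 2)"
      unfolding gauss_def by (intro tendsto_intros LIMSEQ_Suc[OF lim_1_over_n]) auto
    then have "(\<lambda>n. ennreal (gauss (1 / real (Suc n)) x)) \<longlonglongrightarrow> ennreal 1"
      by (intro tendsto_ennrealI) simp
    then have "(\<lambda>n. ennreal (gauss (1 / real (Suc n)) x) * u x) \<longlonglongrightarrow> ennreal 1 * u x"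
      by (intro tendsto_mult_ennreal tendsto_const) auto
    then show ?thesis by (simp add: f_def)
  qed
  have "(\<integral>\<^sup>+x. u x \<partial>lborel) = (\<integral>\<^sup>+x. liminf (\<lambda>n. f n x) \<partial>lborel)"
    by (intro nn_integral_cong) (metis lim lim_imp_Liminf sequentially_bot)
  also have "\<dots> \<le> liminf (\<lambda>n. \<integral>\<^sup>+x. f n x \<partial>lborel)"
    by (rule nn_integral_liminf) simp
  also have "\<dots> \<le> B"
    by (rule Liminf_le) (auto simp: f_def intro!: always_eventually le)
  finally show ?thesis .
qed

text \<open>The squared modulus is a double integral over two frequencies; integrating in
  \<open>x\<close> first leaves the Gaussian kernel of their difference. The weight makes the whole
  integral absolutely convergent, so Fubini's theorem applies.\<close>

lemma gauss_weighted_square: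
  fixes M :: "'z measure" and \<Phi> :: "'z \<Rightarrow> real^2" and F :: "'z \<Rightarrow> complex"
  assumes "sigma_finite_measure M" and [measurable]: "\<Phi> \<in> borel_measurable M"
    and F: "integrable M F" and e: "0 < e"
  defines "T \<equiv> \<lambda>x. LINT z|M. F z * cis (- (2 * pi * (x \<bullet> \<Phi> z)))"
  shows "integrable lborel (\<lambda>x. gauss e x * (cmod (T x))\<^sup>2)"
    and "complex_of_real (LINT x|lborel. gauss e x * (cmod (T x))\<^sup>2) =
      (LINT z|(M \<Otimes>\<^sub>M M). F (fst z) * cnj (F (snd z)) * complex_of_real (gauss_hat e ((2 * pi) *\<^sub>R (\<Phi> (snd z) - \<Phi> (fst z)))))"
proof -
  interpret M: sigma_finite_measure M by fact
  interpret MM: pair_sigma_finite M M ..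
  interpret L: pair_sigma_finite lborel "M \<Otimes>\<^sub>M M" ..
  have [measurable]: "F \<in> borel_measurable M" using F by simp
  have T_def: "T x = (LINT z|M. F z * cis (- (2 * pi * (x \<bullet> \<Phi> z))))" for x by (simp add: T_def)
  have [measurable]: "T \<in> borel_measurable borel" unfolding T_def[abs_def] by measurable
  define D where "D z = (2 * pi) *\<^sub>R (\<Phi> (snd z) - \<Phi> (fst z))" for z
  have [measurable]: "D \<in> borel_measurable (M \<Otimes>\<^sub>M M)" unfolding D_def by measurable
  define FF where "FF z = F (fst z) * cnj (F (snd z))" for z
  have FF: "integrable (M \<Otimes>\<^sub>M M) FF"
    using MM.integrable_mult_fst_snd[OF F, of "\<lambda>z. cnj (F z)"] F by (simp add: FF_def[abs_def] case_prod_beta')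
  have [measurable]: "FF \<in> borel_measurable (M \<Otimes>\<^sub>M M)" using FF by simp
  have int: "integrable M (\<lambda>z. F z * cis (a z))" if [measurable]: "a \<in> borel_measurable M" for a
    by (rule Bochner_Integration.integrable_bound[OF F]) (auto simp: norm_mult)
  have T2: "complex_of_real ((cmod (T x))\<^sup>2) = (LINT z|(M \<Otimes>\<^sub>M M). FF z * cis (x \<bullet> D z))" for x
  proof -
    have "complex_of_real ((cmod (T x))\<^sup>2) = T x * cnj (T x)" by (rule complex_norm_square)
    also have "cnj (T x) = (LINT z|M. cnj (F z * cis (- (2 * pi * (x \<bullet> \<Phi> z)))))"
      unfolding T_def by (rule Bochner_Integration.integral_cnj[symmetric])
    also have "T x * \<dots> = (LINT z|(M \<Otimes>\<^sub>M M). (case z of (z, w) \<Rightarrow> (F z * cis (- (2 * pi * (x \<bullet> \<Phi> z)))) * cnj (F w * cis (- (2 * pi * (x \<bullet> \<Phi> w))))))"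
      unfolding T_def by (rule MM.integral_mult_fst_snd[symmetric]) (intro integrable_cnj int, measurable)+
    also have "\<dots> = (LINT z|(M \<Otimes>\<^sub>M M). FF z * cis (x \<bullet> D z))"
    proof (rule Bochner_Integration.integral_cong)
      fix z
      have "cis (x \<bullet> D z) = cis (- (2 * pi * (x \<bullet> \<Phi> (fst z)))) * cis (2 * pi * (x \<bullet> \<Phi> (snd z)))"
        by (simp add: cis_mult D_def algebra_simps inner_diff_right)
      then show "(case z of (z, w) \<Rightarrow> (F z * cis (- (2 * pi * (x \<bullet> \<Phi> z)))) * cnj (F w * cis (- (2 * pi * (x \<bullet> \<Phi> w))))) = FF z * cis (x \<bullet> D z)"
        by (simp add: FF_def case_prod_beta cis_cnj)
    qed simp
    finally show ?thesis .
  qed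
  have Tb: "cmod (T x) \<le> (LINT z|M. cmod (F z))" for x
    unfolding T_def by (rule order_trans[OF integral_norm_bound]) (simp add: norm_mult)
  have gi: "integrable lborel (\<lambda>x. complex_of_real (gauss e x))"
    using integrable_gauss2[OF e, of 0] by simp
  have gi': "integrable lborel (gauss e)"
    using integrable_gauss2[OF e, of 0] by (simp add: complex_of_real_integrable_eq)
  have int1: "integrable lborel (\<lambda>x. gauss e x * (cmod (T x))\<^sup>2)"
  proof (rule Bochner_Integration.integrable_bound)
    show "integrable lborel (\<lambda>x. gauss e x * (LINT z|M. cmod (F z))\<^sup>2)"
      using gi' by simp
    show "AE x in lborel. norm (gauss e x * (cmod (T x))\<^sup>2) \<le> norm (gauss e x * (LINT z|M. cmod (F z))\<^sup>2)"
      using Tb gauss_pos[of e] by (auto simp: abs_mult intro!: mult_left_mono power_mono)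
  qed simp
  have int2: "integrable (lborel \<Otimes>\<^sub>M (M \<Otimes>\<^sub>M M)) (\<lambda>(x, z). complex_of_real (gauss e x) * (FF z * cis (x \<bullet> D z)))"
    by (rule Bochner_Integration.integrable_bound[OF L.integrable_mult_fst_snd[OF gi FF]])
       (auto simp: norm_mult)
  have "complex_of_real (LINT x|lborel. gauss e x * (cmod (T x))\<^sup>2) = (LINT x|lborel. complex_of_real (gauss e x) * complex_of_real ((cmod (T x))\<^sup>2))"
    by (simp add: integral_complex_of_real[symmetric] del: of_real_power)
  also have "\<dots> = (LINT x|lborel. (LINT z|(M \<Otimes>\<^sub>M M). complex_of_real (gauss e x) * (FF z * cis (x \<bullet> D z))))"
    unfolding T2 by simp
  also have "\<dots> = (LINT z|(M \<Otimes>\<^sub>M M). (LINT x|lborel. complex_of_real (gauss e x) * (FF z * cis (x \<bullet> D z))))"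
    by (rule L.Fubini_integral[OF int2, symmetric])
  also have "\<dots> = (LINT z|(M \<Otimes>\<^sub>M M). FF z * complex_of_real (gauss_hat e (D z)))"
  proof (rule Bochner_Integration.integral_cong)
    fix z
    have "(LINT x|lborel. complex_of_real (gauss e x) * (FF z * cis (x \<bullet> D z))) = (LINT x|lborel. FF z * (complex_of_real (gauss e x) * cis (x \<bullet> D z)))"
      by (simp add: mult_ac)
    then show "(LINT x|lborel. complex_of_real (gauss e x) * (FF z * cis (x \<bullet> D z))) = FF z * complex_of_real (gauss_hat e (D z))"
      using integral_gauss2[OF e] by simp
  qed simp
  finally have eq: "complex_of_real (LINT x|lborel. gauss e x * (cmod (T x))\<^sup>2) = (LINT z|(M \<Otimes>\<^sub>M M). FF z * complex_of_real (gauss_hat e (D z)))" .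
  show "integrable lborel (\<lambda>x. gauss e x * (cmod (T x))\<^sup>2)" by (rule int1)
  show "complex_of_real (LINT x|lborel. gauss e x * (cmod (T x))\<^sup>2) =
      (LINT z|(M \<Otimes>\<^sub>M M). F (fst z) * cnj (F (snd z)) * complex_of_real (gauss_hat e ((2 * pi) *\<^sub>R (\<Phi> (snd z) - \<Phi> (fst z)))))"
    unfolding eq by (simp add: FF_def D_def)
qed

text \<open>A Gaussian weight in \<open>x\<close> turns the square into a positive kernel of unit mass in the
  frequency, so that Schur's test applies and no inversion formula is needed.\<close>
lemma fourier_L2_bound:
  fixes M :: "'z measure" and \<Phi> :: "'z \<Rightarrow> real^2" and F :: "'z \<Rightarrow> complex"
  assumes "sigma_finite_measure M" and [measurable]: "\<Phi> \<in> borel_measurable M"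
    and F: "integrable M F" and C: "0 \<le> C"
    and schur: "\<And>e y. 0 < e \<Longrightarrow> (\<integral>\<^sup>+z. ennreal (gauss_hat e ((2 * pi) *\<^sub>R (\<Phi> z - y))) \<partial>M) \<le> ennreal C"
  shows "(\<integral>\<^sup>+x. ennreal ((cmod (LINT z|M. F z * cis (- (2 * pi * (x \<bullet> \<Phi> z)))))\<^sup>2) \<partial>lborel)
    \<le> ennreal C * (\<integral>\<^sup>+z. ennreal ((cmod (F z))\<^sup>2) \<partial>M)"
proof -
  interpret M: sigma_finite_measure M by fact
  interpret MM: pair_sigma_finite M M ..
  interpret L: pair_sigma_finite lborel "M \<Otimes>\<^sub>M M" ..
  have [measurable]: "F \<in> borel_measurable M" using F by simp
  define T where "T x = (LINT z|M. F z * cis (- (2 * pi * (x \<bullet> \<Phi> z))))" for x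
  have [measurable]: "T \<in> borel_measurable borel" unfolding T_def by measurable
  define D where "D z = (2 * pi) *\<^sub>R (\<Phi> (snd z) - \<Phi> (fst z))" for z
  have [measurable]: "D \<in> borel_measurable (M \<Otimes>\<^sub>M M)" unfolding D_def by measurable
  define FF where "FF z = F (fst z) * cnj (F (snd z))" for z
  have FF: "integrable (M \<Otimes>\<^sub>M M) FF"
    using MM.integrable_mult_fst_snd[OF F, of "\<lambda>z. cnj (F z)"] F by (simp add: FF_def[abs_def] case_prod_beta')
  have [measurable]: "FF \<in> borel_measurable (M \<Otimes>\<^sub>M M)" using FF by simp
  have main: "(\<integral>\<^sup>+x. ennreal (gauss e x) * ennreal ((cmod (T x))\<^sup>2) \<partial>lborel) \<le> ennreal C * (\<integral>\<^sup>+z. ennreal ((cmod (F z))\<^sup>2) \<partial>M)"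
    if e: "0 < e" for e
  proof -
    note int1 = gauss_weighted_square(1)[OF assms(1) assms(2) F e, folded T_def]
    have eq: "complex_of_real (LINT x|lborel. gauss e x * (cmod (T x))\<^sup>2) = (LINT z|(M \<Otimes>\<^sub>M M). FF z * complex_of_real (gauss_hat e (D z)))"
      using gauss_weighted_square(2)[OF assms(1) assms(2) F e] by (simp add: T_def FF_def D_def)
    have "(\<integral>\<^sup>+x. ennreal (gauss e x) * ennreal ((cmod (T x))\<^sup>2) \<partial>lborel) = (\<integral>\<^sup>+x. ennreal (gauss e x * (cmod (T x))\<^sup>2) \<partial>lborel)"
      using gauss_pos[of e] by (simp add: ennreal_mult' less_imp_le)
    also have "\<dots> = ennreal (LINT x|lborel. gauss e x * (cmod (T x))\<^sup>2)"
      by (rule nn_integral_eq_integral[OF int1]) (use gauss_pos[of e] in \<open>auto simp: less_imp_le\<close>)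
    also have "(LINT x|lborel. gauss e x * (cmod (T x))\<^sup>2) \<le> cmod (LINT z|(M \<Otimes>\<^sub>M M). FF z * complex_of_real (gauss_hat e (D z)))"
      unfolding eq[symmetric] by simp
    also have "ennreal \<dots> \<le> (\<integral>\<^sup>+z. ennreal (cmod (FF z * complex_of_real (gauss_hat e (D z)))) \<partial>(M \<Otimes>\<^sub>M M))"
    \<comment> \<open>A divergent Bochner integral has the value 0, so the bound holds in that case
      as well.\<close>
    proof (cases "integrable (M \<Otimes>\<^sub>M M) (\<lambda>z. FF z * complex_of_real (gauss_hat e (D z)))")
      case True then show ?thesis by (rule integral_norm_bound_ennreal)
    qed (simp add: not_integrable_integral_eq)
    also have "\<dots> = (\<integral>\<^sup>+z. \<integral>\<^sup>+w. ennreal (cmod (FF (z,w) * complex_of_real (gauss_hat e (D (z,w))))) \<partial>M \<partial>M)"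
      by (rule M.nn_integral_fst[symmetric]) measurable
    \<comment> \<open>Schur's test: \<open>a * b \<le> (a\<^sup>2 + b\<^sup>2) / 2\<close> separates
      the two factors, so that in each summand one variable occurs in the kernel only and can be
      integrated out.\<close>
    also have "\<dots> \<le> (\<integral>\<^sup>+z. \<integral>\<^sup>+w. ennreal (1/2) * (ennreal ((cmod (F z))\<^sup>2) * ennreal (gauss_hat e (D (z,w))) + ennreal ((cmod (F w))\<^sup>2) * ennreal (gauss_hat e (D (z,w)))) \<partial>M \<partial>M)"
    proof (intro nn_integral_mono)
      fix z w
      have "cmod (FF (z,w) * complex_of_real (gauss_hat e (D (z,w)))) = (cmod (F z) * cmod (F w)) * gauss_hat e (D (z,w))"
        using gauss_hat_nonneg by (simp add: FF_def norm_mult)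
      also have "\<dots> \<le> (((cmod (F z))\<^sup>2 + (cmod (F w))\<^sup>2) / 2) * gauss_hat e (D (z,w))"
        using sum_squares_bound[of "cmod (F z)" "cmod (F w)"] gauss_hat_nonneg by (intro mult_right_mono) auto
      finally have "cmod (FF (z,w) * complex_of_real (gauss_hat e (D (z,w)))) \<le> 1/2 * ((cmod (F z))\<^sup>2 * gauss_hat e (D (z,w)) + (cmod (F w))\<^sup>2 * gauss_hat e (D (z,w)))"
        by (simp add: field_simps)
      then have "ennreal (cmod (FF (z,w) * complex_of_real (gauss_hat e (D (z,w))))) \<le> ennreal (1/2 * ((cmod (F z))\<^sup>2 * gauss_hat e (D (z,w)) + (cmod (F w))\<^sup>2 * gauss_hat e (D (z,w))))"
        by (rule ennreal_leI)
      also have "\<dots> = ennreal (1/2) * (ennreal ((cmod (F z))\<^sup>2) * ennreal (gauss_hat e (D (z,w))) + ennreal ((cmod (F w))\<^sup>2) * ennreal (gauss_hat e (D (z,w))))"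
        using gauss_hat_nonneg by (subst ennreal_mult, simp, simp, subst ennreal_plus) (simp_all add: ennreal_mult del: ennreal_plus)
      finally show "ennreal (cmod (FF (z,w) * complex_of_real (gauss_hat e (D (z,w))))) \<le> \<dots>" .
    qed
    also have "\<dots> = ennreal (1/2) * ((\<integral>\<^sup>+z. \<integral>\<^sup>+w. ennreal ((cmod (F z))\<^sup>2) * ennreal (gauss_hat e (D (z,w))) \<partial>M \<partial>M) + (\<integral>\<^sup>+z. \<integral>\<^sup>+w. ennreal ((cmod (F w))\<^sup>2) * ennreal (gauss_hat e (D (z,w))) \<partial>M \<partial>M))"
      by (rule MM.nn_integral_cmult_add) measurable
    also have "(\<integral>\<^sup>+z. \<integral>\<^sup>+w. ennreal ((cmod (F w))\<^sup>2) * ennreal (gauss_hat e (D (z,w))) \<partial>M \<partial>M) = (\<integral>\<^sup>+w. \<integral>\<^sup>+z. ennreal ((cmod (F w))\<^sup>2) * ennreal (gauss_hat e (D (z,w))) \<partial>M \<partial>M)"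
      by (rule MM.Fubini'[symmetric]) simp
    also have "ennreal (1/2) * ((\<integral>\<^sup>+z. \<integral>\<^sup>+w. ennreal ((cmod (F z))\<^sup>2) * ennreal (gauss_hat e (D (z,w))) \<partial>M \<partial>M) + \<dots>) \<le> ennreal (1/2) * ((\<integral>\<^sup>+z. ennreal ((cmod (F z))\<^sup>2) * ennreal C \<partial>M) + (\<integral>\<^sup>+z. ennreal ((cmod (F z))\<^sup>2) * ennreal C \<partial>M))"
    proof (intro mult_left_mono add_mono nn_integral_mono)
      fix z
      have "(\<integral>\<^sup>+w. ennreal ((cmod (F z))\<^sup>2) * ennreal (gauss_hat e (D (z,w))) \<partial>M) = ennreal ((cmod (F z))\<^sup>2) * (\<integral>\<^sup>+w. ennreal (gauss_hat e ((2 * pi) *\<^sub>R (\<Phi> w - \<Phi> z))) \<partial>M)"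
        by (subst nn_integral_cmult) (auto simp: D_def)
      also have "\<dots> \<le> ennreal ((cmod (F z))\<^sup>2) * ennreal C"
        by (intro mult_left_mono schur e) auto
      finally show "(\<integral>\<^sup>+w. ennreal ((cmod (F z))\<^sup>2) * ennreal (gauss_hat e (D (z,w))) \<partial>M) \<le> \<dots>" .
      have sym: "gauss_hat e (D (w, z)) = gauss_hat e ((2 * pi) *\<^sub>R (\<Phi> w - \<Phi> z))" for w
        by (simp add: gauss_hat_def D_def inner_diff_left inner_diff_right inner_commute)
      have "(\<integral>\<^sup>+w. ennreal ((cmod (F z))\<^sup>2) * ennreal (gauss_hat e (D (w,z))) \<partial>M) \<le> ennreal ((cmod (F z))\<^sup>2) * (\<integral>\<^sup>+w. ennreal (gauss_hat e ((2 * pi) *\<^sub>R (\<Phi> w - \<Phi> z))) \<partial>M)"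
        unfolding sym by (subst nn_integral_cmult) auto
      also have "\<dots> \<le> ennreal ((cmod (F z))\<^sup>2) * ennreal C"
        by (intro mult_left_mono schur e) auto
      finally show "(\<integral>\<^sup>+w. ennreal ((cmod (F z))\<^sup>2) * ennreal (gauss_hat e (D (w,z))) \<partial>M) \<le> \<dots>" .
    qed auto
    also have "(\<integral>\<^sup>+z. ennreal ((cmod (F z))\<^sup>2) * ennreal C \<partial>M) = ennreal C * (\<integral>\<^sup>+z. ennreal ((cmod (F z))\<^sup>2) \<partial>M)"
      by (subst nn_integral_multc) (auto simp: mult.commute)
    also have "ennreal (1/2) * (ennreal C * (\<integral>\<^sup>+z. ennreal ((cmod (F z))\<^sup>2) \<partial>M) + ennreal C * (\<integral>\<^sup>+z. ennreal ((cmod (F z))\<^sup>2) \<partial>M)) = (ennreal (1/2) + ennreal (1/2)) * (ennreal C * (\<integral>\<^sup>+z. ennreal ((cmod (F z))\<^sup>2) \<partial>M))"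
      by (simp add: distrib_left distrib_right)
    also have "ennreal (1/2) + ennreal (1/2) = 1"
      by (subst ennreal_plus[symmetric]) auto
    finally show ?thesis by (simp add: ennreal_leI)
  qed
  have "(\<integral>\<^sup>+x. ennreal ((cmod (T x))\<^sup>2) \<partial>lborel) \<le> ennreal C * (\<integral>\<^sup>+z. ennreal ((cmod (F z))\<^sup>2) \<partial>M)"
    by (rule nn_integral_le_if_gauss_weighted_le) (use main in auto)
  then show ?thesis by (simp add: T_def)
qed

section \<open>Hausdorff-Young and Hardy-Littlewood-Sobolev\<close>

lemma nn_integral_powr_Ioo:
  fixes a y :: real
  assumes a: "-1 < a" and y: "0 \<le> y"
  shows "(\<integral>\<^sup>+l. ennreal (l powr a) * indicator {0<..<y} l \<partial>lborel) = ennreal (y powr (a + 1) / (a + 1))"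
proof -
  have "((\<lambda>u. u powr a) has_integral (y powr (a + 1) / (a + 1))) {0..y}"
    by (rule has_integral_powr_from_0) (use a y in auto)
  from nn_integral_has_integral_lebesgue[OF _ this]
  have *: "integral\<^sup>N lborel (\<lambda>u. ennreal (indicator {0..y} u * (u powr a))) = ennreal (y powr (a + 1) / (a + 1))"
    by (simp add: nn_integral_completion) 
  have "(\<integral>\<^sup>+l. ennreal (l powr a) * indicator {0<..<y} l \<partial>lborel) = integral\<^sup>N lborel (\<lambda>u. ennreal (indicator {0..y} u * (u powr a)))"
  proof (rule nn_integral_cong_AE)
    show "AE l in lborel. ennreal (l powr a) * indicator {0<..<y} l = ennreal (indicator {0..y} l * (l powr a))"
      using AE_lborel_singleton[of 0] AE_lborel_singleton[of y]
      by eventually_elim (auto simp: indicator_def)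
  qed
  then show ?thesis using * by simp
qed

text \<open>Real interpolation between the trivial bound \<open>L\<^sup>1 \<rightarrow> L\<^sup>\<infinity>\<close> and an \<open>L\<^sup>2\<close> bound: at height
  \<open>l\<close> the function is cut where its large part has \<open>L\<^sup>1\<close> norm at most \<open>l / 2\<close>.\<close>
lemma interpolated_Hausdorff_Young:
  fixes M :: "'z measure" and N :: "'x measure" and k :: "'x \<Rightarrow> 'z \<Rightarrow> complex" and F :: "'z \<Rightarrow> complex"
  assumes "sigma_finite_measure M" "sigma_finite_measure N"
    and k[measurable]: "(\<lambda>(x, z). k x z) \<in> borel_measurable (N \<Otimes>\<^sub>M M)"
    and k1: "\<And>x z. cmod (k x z) \<le> 1"
    and C: "0 \<le> C"
    and L2: "\<And>G. integrable M G \<Longrightarrow>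
      (\<integral>\<^sup>+x. ennreal ((cmod (LINT z|M. G z * k x z))\<^sup>2) \<partial>N) \<le> ennreal C * (\<integral>\<^sup>+z. ennreal ((cmod (G z))\<^sup>2) \<partial>M)"
    and m: "1 < m" "m < 2" and F: "integrable M F"
    and A: "0 < A" "(\<integral>\<^sup>+z. ennreal (cmod (F z) powr m) \<partial>M) \<le> ennreal A"
  shows "(\<integral>\<^sup>+x. ennreal (cmod (LINT z|M. F z * k x z) powr (m / (m - 1))) \<partial>N)
    \<le> ennreal (4 * (m / (m - 1)) * C * (2 powr (m / (m - 1) - 2) / (m / (m - 1) - 2)) * A powr (m / (m - 1) - 1))"
proof -
  interpret M: sigma_finite_measure M by fact
  interpret N: sigma_finite_measure N by fact
  interpret NM: pair_sigma_finite N M ..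
  interpret LN: pair_sigma_finite "lborel :: real measure" N ..
  interpret LM: pair_sigma_finite "lborel :: real measure" M ..
  define r where "r = m / (m - 1)"
  have r: "2 < r" using m by (simp add: r_def field_simps)
  have r1: "r - 1 = 1 / (m - 1)" and r2: "(m - 1) * (r - 2) = 2 - m"
    using m by (auto simp: r_def field_simps)
  have [measurable]: "F \<in> borel_measurable M" using F by simp
  \<comment> \<open>Where \<open>cmod (F z)\<close> exceeds this threshold it is at most
    \<open>l / (2 * A)\<close> times its own \<open>m\<close>-th power; hence the removed part has
    L1 norm at most \<open>l / 2\<close>.\<close>
  define a where "a l = (2 * A / l) powr (1 / (m - 1))" for l
  have [measurable]: "a \<in> borel_measurable borel" unfolding a_def by measurable
  define G where "G l z = (if cmod (F z) \<le> a l then F z else 0)" for l z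
  have [measurable]: "(\<lambda>(l, z). G l z) \<in> borel_measurable (borel \<Otimes>\<^sub>M M)" unfolding G_def by measurable
  have Gint: "integrable M (G l)" for l
    by (rule Bochner_Integration.integrable_bound[OF F]) (auto simp: G_def)
  have kint: "integrable M (\<lambda>z. H z * k x z)" if "integrable M H" "x \<in> space N" for H x
  proof (rule Bochner_Integration.integrable_bound[OF that(1)])
    show "AE z in M. norm (H z * k x z) \<le> norm (H z)"
      using mult_left_mono[OF k1] by (auto simp: norm_mult)
    have [measurable]: "(\<lambda>z. k x z) \<in> borel_measurable M"
      using measurable_compose[OF measurable_Pair1'[OF that(2)] k] by simp
    show "(\<lambda>z. H z * k x z) \<in> borel_measurable M" using that(1) by measurable
  qed
  define T where "T H x = (LINT z|M. H z * k x z)" for H x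
  have [measurable]: "T F \<in> borel_measurable N" unfolding T_def by measurable
  have [measurable]: "(\<lambda>(l, x). T (G l) x) \<in> borel_measurable (borel \<Otimes>\<^sub>M N)" unfolding T_def by measurable
  have tail: "cmod (T F x) \<le> cmod (T (G l) x) + l / 2" if l: "0 < l" and x: "x \<in> space N" for l x
  proof -
    have al: "0 < a l" and al': "a l powr (m - 1) = 2 * A / l" using A l m by (auto simp: a_def powr_powr)
    have FG: "integrable M (\<lambda>z. F z - G l z)" using F Gint by simp
    have "T (\<lambda>z. F z - G l z) x = T F x - T (G l) x"
      unfolding T_def by (simp add: left_diff_distrib kint F Gint x)
    then have "T F x = T (G l) x + T (\<lambda>z. F z - G l z) x" by simp
    moreover have "ennreal (cmod (T (\<lambda>z. F z - G l z) x)) \<le> ennreal (l / 2)"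
    proof -
      have "ennreal (cmod (T (\<lambda>z. F z - G l z) x)) \<le> (\<integral>\<^sup>+z. ennreal (cmod ((F z - G l z) * k x z)) \<partial>M)"
        unfolding T_def by (intro integral_norm_bound_ennreal kint FG x)
      also have "\<dots> \<le> (\<integral>\<^sup>+z. ennreal (l / (2 * A)) * ennreal (cmod (F z) powr m) \<partial>M)"
      proof (intro nn_integral_mono)
        fix z
        have "cmod ((F z - G l z) * k x z) \<le> cmod (F z - G l z)"
          using mult_left_mono[OF k1] by (auto simp: norm_mult)
        also have "\<dots> \<le> l / (2 * A) * cmod (F z) powr m"
        proof (cases "cmod (F z) \<le> a l")
          case True then show ?thesis using l A by (simp add: G_def)
        next
          case False
          have "2 * A / l \<le> cmod (F z) powr (m - 1)"
            unfolding al'[symmetric] using False al m by (intro powr_mono2) auto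
          then have "2 * A / l * cmod (F z) \<le> cmod (F z) powr (m - 1) * cmod (F z)"
            by (intro mult_right_mono) auto
          also have "\<dots> = cmod (F z) powr m" using False al by (simp add: powr_diff)
          finally show ?thesis using False l A by (simp add: G_def field_simps)
        qed
        finally show "ennreal (cmod ((F z - G l z) * k x z)) \<le> ennreal (l / (2 * A)) * ennreal (cmod (F z) powr m)"
          using l A by (subst ennreal_mult[symmetric]) (auto intro: ennreal_leI)
      qed
      also have "\<dots> = ennreal (l / (2 * A)) * (\<integral>\<^sup>+z. ennreal (cmod (F z) powr m) \<partial>M)"
        by (rule nn_integral_cmult) simp
      also have "\<dots> \<le> ennreal (l / (2 * A)) * ennreal A"
        by (intro mult_left_mono A) auto
      also have "\<dots> = ennreal (l / 2)" using l A by (simp add: ennreal_mult[symmetric])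
      finally show ?thesis .
    qed
    ultimately show ?thesis using l norm_triangle_ineq[of "T (G l) x" "T (\<lambda>z. F z - G l z) x"]
      by (simp add: ennreal_le_iff)
  qed
  \<comment> \<open>Layer-cake formula. For \<open>l < cmod (T F x)\<close> the truncated part still
    has modulus at least \<open>l / 2\<close>, so the factor
    \<open>4 * (cmod (T (G l) x))\<^sup>2 / l\<^sup>2\<close>, which is at least 1 there, may be
    inserted.\<close>
  have pw: "ennreal (cmod (T F x) powr r) \<le> (\<integral>\<^sup>+l. ennreal (4 * r * l powr (r - 3)) * indicator {0<..} l * ennreal ((cmod (T (G l) x))\<^sup>2) \<partial>lborel)"
    if x: "x \<in> space N" for x
  proof -
    have "ennreal (cmod (T F x) powr r) = ennreal r * (\<integral>\<^sup>+l. ennreal (l powr (r - 1)) * indicator {0<..<cmod (T F x)} l \<partial>lborel)"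
      using r by (subst nn_integral_powr_Ioo) (auto simp: ennreal_mult[symmetric])
    also have "\<dots> = (\<integral>\<^sup>+l. ennreal r * (ennreal (l powr (r - 1)) * indicator {0<..<cmod (T F x)} l) \<partial>lborel)"
      by (rule nn_integral_cmult[symmetric]) simp
    also have "\<dots> \<le> (\<integral>\<^sup>+l. ennreal (4 * r * l powr (r - 3)) * indicator {0<..} l * ennreal ((cmod (T (G l) x))\<^sup>2) \<partial>lborel)"
    proof (rule nn_integral_mono)
      fix l :: real
      show "ennreal r * (ennreal (l powr (r - 1)) * indicator {0<..<cmod (T F x)} l) \<le> ennreal (4 * r * l powr (r - 3)) * indicator {0<..} l * ennreal ((cmod (T (G l) x))\<^sup>2)"
      proof (cases "0 < l \<and> l < cmod (T F x)")
        case True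
        then have l: "0 < l" by simp
        have "l / 2 \<le> cmod (T (G l) x)" using tail[OF l x] True by simp
        then have "(l / 2)\<^sup>2 \<le> (cmod (T (G l) x))\<^sup>2" using l by (intro power_mono) auto
        then have "r * (l powr (r - 3) * l\<^sup>2) \<le> r * (l powr (r - 3) * (4 * (cmod (T (G l) x))\<^sup>2))"
          using r by (intro mult_left_mono) (auto simp: power_divide)
        moreover have "l powr (r - 3) * l\<^sup>2 = l powr (r - 1)"
          using l by (simp add: powr_add[symmetric] flip: powr_numeral)
        ultimately have "r * l powr (r - 1) \<le> 4 * r * l powr (r - 3) * (cmod (T (G l) x))\<^sup>2" by (simp add: mult_ac)
        then show ?thesis using True r by (simp add: ennreal_mult[symmetric] ennreal_leI)
      qed simp
    qed
    finally show ?thesis .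
  qed
  have "(\<integral>\<^sup>+x. ennreal (cmod (T F x) powr r) \<partial>N) \<le> (\<integral>\<^sup>+x. \<integral>\<^sup>+l. ennreal (4 * r * l powr (r - 3)) * indicator {0<..} l * ennreal ((cmod (T (G l) x))\<^sup>2) \<partial>lborel \<partial>N)"
    by (intro nn_integral_mono pw)
  also have "\<dots> = (\<integral>\<^sup>+l. \<integral>\<^sup>+x. ennreal (4 * r * l powr (r - 3)) * indicator {0<..} l * ennreal ((cmod (T (G l) x))\<^sup>2) \<partial>N \<partial>lborel)"
    by (rule LN.Fubini') measurable
  also have "\<dots> \<le> (\<integral>\<^sup>+l. \<integral>\<^sup>+z. ennreal (4 * r * l powr (r - 3)) * indicator {0<..} l * (ennreal C * ennreal ((cmod (G l z))\<^sup>2)) \<partial>M \<partial>lborel)"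
  proof (rule nn_integral_mono)
    fix l :: real
    have "(\<integral>\<^sup>+x. ennreal (4 * r * l powr (r - 3)) * indicator {0<..} l * ennreal ((cmod (T (G l) x))\<^sup>2) \<partial>N) = ennreal (4 * r * l powr (r - 3)) * indicator {0<..} l * (\<integral>\<^sup>+x. ennreal ((cmod (T (G l) x))\<^sup>2) \<partial>N)"
      by (rule nn_integral_cmult) measurable
    also have "\<dots> \<le> ennreal (4 * r * l powr (r - 3)) * indicator {0<..} l * (ennreal C * (\<integral>\<^sup>+z. ennreal ((cmod (G l z))\<^sup>2) \<partial>M))"
      unfolding T_def by (intro mult_left_mono L2 Gint) auto
    also have "\<dots> = (\<integral>\<^sup>+z. ennreal (4 * r * l powr (r - 3)) * indicator {0<..} l * (ennreal C * ennreal ((cmod (G l z))\<^sup>2)) \<partial>M)"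
      by (simp add: nn_integral_cmult)
    finally show "(\<integral>\<^sup>+x. ennreal (4 * r * l powr (r - 3)) * indicator {0<..} l * ennreal ((cmod (T (G l) x))\<^sup>2) \<partial>N) \<le> \<dots>" .
  qed
  also have "\<dots> = (\<integral>\<^sup>+z. \<integral>\<^sup>+l. ennreal (4 * r * l powr (r - 3)) * indicator {0<..} l * (ennreal C * ennreal ((cmod (G l z))\<^sup>2)) \<partial>lborel \<partial>M)"
    by (rule LM.Fubini'[symmetric]) measurable
  also have "\<dots> \<le> (\<integral>\<^sup>+z. ennreal (4 * r * C * ((2 * A) powr (r - 2) / (r - 2))) * ennreal (cmod (F z) powr m) \<partial>M)"
  proof (rule nn_integral_mono)
    fix z
    define y where "y = cmod (F z)"
    show "(\<integral>\<^sup>+l. ennreal (4 * r * l powr (r - 3)) * indicator {0<..} l * (ennreal C * ennreal ((cmod (G l z))\<^sup>2)) \<partial>lborel) \<le> ennreal (4 * r * C * ((2 * A) powr (r - 2) / (r - 2))) * ennreal (cmod (F z) powr m)"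
    proof (cases "y = 0")
      case True
      then have "G l z = 0" for l by (simp add: G_def y_def)
      then show ?thesis by simp
    next
      case False
      then have y: "0 < y" by (simp add: y_def)
      \<comment> \<open>For fixed \<open>z\<close> the truncation keeps \<open>F z\<close> exactly
        at the heights \<open>l \<le> b\<close>. The remaining height integral converges at 0
        because \<open>r - 3 > -1\<close>, that is \<open>m < 2\<close>.\<close>
      define b where "b = 2 * A * y powr (1 - m)"
      have b: "0 < b" using A y by (simp add: b_def)
      have "(\<integral>\<^sup>+l. ennreal (4 * r * l powr (r - 3)) * indicator {0<..} l * (ennreal C * ennreal ((cmod (G l z))\<^sup>2)) \<partial>lborel)
        \<le> (\<integral>\<^sup>+l. ennreal (4 * r * C * y\<^sup>2) * (ennreal (l powr (r - 3)) * indicator {0<..<b} l) \<partial>lborel)"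
      proof (rule nn_integral_mono_AE)
        show "AE l in lborel. ennreal (4 * r * l powr (r - 3)) * indicator {0<..} l * (ennreal C * ennreal ((cmod (G l z))\<^sup>2)) \<le> ennreal (4 * r * C * y\<^sup>2) * (ennreal (l powr (r - 3)) * indicator {0<..<b} l)"
          using AE_lborel_singleton[of b]
        proof eventually_elim
          fix l :: real assume lb: "l \<noteq> b"
          show "ennreal (4 * r * l powr (r - 3)) * indicator {0<..} l * (ennreal C * ennreal ((cmod (G l z))\<^sup>2)) \<le> ennreal (4 * r * C * y\<^sup>2) * (ennreal (l powr (r - 3)) * indicator {0<..<b} l)"
          proof (cases "0 < l \<and> y \<le> a l")
            case True
            then have l: "0 < l" by simp
            have "y powr (m - 1) \<le> a l powr (m - 1)" using True y m by (intro powr_mono2) auto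
            also have "\<dots> = 2 * A / l" using A l m by (simp add: a_def powr_powr)
            finally have "l * y powr (m - 1) \<le> 2 * A" using l by (simp add: field_simps)
            then have "l * y powr (m - 1) * y powr (1 - m) \<le> b" unfolding b_def by (intro mult_right_mono) auto
            then have "l \<le> b" using y by (simp add: mult.assoc powr_add[symmetric])
            then have "l < b" using lb by simp
            then show ?thesis using True C r by (simp add: G_def y_def ennreal_mult[symmetric] mult_ac)
          next
            case False
            then show ?thesis by (auto simp: G_def y_def)
          qed
        qed
      qed
      also have "\<dots> = ennreal (4 * r * C * y\<^sup>2) * ennreal (b powr (r - 2) / (r - 2))"
        using nn_integral_powr_Ioo[of "r - 3" b] r b by (subst nn_integral_cmult) auto
      also have "\<dots> = ennreal (4 * r * C * (y\<^sup>2 * b powr (r - 2) / (r - 2)))"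
        using r C b by (simp add: ennreal_mult[symmetric] mult_ac)
      also have "y\<^sup>2 * b powr (r - 2) / (r - 2) = (2 * A) powr (r - 2) / (r - 2) * y powr m"
      proof -
        have "b powr (r - 2) = (2 * A) powr (r - 2) * y powr (- (2 - m))"
          using A y unfolding b_def by (subst powr_mult) (auto simp: powr_powr r2[symmetric] algebra_simps)
        moreover have "y powr 2 * y powr (- (2 - m)) = y powr m" unfolding powr_add[symmetric] by simp
        ultimately show ?thesis using y by simp
      qed
      also have "ennreal (4 * r * C * ((2 * A) powr (r - 2) / (r - 2) * y powr m)) = ennreal (4 * r * C * ((2 * A) powr (r - 2) / (r - 2))) * ennreal (cmod (F z) powr m)"
        using r C by (subst ennreal_mult[symmetric]) (auto simp: y_def mult_ac)
      finally show ?thesis .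
    qed
  qed
  also have "\<dots> = ennreal (4 * r * C * ((2 * A) powr (r - 2) / (r - 2))) * (\<integral>\<^sup>+z. ennreal (cmod (F z) powr m) \<partial>M)"
    by (rule nn_integral_cmult) simp
  also have "\<dots> \<le> ennreal (4 * r * C * ((2 * A) powr (r - 2) / (r - 2))) * ennreal A"
    by (intro mult_left_mono A) auto
  also have "\<dots> = ennreal (4 * r * C * (2 powr (r - 2) / (r - 2)) * A powr (r - 1))"
  proof -
    have "A powr (r - 2) * A = A powr (r - 1)" using A powr_add[of A "r - 2" 1] by simp
    then show ?thesis using A r C by (simp add: ennreal_mult[symmetric] powr_mult mult_ac)
  qed
  finally show ?thesis unfolding T_def r_def .
qed

text \<open>Young's inequality for the conjugate exponents \<open>2 / (2 - b)\<close> and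
  \<open>2 / b\<close>. It suffices to see which of \<open>v\<close> and
  \<open>w powr (-(2 - b))\<close> is larger, since the larger one absorbs the product.\<close>

lemma young_split:
  fixes v w b :: real
  assumes b: "0 < b" "b < 1" and v: "0 \<le> v" and w: "0 < w"
  shows "v * w powr (-b) \<le> v powr (2 / (2 - b)) + w powr (-2)"
proof (cases "v \<le> w powr (-(2-b))")
  case True
  have "v * w powr (-b) \<le> w powr (-(2-b)) * w powr (-b)"
    using True by (intro mult_right_mono) auto
  also have "\<dots> = w powr (-2)" by (simp add: powr_add[symmetric])
  finally show ?thesis by (smt (verit) powr_ge_zero)
next
  case False
  then have v0: "v > 0" by (smt (verit) powr_ge_zero)
  have "- (2 - b) * (b / (2 - b)) = - b" using b by (simp add: divide_simps) (simp add: algebra_simps)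
  then have "w powr (-b) = (w powr (-(2-b))) powr (b/(2-b))"
    by (simp only: powr_powr)
  also have "\<dots> \<le> v powr (b/(2-b))" using False b by (intro powr_mono2) auto
  finally have "v * w powr (-b) \<le> v * v powr (b/(2-b))" using v0 by simp
  also have "\<dots> = v powr (1 + b/(2-b))" using v0 by (simp add: powr_add)
  also have "1 + b/(2-b) = 2/(2-b)" using b by (simp add: field_simps)
  finally show ?thesis by (smt (verit) powr_ge_zero)
qed

lemma nn_integral_abs_powr_near:
  fixes b d s :: real
  assumes b: "0 < b" "b < 1" and d: "0 < d"
  shows "(\<integral>\<^sup>+t. ennreal (\<bar>s - t\<bar> powr (-b)) * indicator {t. \<bar>s - t\<bar> < d} t \<partial>lborel) \<le> ennreal (2 * d powr (1 - b) / (1 - b))"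
proof -
  have one: "(\<integral>\<^sup>+u. ennreal (u powr (-b)) * indicator {0..d} u \<partial>lborel) = ennreal (d powr (1 - b) / (1 - b))"
  proof -
    have "((\<lambda>u. u powr (-b)) has_integral (d powr (-b + 1) / (-b + 1))) {0..d}"
      by (rule has_integral_powr_from_0) (use b d in auto)
    from nn_integral_has_integral_lebesgue[OF _ this]
    have "integral\<^sup>N lborel (\<lambda>u. ennreal (indicator {0..d} u * (u powr (-b)))) = ennreal (d powr (1 - b) / (1 - b))"
      by (simp add: nn_integral_completion) 
    moreover have "ennreal (indicator S u * x) = ennreal x * indicator S u" for S and u x :: real
      by (auto simp: indicator_def)
    ultimately show ?thesis by simp
  qed
  have "(\<integral>\<^sup>+t. ennreal (\<bar>s - t\<bar> powr (-b)) * indicator {t. \<bar>s - t\<bar> < d} t \<partial>lborel)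
     \<le> (\<integral>\<^sup>+t. ennreal ((s - t) powr (-b)) * indicator {0..d} (s - t) + ennreal ((t - s) powr (-b)) * indicator {0..d} (t - s) \<partial>lborel)"
    by (intro nn_integral_mono) (auto simp: indicator_def)
  also have "\<dots> = (\<integral>\<^sup>+t. ennreal ((s - t) powr (-b)) * indicator {0..d} (s - t) \<partial>lborel) + (\<integral>\<^sup>+t. ennreal ((t - s) powr (-b)) * indicator {0..d} (t - s) \<partial>lborel)"
    by (intro nn_integral_add) auto
  also have "(\<integral>\<^sup>+t. ennreal ((s - t) powr (-b)) * indicator {0..d} (s - t) \<partial>lborel) = (\<integral>\<^sup>+u. ennreal (u powr (-b)) * indicator {0..d} u \<partial>lborel)"
    by (subst nn_integral_real_affine[where c="-1" and t=s and f="\<lambda>t. ennreal ((s - t) powr (-b)) * indicator {0..d} (s - t)"]) auto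
  also have "(\<integral>\<^sup>+t. ennreal ((t - s) powr (-b)) * indicator {0..d} (t - s) \<partial>lborel) = (\<integral>\<^sup>+u. ennreal (u powr (-b)) * indicator {0..d} u \<partial>lborel)"
    by (subst nn_integral_real_affine[where c="1" and t=s and f="\<lambda>t. ennreal ((t - s) powr (-b)) * indicator {0..d} (t - s)"]) auto
  finally show ?thesis unfolding one using b d by (simp add: ennreal_plus[symmetric] del: ennreal_plus)
qed

lemma nn_integral_abs_powr_far:
  fixes d s :: real
  assumes d: "0 < d"
  shows "(\<integral>\<^sup>+t. ennreal (\<bar>s - t\<bar> powr (-2)) * indicator {t. d \<le> \<bar>s - t\<bar>} t \<partial>lborel) \<le> ennreal (2 / d)"
proof -
  have one: "(\<integral>\<^sup>+u. ennreal (u powr (-2)) * indicator {d..} u \<partial>lborel) = ennreal (1 / d)"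
  proof -
    have "((\<lambda>u. u powr (-2)) has_integral -(d powr (-2 + 1)) / (-2 + 1)) {d..}"
      by (rule has_integral_powr_to_inf) (use d in auto)
    from nn_integral_has_integral_lebesgue[OF _ this]
    have "integral\<^sup>N lborel (\<lambda>u. ennreal (indicator {d..} u * (u powr (-2)))) = ennreal (1 / d)"
      using d by (simp add: nn_integral_completion powr_minus divide_inverse) 
    moreover have "ennreal (indicator S u * x) = ennreal x * indicator S u" for S and u x :: real
      by (auto simp: indicator_def)
    ultimately show ?thesis by simp
  qed
  have "(\<integral>\<^sup>+t. ennreal (\<bar>s - t\<bar> powr (-2)) * indicator {t. d \<le> \<bar>s - t\<bar>} t \<partial>lborel)
     \<le> (\<integral>\<^sup>+t. ennreal ((s - t) powr (-2)) * indicator {d..} (s - t) + ennreal ((t - s) powr (-2)) * indicator {d..} (t - s) \<partial>lborel)"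
    by (intro nn_integral_mono) (auto simp: indicator_def abs_if)
  also have "\<dots> = (\<integral>\<^sup>+t. ennreal ((s - t) powr (-2)) * indicator {d..} (s - t) \<partial>lborel) + (\<integral>\<^sup>+t. ennreal ((t - s) powr (-2)) * indicator {d..} (t - s) \<partial>lborel)"
    by (intro nn_integral_add) auto
  also have "(\<integral>\<^sup>+t. ennreal ((s - t) powr (-2)) * indicator {d..} (s - t) \<partial>lborel) = (\<integral>\<^sup>+u. ennreal (u powr (-2)) * indicator {d..} u \<partial>lborel)"
    by (subst nn_integral_real_affine[where c="-1" and t=s and f="\<lambda>t. ennreal ((s - t) powr (-2)) * indicator {d..} (s - t)"]) auto
  also have "(\<integral>\<^sup>+t. ennreal ((t - s) powr (-2)) * indicator {d..} (t - s) \<partial>lborel) = (\<integral>\<^sup>+u. ennreal (u powr (-2)) * indicator {d..} u \<partial>lborel)"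
    by (subst nn_integral_real_affine[where c="1" and t=s and f="\<lambda>t. ennreal ((t - s) powr (-2)) * indicator {d..} (t - s)"]) auto
  finally show ?thesis unfolding one using d by (simp add: ennreal_plus[symmetric] del: ennreal_plus)
qed

text \<open>The splitting radius \<open>d = A / l powr a\<close> in the proof is the size of the level set allowed by
  Chebyshev's inequality.\<close>
lemma truncated_potential_bound:
  fixes h :: "real \<Rightarrow> real" and b l A s :: real
  assumes b: "0 < b" "b < 1" and [measurable]: "h \<in> borel_measurable borel"
    and h0: "\<And>t. 0 \<le> h t" and A: "0 < A" "(\<integral>\<^sup>+t. ennreal (h t powr (2/(2-b))) \<partial>lborel) \<le> ennreal A"
    and l: "0 < l"
  shows "(\<integral>\<^sup>+t. ennreal (min (h t) l * \<bar>s - t\<bar> powr (-b)) \<partial>lborel)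
    \<le> ennreal ((2 / (1 - b) + 3) * A powr (1 - b) * l powr (2/(2-b) - 1))"
proof -
  define a where "a = 2/(2-b)"
  define d where "d = A / l powr a"
  have d: "0 < d" using A l by (simp add: d_def)
  \<comment> \<open>Near the diagonal \<open>h\<close> is replaced by its cap \<open>l\<close>. Away
    from it the cap is dropped and \<open>young_split\<close> is applied to \<open>h t / l\<close>
    and \<open>\<bar>s - t\<bar> / d\<close>, which separates \<open>h\<close> from an integrable
    kernel.\<close>
  have pw: "min (h t) l * \<bar>s - t\<bar> powr (-b) \<le> l * (\<bar>s - t\<bar> powr (-b) * indicator {t. \<bar>s - t\<bar> < d} t)
     + l * d powr (-b) * ((h t powr a) / l powr a + d powr 2 * (\<bar>s - t\<bar> powr (-2) * indicator {t. d \<le> \<bar>s - t\<bar>} t))" for t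
  proof (cases "\<bar>s - t\<bar> < d")
    case True
    have "min (h t) l * \<bar>s - t\<bar> powr (-b) \<le> l * \<bar>s - t\<bar> powr (-b)"
      by (intro mult_right_mono) auto
    moreover have "0 \<le> l * d powr (-b) * ((h t powr a) / l powr a)" using l by auto
    ultimately show ?thesis using True by (auto simp: indicator_def)
  next
    case False
    have "min (h t) l * \<bar>s - t\<bar> powr (-b) \<le> h t * \<bar>s - t\<bar> powr (-b)"
      by (intro mult_right_mono) auto
    also have "\<dots> = l * d powr (-b) * ((h t / l) * (\<bar>s - t\<bar> / d) powr (-b))"
      using l d by (subst powr_divide) auto
    also have "\<dots> \<le> l * d powr (-b) * ((h t / l) powr a + (\<bar>s - t\<bar> / d) powr (-2))"
      unfolding a_def using l h0 False d b by (intro mult_left_mono young_split) auto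
    also have "\<dots> = l * d powr (-b) * ((h t powr a) / l powr a + d powr 2 * \<bar>s - t\<bar> powr (-2))"
      using l h0 d by (subst (1 2) powr_divide) (auto simp: powr_minus field_simps)
    finally show ?thesis using False by auto
  qed
  have "(\<integral>\<^sup>+t. ennreal (min (h t) l * \<bar>s - t\<bar> powr (-b)) \<partial>lborel) \<le>
    (\<integral>\<^sup>+t. ennreal l * (ennreal (\<bar>s - t\<bar> powr (-b)) * indicator {t. \<bar>s - t\<bar> < d} t)
     + ennreal (l * d powr (-b)) * (ennreal (1 / l powr a) * ennreal (h t powr a) + ennreal (d powr 2) * (ennreal (\<bar>s - t\<bar> powr (-2)) * indicator {t. d \<le> \<bar>s - t\<bar>} t)) \<partial>lborel)"
  proof (rule nn_integral_mono)
    fix t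
    have "ennreal (min (h t) l * \<bar>s - t\<bar> powr (-b)) \<le> ennreal (l * (\<bar>s - t\<bar> powr (-b) * indicator {t. \<bar>s - t\<bar> < d} t)
     + l * d powr (-b) * ((h t powr a) / l powr a + d powr 2 * (\<bar>s - t\<bar> powr (-2) * indicator {t. d \<le> \<bar>s - t\<bar>} t)))"
      using pw[of t] by (rule ennreal_leI)
    also have "\<dots> = ennreal l * (ennreal (\<bar>s - t\<bar> powr (-b)) * indicator {t. \<bar>s - t\<bar> < d} t)
     + ennreal (l * d powr (-b)) * (ennreal (1 / l powr a) * ennreal (h t powr a) + ennreal (d powr 2) * (ennreal (\<bar>s - t\<bar> powr (-2)) * indicator {t. d \<le> \<bar>s - t\<bar>} t))"
      using l d by (simp add: ennreal_mult' ennreal_plus divide_inverse mult.commute ennreal_indicator[symmetric] del: ennreal_indicator)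
    finally show "ennreal (min (h t) l * \<bar>s - t\<bar> powr (-b)) \<le> \<dots>" .
  qed
  also have "\<dots> = ennreal l * (\<integral>\<^sup>+t. ennreal (\<bar>s - t\<bar> powr (-b)) * indicator {t. \<bar>s - t\<bar> < d} t \<partial>lborel)
     + ennreal (l * d powr (-b)) * (ennreal (1 / l powr a) * (\<integral>\<^sup>+t. ennreal (h t powr a) \<partial>lborel) + ennreal (d powr 2) * (\<integral>\<^sup>+t. ennreal (\<bar>s - t\<bar> powr (-2)) * indicator {t. d \<le> \<bar>s - t\<bar>} t \<partial>lborel))"
    by (simp add: nn_integral_add nn_integral_cmult)
  also have "\<dots> \<le> ennreal l * ennreal (2 * d powr (1 - b) / (1 - b))
     + ennreal (l * d powr (-b)) * (ennreal (1 / l powr a) * ennreal A + ennreal (d powr 2) * ennreal (2 / d))"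
    by (intro add_mono mult_left_mono nn_integral_abs_powr_near nn_integral_abs_powr_far A(2)[folded a_def] b d) auto
  also have "\<dots> = ennreal (l * (2 * d powr (1 - b) / (1 - b)) + l * d powr (-b) * (1 / l powr a * A + d powr 2 * (2 / d)))"
    using l d b A by (simp add: ennreal_mult'[symmetric] ennreal_plus[symmetric] del: ennreal_plus)
  also have "l * (2 * d powr (1 - b) / (1 - b)) + l * d powr (-b) * (1 / l powr a * A + d powr 2 * (2 / d)) = (2 / (1 - b) + 3) * (l * d powr (1 - b))"
  proof -
    have "1 / l powr a * A + d powr 2 * (2 / d) = 3 * d"
      using d by (simp add: d_def[symmetric] power2_eq_square)
    moreover have "d powr (-b) * d = d powr (1 - b)"
      using d by (simp add: powr_diff powr_minus field_simps)
    ultimately show ?thesis using b by (simp add: algebra_simps)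
  qed
  also have "l * d powr (1 - b) = A powr (1 - b) * l powr (a - 1)"
  proof -
    have "l * d powr (1 - b) = A powr (1 - b) * (l powr 1 * l powr (-(a * (1 - b))))"
    proof -
      have "d powr (1 - b) = A powr (1 - b) / l powr (a * (1 - b))"
        using A l by (simp add: d_def powr_divide powr_powr)
      then show ?thesis using l by (simp only: powr_minus_divide) simp
    qed
    also have "l powr 1 * l powr (-(a * (1 - b))) = l powr (1 - a * (1 - b))"
      by (simp only: powr_add[symmetric]) simp
    \<comment> \<open>By \<open>a * (2 - b) = 2\<close>. With this exponent the bound at
      \<open>l = h s\<close>, multiplied by \<open>h s\<close>, is a multiple of
      \<open>h s powr a\<close>.\<close>
    also have "1 - a * (1 - b) = a - 1" using b by (simp add: a_def field_simps)
    finally show ?thesis .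
  qed
  finally show ?thesis by (simp add: a_def mult.assoc)
qed

text \<open>By symmetry the smaller of the values \<open>h s\<close> and \<open>h t\<close> may be
  put into the inner integral, where truncation at the height of the larger one does not change it.
  The truncated bound then returns \<open>h s powr a\<close>, whose integral is at most
  \<open>A\<close>.\<close>

lemma HLS_diagonal:
  fixes h :: "real \<Rightarrow> real" and b A :: real
  assumes b: "0 < b" "b < 1" and [measurable]: "h \<in> borel_measurable borel"
    and h0: "\<And>t. 0 \<le> h t" and A: "0 < A" "(\<integral>\<^sup>+t. ennreal (h t powr (2/(2-b))) \<partial>lborel) \<le> ennreal A"
  shows "(\<integral>\<^sup>+s. \<integral>\<^sup>+t. ennreal (h s * h t * \<bar>s - t\<bar> powr (-b)) \<partial>lborel \<partial>lborel)
    \<le> ennreal (2 * (2 / (1 - b) + 3) * A powr (2 - b))"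
proof -
  define a where "a = 2/(2-b)"
  define K where "K = 2 / (1 - b) + 3"
  have K: "K > 0" using b by (simp add: K_def field_simps)
  define P where "P s t = ennreal (h s * (min (h t) (h s) * \<bar>s - t\<bar> powr (-b)))" for s t
  have [measurable]: "(\<lambda>(s,t). P s t) \<in> borel_measurable (borel \<Otimes>\<^sub>M borel)"
    unfolding P_def by measurable
  have P1: "(\<integral>\<^sup>+s. \<integral>\<^sup>+t. P s t \<partial>lborel \<partial>lborel) \<le> ennreal (K * A powr (2 - b))"
  proof -
    have "(\<integral>\<^sup>+s. \<integral>\<^sup>+t. P s t \<partial>lborel \<partial>lborel) \<le> (\<integral>\<^sup>+s. ennreal (K * A powr (1 - b)) * ennreal (h s powr a) \<partial>lborel)"
    proof (rule nn_integral_mono)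
      fix s
      show "(\<integral>\<^sup>+t. P s t \<partial>lborel) \<le> ennreal (K * A powr (1 - b)) * ennreal (h s powr a)"
      proof (cases "h s = 0")
        case True then show ?thesis by (simp add: P_def)
      next
        case False
        then have hs: "h s > 0" using h0[of s] by simp
        have "(\<integral>\<^sup>+t. P s t \<partial>lborel) = ennreal (h s) * (\<integral>\<^sup>+t. ennreal (min (h t) (h s) * \<bar>s - t\<bar> powr (-b)) \<partial>lborel)"
          unfolding P_def using hs by (subst nn_integral_cmult[symmetric]) (auto simp: ennreal_mult')
        also have "\<dots> \<le> ennreal (h s) * ennreal (K * A powr (1 - b) * h s powr (a - 1))"
          unfolding K_def a_def
          by (intro mult_left_mono truncated_potential_bound b h0 A hs) auto
        also have "\<dots> = ennreal (K * A powr (1 - b)) * ennreal (h s powr a)"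
          using hs K by (simp add: ennreal_mult'[symmetric] powr_diff field_simps)
        finally show ?thesis .
      qed
    qed
    also have "\<dots> = ennreal (K * A powr (1 - b)) * (\<integral>\<^sup>+s. ennreal (h s powr a) \<partial>lborel)"
      by (rule nn_integral_cmult) auto
    also have "\<dots> \<le> ennreal (K * A powr (1 - b)) * ennreal A"
      using A(2) by (intro mult_left_mono) (auto simp: a_def)
    also have "\<dots> = ennreal (K * A powr (2 - b))"
      using A K powr_add[of A "1 - b" 1] by (simp add: ennreal_mult'[symmetric] mult.assoc)
    finally show ?thesis .
  qed
  have "(\<integral>\<^sup>+s. \<integral>\<^sup>+t. ennreal (h s * h t * \<bar>s - t\<bar> powr (-b)) \<partial>lborel \<partial>lborel)
    \<le> (\<integral>\<^sup>+s. \<integral>\<^sup>+t. P s t + P t s \<partial>lborel \<partial>lborel)"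
  proof (intro nn_integral_mono)
    fix s t
    have "h s * h t * \<bar>s - t\<bar> powr (-b) \<le> h s * (min (h t) (h s) * \<bar>s - t\<bar> powr (-b)) + h t * (min (h s) (h t) * \<bar>t - s\<bar> powr (-b))"
      using h0[of s] h0[of t] by (auto simp: min_def abs_minus_commute mult.assoc mult_nonneg_nonneg)
    moreover have "0 \<le> h s * (min (h t) (h s) * \<bar>s - t\<bar> powr (-b))" "0 \<le> h t * (min (h s) (h t) * \<bar>t - s\<bar> powr (-b))"
      using h0 by auto
    ultimately show "ennreal (h s * h t * \<bar>s - t\<bar> powr (-b)) \<le> P s t + P t s"
      unfolding P_def by (simp add: ennreal_plus[symmetric] ennreal_leI del: ennreal_plus)
  qed
  also have "\<dots> = (\<integral>\<^sup>+s. \<integral>\<^sup>+t. P s t \<partial>lborel \<partial>lborel) + (\<integral>\<^sup>+s. \<integral>\<^sup>+t. P t s \<partial>lborel \<partial>lborel)"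
    by (subst nn_integral_add[symmetric]) (auto simp: nn_integral_add[symmetric])
  also have "(\<integral>\<^sup>+s. \<integral>\<^sup>+t. P t s \<partial>lborel \<partial>lborel) = (\<integral>\<^sup>+s. \<integral>\<^sup>+t. P s t \<partial>lborel \<partial>lborel)"
    by (rule lborel_pair.Fubini') simp
  also have "(\<integral>\<^sup>+s. \<integral>\<^sup>+t. P s t \<partial>lborel \<partial>lborel) + (\<integral>\<^sup>+s. \<integral>\<^sup>+t. P s t \<partial>lborel \<partial>lborel) \<le> ennreal (K * A powr (2 - b)) + ennreal (K * A powr (2 - b))"
    by (intro add_mono P1)
  also have "\<dots> = ennreal (2 * K * A powr (2 - b))"
    using K by (simp add: ennreal_plus[symmetric] del: ennreal_plus)
  finally show ?thesis by (simp add: K_def)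
qed

section \<open>Sums of two points on an arc\<close>

text \<open>The Jacobian formula turns the left side into the integral of \<open>h\<close> over the
  image of \<open>S\<close>, which is only a part of the plane.\<close>

lemma nn_integral_change_of_variables_le:
  fixes g :: "real^2 \<Rightarrow> real^2" and h :: "real^2 \<Rightarrow> real"
  assumes S: "S \<in> sets borel"
    and der: "\<And>x. x \<in> S \<Longrightarrow> (g has_derivative g' x) (at x within S)"
    and inj: "inj_on g S"
    and h: "h \<in> borel_measurable borel" "\<And>x. 0 \<le> h x" "(\<integral>\<^sup>+x. ennreal (h x) \<partial>lborel) < \<infinity>"
    and m: "(\<lambda>x. \<bar>det (matrix (g' x))\<bar> * h (g x)) \<in> borel_measurable borel"
  shows "(\<integral>\<^sup>+x. ennreal (\<bar>det (matrix (g' x))\<bar> * h (g x)) * indicator S x \<partial>lborel) \<le> (\<integral>\<^sup>+x. ennreal (h x) \<partial>lborel)"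
proof -
  note [measurable] = S h(1) m
  let ?k = "\<lambda>x. \<bar>det (matrix (g' x))\<bar> * h (g x)"
  \<comment> \<open>The change of variables theorem is about functions with values in some
    \<open>real^'n\<close>, so \<open>h\<close> is read as a function into
    \<open>real^1\<close>.\<close>
  let ?lift = "\<lambda>x. vec (h x) :: real^1"
  have S': "S \<in> sets lebesgue" using S by (simp add: sets_completionI_sets)
  have hi: "integrable lborel h"
    using h by (intro integrableI_bounded) auto
  then have hi': "integrable lebesgue h"
    by (simp add: integrable_completion)
  have gS: "g ` S \<in> sets lebesgue"
    using der S' by (intro differentiable_image_in_sets_lebesgue) (auto simp: differentiable_on_def differentiable_def)
  have h1: "h absolutely_integrable_on UNIV"
    using hi' by (simp add: set_integrable_def)
  then have h2: "h absolutely_integrable_on (g ` S)"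
    by (rule set_integrable_subset) (use gS in auto)
  have "?lift absolutely_integrable_on (g ` S) \<and> integral (g ` S) ?lift = vec (integral (g ` S) h)"
    using h2 unfolding absolutely_integrable_on_1_iff integral_on_1_eq by simp
  then have "(\<lambda>x. \<bar>det (matrix (g' x))\<bar> *\<^sub>R ?lift (g x)) absolutely_integrable_on S \<and>
     integral S (\<lambda>x. \<bar>det (matrix (g' x))\<bar> *\<^sub>R ?lift (g x)) = vec (integral (g ` S) h)"
    by (subst has_absolute_integral_change_of_variables[OF S' der inj])
  then have k: "?k absolutely_integrable_on S" "integral S ?k = integral (g ` S) h"
    unfolding absolutely_integrable_on_1_iff integral_on_1_eq by simp_all
  have "(\<integral>\<^sup>+x. ennreal (?k x) * indicator S x \<partial>lborel) = (\<integral>\<^sup>+x. ennreal (?k x) * indicator S x \<partial>lebesgue)"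
    by (rule nn_integral_completion[symmetric])
  also have "\<dots> = (\<integral>\<^sup>+x. ennreal (indicator S x *\<^sub>R ?k x) \<partial>lebesgue)"
    by (intro nn_integral_cong) (auto simp: indicator_def)
  also have "\<dots> = ennreal (LINT x|lebesgue. indicator S x *\<^sub>R ?k x)"
    using k(1) h(2) by (intro nn_integral_eq_integral) (auto simp: set_integrable_def)
  also have "(LINT x|lebesgue. indicator S x *\<^sub>R ?k x) = integral S ?k"
    using set_lebesgue_integral_eq_integral(2)[OF k(1)] by (simp add: set_lebesgue_integral_def)
  also have "\<dots> = integral (g ` S) h" by (rule k(2))
  also have "\<dots> \<le> integral UNIV h"
    using h1 h2 h(2) by (intro integral_subset_le) (auto intro: set_lebesgue_integral_eq_integral)
  also have "\<dots> = (LINT x|lebesgue. h x)"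
    using set_lebesgue_integral_eq_integral(2)[OF h1] by (simp add: set_lebesgue_integral_def)
  also have "\<dots> = (LINT x|lborel. h x)"
    by (rule integral_completion) simp
  also have "ennreal \<dots> = (\<integral>\<^sup>+x. ennreal (h x) \<partial>lborel)"
    by (rule nn_integral_eq_integral[symmetric]) (use hi h in auto)
  finally show ?thesis by (simp add: ennreal_leI)
qed

text \<open>The derivative \<open>cos x - 1 / 2\<close> of the difference is nonnegative up to
  \<open>pi / 3\<close>.\<close>

lemma sin_ge_half:
  fixes x :: real assumes "0 \<le> x" "x \<le> pi / 3"
  shows "x / 2 \<le> sin x"
proof -
  have "sin 0 - 0 / 2 \<le> sin x - x / 2"
  proof (rule DERIV_nonneg_imp_nondecreasing[OF assms(1)])
    fix y assume y: "0 \<le> y" "y \<le> x"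
    have "cos (pi / 3) \<le> cos y" using y assms by (intro cos_monotone_0_pi_le) auto
    then show "\<exists>d. ((\<lambda>x. sin x - x / 2) has_real_derivative d) (at y) \<and> 0 \<le> d"
      by (intro exI[of _ "cos y - 1/2"]) (auto intro!: derivative_eq_intros simp: cos_60)
  qed
  then show ?thesis by simp
qed

lemma sin_2pi_ge:
  fixes u :: real assumes "0 \<le> u" "u \<le> 1/8"
  shows "u \<le> sin (2 * pi * u)"
proof -
  have "pi * u \<le> pi * (1/6)" using assms by (intro mult_left_mono) auto
  then have "2 * pi * u / 2 \<le> sin (2 * pi * u)" using assms by (intro sin_ge_half) auto
  moreover have "1 * u \<le> pi * u" using assms pi_gt3 by (intro mult_right_mono) auto
  ultimately show ?thesis by simp
qed

lemma cos_2pi_pos: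
  fixes u :: real assumes "\<bar>u\<bar> \<le> 1/8"
  shows "0 < cos (2 * pi * u)"
proof -
  have "pi * u \<le> pi * (1/8)" "pi * (-1/8) \<le> pi * u" using assms by (intro mult_left_mono; simp add: abs_le_iff)+
  then show ?thesis using pi_gt_zero by (intro cos_gt_zero_pi) linarith+
qed

lemma cis_2pi_eq_imp_eq:
  fixes s t :: real
  assumes "cis (2 * pi * s) = cis (2 * pi * t)" "\<bar>s - t\<bar> \<le> 1/8"
  shows "s = t"
proof -
  have "cis (2 * pi * \<bar>s - t\<bar>) = 1"
    using assms(1) by (cases "t \<le> s") (simp_all add: right_diff_distrib flip: cis_divide)
  then have "sin (2 * pi * \<bar>s - t\<bar>) = 0" by (simp add: complex_eq_iff)
  then show ?thesis using sin_2pi_ge[of "\<bar>s - t\<bar>"] assms(2) by simp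
qed

text \<open>On the unit circle conjugation is inversion, so the conjugate of a sum times the product
  of the summands is the sum again. A nonzero sum thus determines the product, and both pairs are
  the roots of one quadratic polynomial.\<close>

lemma unit_sum_eq:
  fixes z1 z2 w1 w2 :: complex
  assumes "cmod z1 = 1" "cmod z2 = 1" "cmod w1 = 1" "cmod w2 = 1"
    and eq: "z1 + z2 = w1 + w2" and nz: "z1 + z2 \<noteq> 0"
  shows "z1 = w1 \<or> z1 = w2"
proof -
  have u: "z * cnj z = 1" if "cmod z = 1" for z using complex_norm_square[of z] that by simp
  have p: "cnj (a + b) * (a * b) = a + b" if "cmod a = 1" "cmod b = 1" for a b
  proof -
    have "cnj (a + b) * (a * b) = (a * cnj a) * b + (b * cnj b) * a" by (simp add: algebra_simps)
    then show ?thesis using u that by simp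
  qed
  have "cnj (z1 + z2) * (z1 * z2) = cnj (z1 + z2) * (w1 * w2)"
    using p[of z1 z2] p[of w1 w2] assms by simp
  then have "z1 * z2 = w1 * w2" using nz by (metis complex_cnj_zero_iff mult_left_cancel)
  moreover have "(z1 - w1) * (z1 - w2) = z1 * z1 - z1 * (w1 + w2) + w1 * w2" by (simp add: algebra_simps)
  moreover have "z1 * z1 - z1 * (z1 + z2) + z1 * z2 = 0" by (simp add: algebra_simps)
  ultimately have "(z1 - w1) * (z1 - w2) = 0" unfolding eq by simp
  then show ?thesis by auto
qed

text \<open>Arcs of an eighth of the circle contain no antipodal points, and there
  \<open>u \<le> sin (2 * pi * u)\<close> for the distance \<open>u\<close> of two parameters.\<close>
definition arc_pairs :: "real \<Rightarrow> (real^2) set" where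
  "arc_pairs c = {x. x $ 2 < x $ 1 \<and> x $ 1 \<in> {c..<c+1/8} \<and> x $ 2 \<in> {c..<c+1/8}}"

lemma sets_arc_pairs [measurable]: "arc_pairs c \<in> sets borel"
  unfolding arc_pairs_def by measurable

text \<open>A nonzero sum determines the unordered pair of points by \<open>unit_sum_eq\<close>, and
  the sum does not vanish because an arc holds no antipodal points. The condition
  \<open>x $ 2 < x $ 1\<close> then excludes the swapped pair.\<close>

lemma inj_on_circ_sum: "inj_on (\<lambda>x. circ (x $ 1) + circ (x $ 2)) (arc_pairs c)"
proof (rule inj_onI)
  fix x y assume x: "x \<in> arc_pairs c" and y: "y \<in> arc_pairs c"
    and eq: "circ (x $ 1) + circ (x $ 2) = circ (y $ 1) + circ (y $ 2)"
  let ?c = "\<lambda>s. cis (2 * pi * s)"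
  have eq': "?c (x $ 1) + ?c (x $ 2) = ?c (y $ 1) + ?c (y $ 2)"
    using arg_cong[OF eq, of "\<lambda>v. v $ 1"] arg_cong[OF eq, of "\<lambda>v. v $ 2"] by (simp add: complex_eq_iff)
  have nz: "?c (x $ 1) + ?c (x $ 2) \<noteq> 0"
  proof
    assume "?c (x $ 1) + ?c (x $ 2) = 0"
    then have "?c (x $ 1) = - ?c (x $ 2)" by (simp add: add_eq_0_iff2)
    then have "?c (x $ 1) / ?c (x $ 2) = -1" by simp
    then have "cos (2 * pi * (x $ 1 - x $ 2)) = -1" by (simp add: cis_divide complex_eq_iff right_diff_distrib)
    moreover have "0 < cos (2 * pi * (x $ 1 - x $ 2))" using x by (intro cos_2pi_pos) (auto simp: arc_pairs_def)
    ultimately show False by simp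
  qed
  have d: "\<bar>x $ 1 - y $ 1\<bar> \<le> 1/8" "\<bar>x $ 1 - y $ 2\<bar> \<le> 1/8" "\<bar>x $ 2 - y $ 1\<bar> \<le> 1/8" "\<bar>x $ 2 - y $ 2\<bar> \<le> 1/8"
    using x y unfolding arc_pairs_def mem_Collect_eq atLeastLessThan_iff by linarith+
  have "?c (x $ 1) = ?c (y $ 1) \<or> ?c (x $ 1) = ?c (y $ 2)"
    by (rule unit_sum_eq[OF _ _ _ _ eq' nz]) simp_all
  then show "x = y"
  proof
    assume e: "?c (x $ 1) = ?c (y $ 1)"
    then have "?c (x $ 2) = ?c (y $ 2)" using eq' by simp
    then have "x $ 1 = y $ 1" "x $ 2 = y $ 2"
      using cis_2pi_eq_imp_eq[OF e d(1)] cis_2pi_eq_imp_eq[OF _ d(4)] by blast+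
    then show ?thesis by (simp add: vec_eq_iff forall_2)
  next
    assume e: "?c (x $ 1) = ?c (y $ 2)"
    then have "?c (x $ 2) = ?c (y $ 1)" using eq' by simp
    then have "x $ 1 = y $ 2" "x $ 2 = y $ 1"
      using cis_2pi_eq_imp_eq[OF e d(2)] cis_2pi_eq_imp_eq[OF _ d(3)] by blast+
    then show ?thesis using x y by (simp add: arc_pairs_def)
  qed
qed

text \<open>Up to sign the Jacobian determinant is
  \<open>4 * pi\<^sup>2 * sin (2 * pi * (x $ 1 - x $ 2))\<close>, which dominates
  \<open>x $ 1 - x $ 2\<close> on \<open>arc_pairs c\<close>.\<close>

lemma nn_integral_circ_sum_le:
  fixes h :: "real^2 \<Rightarrow> real"
  assumes h: "h \<in> borel_measurable borel" "\<And>x. 0 \<le> h x" "(\<integral>\<^sup>+x. ennreal (h x) \<partial>lborel) < \<infinity>"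
  shows "(\<integral>\<^sup>+x. ennreal ((x $ 1 - x $ 2) * h (circ (x $ 1) + circ (x $ 2))) * indicator (arc_pairs c) x \<partial>lborel)
    \<le> (\<integral>\<^sup>+x. ennreal (h x) \<partial>lborel)"
proof -
  note [measurable] = h(1)
  define g' where "g' x = (\<lambda>v::real^2. pt (- (2 * pi * sin (2 * pi * (x $ 1)) * (v $ 1)) - 2 * pi * sin (2 * pi * (x $ 2)) * (v $ 2),
     2 * pi * cos (2 * pi * (x $ 1)) * (v $ 1) + 2 * pi * cos (2 * pi * (x $ 2)) * (v $ 2)))" for x :: "real^2"
  have der: "((\<lambda>x::real^2. circ (x $ 1) + circ (x $ 2)) has_derivative g' x) (at x within T)" for x T
  proof (rule has_derivative_componentwise_within[THEN iffD2], rule ballI)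
    fix b :: "real^2" assume "b \<in> Basis"
    then obtain i where b: "b = axis i 1" by (auto simp: Basis_vec_def)
    show "((\<lambda>x. (circ (x $ 1) + circ (x $ 2)) \<bullet> b) has_derivative (\<lambda>v. g' x v \<bullet> b)) (at x within T)"
      unfolding b inner_axis using exhaust_2[of i]
      by (auto simp: g'_def intro!: derivative_eq_intros bounded_linear.has_derivative[OF bounded_linear_vec_nth] simp: algebra_simps)
  qed
  have det: "det (matrix (g' x)) = - (4 * pi\<^sup>2 * sin (2 * pi * (x $ 1 - x $ 2)))" for x
    by (simp add: det_2 matrix_def g'_def axis_def right_diff_distrib sin_diff power2_eq_square algebra_simps)
  have "(\<integral>\<^sup>+x. ennreal ((x $ 1 - x $ 2) * h (circ (x $ 1) + circ (x $ 2))) * indicator (arc_pairs c) x \<partial>lborel)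
     \<le> (\<integral>\<^sup>+x. ennreal (\<bar>det (matrix (g' x))\<bar> * h (circ (x $ 1) + circ (x $ 2))) * indicator (arc_pairs c) x \<partial>lborel)"
  proof (rule nn_integral_mono)
    fix x :: "real^2"
    show "ennreal ((x $ 1 - x $ 2) * h (circ (x $ 1) + circ (x $ 2))) * indicator (arc_pairs c) x \<le> ennreal (\<bar>det (matrix (g' x))\<bar> * h (circ (x $ 1) + circ (x $ 2))) * indicator (arc_pairs c) x"
    proof (cases "x \<in> arc_pairs c")
      case True
      then have "x $ 1 - x $ 2 \<le> sin (2 * pi * (x $ 1 - x $ 2))" and u: "0 \<le> x $ 1 - x $ 2"
        by (auto simp: arc_pairs_def intro!: sin_2pi_ge)
      moreover have "1 \<le> pi\<^sup>2" using pi_gt3 by (intro one_le_power) simp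
      ultimately have "1 * (x $ 1 - x $ 2) \<le> (4 * pi\<^sup>2) * sin (2 * pi * (x $ 1 - x $ 2))"
        by (intro mult_mono) auto
      then have "x $ 1 - x $ 2 \<le> \<bar>det (matrix (g' x))\<bar>" unfolding det by simp
      then show ?thesis using h(2) by (auto intro!: mult_right_mono ennreal_leI)
    qed simp
  qed
  also have "\<dots> \<le> (\<integral>\<^sup>+x. ennreal (h x) \<partial>lborel)"
    by (rule nn_integral_change_of_variables_le[OF sets_arc_pairs der inj_on_circ_sum h]) (simp add: det)
  finally show ?thesis .
qed

section \<open>Hoelder and Minkowski inequalities\<close>

text \<open>With the junk values \<open>epowr 0 a = 0\<close> and \<open>epowr \<infinity> a = \<infinity>\<close> also for \<open>a \<le> 0\<close>.\<close>
definition epowr :: "ennreal \<Rightarrow> real \<Rightarrow> ennreal" where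
  "epowr x a = (if x = \<infinity> then \<infinity> else ennreal (enn2real x powr a))"

lemma epowr_ennreal [simp]: "0 \<le> x \<Longrightarrow> epowr (ennreal x) a = ennreal (x powr a)"
  by (simp add: epowr_def)

lemma epowr_top [simp]: "epowr \<infinity> a = \<infinity>" "epowr top a = top"
  by (simp_all add: epowr_def)

lemma epowr_0 [simp]: "epowr 0 a = 0"
  by (simp add: epowr_def)

lemma epowr_mono: "0 \<le> a \<Longrightarrow> x \<le> y \<Longrightarrow> epowr x a \<le> epowr y a"
  by (cases x; cases y) (auto simp: powr_mono2 ennreal_le_iff top_unique)

lemma epowr_epowr: "epowr (epowr x a) b = epowr x (a * b)"
  by (cases x) (auto simp: powr_powr)

lemma epowr_one [simp]: "epowr x 1 = x"
  by (cases x) auto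

lemma epowr_cmult: "0 \<le> c \<Longrightarrow> epowr (ennreal c * x) a = ennreal (c powr a) * epowr x a"
  by (cases x; cases "c = 0") (auto simp: ennreal_mult'[symmetric] powr_mult ennreal_mult_top)

lemma epowr_eq_0_iff: "epowr x a = 0 \<longleftrightarrow> x = 0"
  by (cases x) auto

lemma measurable_epowr [measurable]: "(\<lambda>x. epowr x a) \<in> borel_measurable borel"
  unfolding epowr_def by measurable

text \<open>Young's inequality after dividing both functions by their norms; vanishing and infinite
  norms, which do not admit this normalisation, are treated apart.\<close>

lemma nn_integral_Holder:
  fixes f g :: "'a \<Rightarrow> real"
  assumes [measurable]: "f \<in> borel_measurable M" "g \<in> borel_measurable M"
    and nn: "\<And>x. 0 \<le> f x" "\<And>x. 0 \<le> g x"
    and p: "1 < p" and q: "1 < q" and pq: "1/p + 1/q = 1"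
  shows "(\<integral>\<^sup>+x. ennreal (f x * g x) \<partial>M) \<le> epowr (\<integral>\<^sup>+x. ennreal (f x powr p) \<partial>M) (1/p) * epowr (\<integral>\<^sup>+x. ennreal (g x powr q) \<partial>M) (1/q)"
    (is "?L \<le> epowr ?F _ * epowr ?G _")
proof -
  consider "?F = 0" | "?G = 0" | "?F \<noteq> 0" "?G \<noteq> 0" "?F = \<infinity> \<or> ?G = \<infinity>" | "?F \<noteq> 0" "?G \<noteq> 0" "?F \<noteq> \<infinity>" "?G \<noteq> \<infinity>"
    by blast
  then show ?thesis
  proof cases
    case 1
    then have "AE x in M. f x = 0" by (simp add: nn_integral_0_iff_AE)
    then have "AE x in M. ennreal (f x * g x) = 0" by eventually_elim simp
    then have "?L = 0" by (subst nn_integral_0_iff_AE) auto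
    then show ?thesis by simp
  next
    case 2
    then have "AE x in M. g x = 0" by (simp add: nn_integral_0_iff_AE)
    then have "AE x in M. ennreal (f x * g x) = 0" by eventually_elim simp
    then have "?L = 0" by (subst nn_integral_0_iff_AE) auto
    then show ?thesis by simp
  next
    case 3
    then have "epowr ?F (1/p) * epowr ?G (1/q) = \<infinity>"
      by (auto simp: ennreal_mult_eq_top_iff epowr_eq_0_iff)
    then show ?thesis by simp
  next
    case 4
    have ex: "\<exists>r>0. x = ennreal r" if "x \<noteq> 0" "x \<noteq> \<infinity>" for x
      using that by (cases x) (auto simp: less_le)
    obtain A B where A: "?F = ennreal A" "0 < A" and B: "?G = ennreal B" "0 < B"
      using ex[OF 4(1,3)] ex[OF 4(2,4)] by blast
    define a b where "a = A powr (1/p)" and "b = B powr (1/q)"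
    have ab: "0 < a" "0 < b" "a powr p = A" "b powr q = B"
      using A B p q by (auto simp: a_def b_def powr_powr)
    have "?L \<le> (\<integral>\<^sup>+x. ennreal (a * b / (p * A)) * ennreal (f x powr p) + ennreal (a * b / (q * B)) * ennreal (g x powr q) \<partial>M)"
    proof (rule nn_integral_mono)
      fix x
      have "(f x / a) * (g x / b) \<le> (f x / a) powr p / p + (g x / b) powr q / q"
        using nn ab p q pq by (intro Youngs_inequality) auto
      also have "\<dots> = f x powr p / (p * A) + g x powr q / (q * B)"
        using nn ab by (simp add: powr_divide mult.commute)
      finally have "(a * b) * ((f x / a) * (g x / b)) \<le> (a * b) * (f x powr p / (p * A) + g x powr q / (q * B))"
        using ab by (intro mult_left_mono) auto
      then have "f x * g x \<le> a * b / (p * A) * f x powr p + a * b / (q * B) * g x powr q"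
        using ab by (simp add: field_simps)
      then show "ennreal (f x * g x) \<le> ennreal (a * b / (p * A)) * ennreal (f x powr p) + ennreal (a * b / (q * B)) * ennreal (g x powr q)"
        using ab A B p q by (simp add: ennreal_mult[symmetric] ennreal_plus[symmetric] ennreal_leI del: ennreal_plus)
    qed
    also have "\<dots> = ennreal (a * b / (p * A)) * ?F + ennreal (a * b / (q * B)) * ?G"
      by (simp add: nn_integral_add nn_integral_cmult)
    also have "\<dots> = ennreal (a * b / p + a * b / q)"
      unfolding A B using A B ab p q by (simp add: ennreal_mult[symmetric] ennreal_plus[symmetric] del: ennreal_plus)
    also have "a * b / p + a * b / q = a * b * (1/p + 1/q)" by (simp add: algebra_simps)
    also have "\<dots> = a * b" by (simp add: pq)
    finally show ?thesis unfolding A B using A B by (simp add: a_def b_def ennreal_mult[symmetric])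
  qed
qed

text \<open>Self-duality: in the integral of \<open>P powr s\<close> one factor \<open>P\<close> is
  written out as an integral over \<open>x\<close>, the order is exchanged, and Hoelder's inequality
  in \<open>y\<close> gives \<open>I \<le> I powr (1 - 1/s) * K\<close>. The power of
  \<open>I\<close> can be divided off once \<open>I\<close> is finite.\<close>

lemma nn_integral_Minkowski:
  fixes H :: "'x \<Rightarrow> 'y \<Rightarrow> real"
  assumes "sigma_finite_measure M" "finite_measure N"
    and H[measurable]: "(\<lambda>(x, y). H x y) \<in> borel_measurable (M \<Otimes>\<^sub>M N)"
    and H0: "\<And>x y. 0 \<le> H x y" and s: "1 \<le> s"
  shows "(\<integral>\<^sup>+y. epowr (\<integral>\<^sup>+x. ennreal (H x y) \<partial>M) s \<partial>N)
    \<le> epowr (\<integral>\<^sup>+x. epowr (\<integral>\<^sup>+y. ennreal (H x y powr s) \<partial>N) (1/s) \<partial>M) s"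
proof -
  interpret M: sigma_finite_measure M by fact
  interpret N: finite_measure N by fact
  interpret MN: pair_sigma_finite M N ..
  interpret NM: pair_sigma_finite N M ..
  define P where "P y = (\<integral>\<^sup>+x. ennreal (H x y) \<partial>M)" for y
  define B where "B x = epowr (\<integral>\<^sup>+y. ennreal (H x y powr s) \<partial>N) (1/s)" for x
  define K where "K = (\<integral>\<^sup>+x. B x \<partial>M)"
  have [measurable]: "(\<lambda>(y, x). H x y) \<in> borel_measurable (N \<Otimes>\<^sub>M M)"
    using measurable_pair_swap[OF H] by simp
  have [measurable]: "P \<in> borel_measurable N" unfolding P_def by measurable
  have [measurable]: "B \<in> borel_measurable M" unfolding B_def by measurable
  show ?thesis
  proof (cases "s = 1")
    case True
    have "(\<integral>\<^sup>+y. \<integral>\<^sup>+x. ennreal (H x y) \<partial>M \<partial>N) = (\<integral>\<^sup>+x. \<integral>\<^sup>+y. ennreal (H x y) \<partial>N \<partial>M)"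
      by (rule MN.Fubini') simp
    then show ?thesis using True H0 by simp
  next
    case False
    then have s1: "1 < s" using s by simp
    show ?thesis
    proof (cases "K = \<infinity>")
      case True then show ?thesis by (simp add: K_def B_def)
    next
      case K: False
      \<comment> \<open>Capping \<open>P\<close> at \<open>n\<close> makes the integral of its
        \<open>s\<close>-th power finite, since \<open>N\<close> is a finite measure.\<close>
      define Q where "Q n y = enn2real (min (P y) (of_nat n))" for n :: nat and y
      have Qe: "ennreal (Q n y) = min (P y) (of_nat n)" for n y
        unfolding Q_def by (simp add: ennreal_enn2real_if min_def)  (auto simp: top_unique ennreal_of_nat_eq_real_of_nat)
      have Q0: "0 \<le> Q n y" for n y by (simp add: Q_def)
      have Qn: "Q n y \<le> real n" for n y
        unfolding Q_def by (rule enn2real_leI) (auto simp: ennreal_of_nat_eq_real_of_nat)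
      have [measurable]: "Q n \<in> borel_measurable N" for n unfolding Q_def by measurable
      define I where "I n = (\<integral>\<^sup>+y. ennreal (Q n y powr s) \<partial>N)" for n
      have Ifin: "I n < \<infinity>" for n
      proof -
        have "I n \<le> (\<integral>\<^sup>+y. ennreal (real n powr s) \<partial>N)"
          unfolding I_def using Q0 Qn s by (intro nn_integral_mono ennreal_leI powr_mono2) auto
        also have "\<dots> < \<infinity>" by (simp add: N.emeasure_eq_measure ennreal_mult[symmetric])
        finally show ?thesis .
      qed
      have dual: "1 / (s / (s - 1)) + 1 / s = 1" using s1 by (simp add: field_simps)
      have ineq: "I n \<le> epowr (I n) (1 - 1/s) * K" for n
      proof -
        have "I n \<le> (\<integral>\<^sup>+y. ennreal (Q n y powr (s - 1)) * P y \<partial>N)"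
          unfolding I_def
        proof (rule nn_integral_mono)
          fix y
          have "Q n y powr s = Q n y powr (s - 1) * Q n y"
            using Q0[of n y] powr_add[of "Q n y" "s - 1" 1] by (cases "Q n y = 0") auto
          then have "ennreal (Q n y powr s) = ennreal (Q n y powr (s - 1)) * ennreal (Q n y)"
            using Q0 by (simp add: ennreal_mult)
          also have "\<dots> \<le> ennreal (Q n y powr (s - 1)) * P y"
            unfolding Qe by (intro mult_left_mono) auto
          finally show "ennreal (Q n y powr s) \<le> \<dots>" .
        qed
        also have "\<dots> = (\<integral>\<^sup>+y. \<integral>\<^sup>+x. ennreal (Q n y powr (s - 1)) * ennreal (H x y) \<partial>M \<partial>N)"
          unfolding P_def by (intro nn_integral_cong nn_integral_cmult[symmetric]) measurable
        also have "\<dots> = (\<integral>\<^sup>+x. \<integral>\<^sup>+y. ennreal (Q n y powr (s - 1)) * ennreal (H x y) \<partial>N \<partial>M)"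
          by (rule MN.Fubini') measurable
        also have "\<dots> \<le> (\<integral>\<^sup>+x. epowr (I n) (1 - 1/s) * B x \<partial>M)"
        proof (rule nn_integral_mono)
          fix x assume [measurable]: "x \<in> space M"
          have "(\<integral>\<^sup>+y. ennreal (Q n y powr (s - 1)) * ennreal (H x y) \<partial>N) = (\<integral>\<^sup>+y. ennreal (Q n y powr (s - 1) * H x y) \<partial>N)"
            using H0 by (simp add: ennreal_mult)
          also have "\<dots> \<le> epowr (\<integral>\<^sup>+y. ennreal ((Q n y powr (s - 1)) powr (s / (s - 1))) \<partial>N) (1 / (s / (s - 1))) * epowr (\<integral>\<^sup>+y. ennreal (H x y powr s) \<partial>N) (1/s)"
            using H0 s1 dual by (intro nn_integral_Holder) auto
          also have "(\<lambda>y. (Q n y powr (s - 1)) powr (s / (s - 1))) = (\<lambda>y. Q n y powr s)"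
            using s1 by (simp add: powr_powr)
          also have "1 / (s / (s - 1)) = 1 - 1/s" using s1 by (simp add: field_simps)
          finally show "(\<integral>\<^sup>+y. ennreal (Q n y powr (s - 1)) * ennreal (H x y) \<partial>N) \<le> epowr (I n) (1 - 1/s) * B x"
            by (simp add: I_def B_def)
        qed
        also have "\<dots> = epowr (I n) (1 - 1/s) * K"
          unfolding K_def by (rule nn_integral_cmult) measurable
        finally show ?thesis .
      qed
      obtain k where k: "K = ennreal k" "0 \<le> k" using K by (cases K) auto
      have I_le: "I n \<le> epowr K s" for n
      proof -
        obtain i where i: "I n = ennreal i" "0 \<le> i" using Ifin[of n] by (cases "I n") auto
        have "i \<le> k powr s"
        proof (cases "i = 0")
          case False
          then have i0: "0 < i" using i by simp
          have "i \<le> i powr (1 - 1/s) * k" using ineq[of n] i k by (simp add: ennreal_mult[symmetric])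
          then have "i * i powr (1/s - 1) \<le> (i powr (1 - 1/s) * k) * i powr (1/s - 1)"
            by (intro mult_right_mono) auto
          moreover have "i * i powr (1/s - 1) = i powr (1/s)" using i0 powr_add[of i 1 "1/s - 1"] by simp
          moreover have "i powr (1 - 1/s) * i powr (1/s - 1) = 1" using i0 by (simp add: powr_add[symmetric])
          ultimately have "i powr (1/s) \<le> k" by (simp add: mult.assoc mult.left_commute mult.commute)
          then have "(i powr (1/s)) powr s \<le> k powr s" using s by (intro powr_mono2) auto
          then show ?thesis using i0 s1 by (simp add: powr_powr)
        qed (use k in simp)
        then show ?thesis using i k by (simp add: ennreal_leI)
      qed
      \<comment> \<open>Fatou's lemma removes the cap; where \<open>P y\<close> is infinite the
        capped values are \<open>n\<close> itself and diverge.\<close>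
      have "(\<integral>\<^sup>+y. epowr (P y) s \<partial>N) \<le> (\<integral>\<^sup>+y. liminf (\<lambda>n. ennreal (Q n y powr s)) \<partial>N)"
      proof (rule nn_integral_mono)
        fix y
        show "epowr (P y) s \<le> liminf (\<lambda>n. ennreal (Q n y powr s))"
        proof (cases "P y = \<infinity>")
          case True
          have "Q n y = real n" for n
            by (simp add: Q_def True min_absorb2)
          have "liminf (\<lambda>n. ennreal (Q n y powr s)) = top"
          proof (rule ccontr)
            assume "liminf (\<lambda>n. ennreal (Q n y powr s)) \<noteq> top"
            then obtain r where r: "liminf (\<lambda>n. ennreal (Q n y powr s)) = ennreal r" "0 \<le> r"
              using ennreal_cases infinity_ennreal_def by metis
            obtain m :: nat where m: "r + 1 \<le> real m" using real_arch_simple by blast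
            have "ennreal (r + 1) \<le> ennreal (Q n y powr s)" if "m \<le> n" for n
            proof (rule ennreal_leI)
              have "r + 1 \<le> real n" using m that by linarith
              moreover have "real n powr 1 \<le> real n powr s" using s1 calculation r by (intro powr_mono) auto
              moreover have "real n powr 1 = real n" by simp
              ultimately show "r + 1 \<le> Q n y powr s"
                unfolding \<open>\<And>n. Q n y = real n\<close> by linarith
            qed
            then have "ennreal (r + 1) \<le> liminf (\<lambda>n. ennreal (Q n y powr s))"
              by (intro Liminf_bounded) (auto simp: eventually_sequentially)
            then show False using r by (simp add: ennreal_le_iff)
          qed
          then show ?thesis by simp
        next
          case False
          then obtain r where r: "P y = ennreal r" "0 \<le> r" by (cases "P y") auto
          obtain m :: nat where m: "r \<le> real m" using real_arch_simple by blast
          have "Q n y = r" if "m \<le> n" for n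
          proof -
            have "r \<le> real n" using m that by linarith
            then have "ennreal (Q n y) = ennreal r" unfolding Qe r by (simp add: ennreal_of_nat_eq_real_of_nat min_def ennreal_le_iff2 ennreal_leI)
            then show ?thesis using Q0 r by simp
          qed
          then have "\<forall>\<^sub>F n in sequentially. ennreal (r powr s) \<le> ennreal (Q n y powr s)"
            by (auto simp: eventually_sequentially)
          then have "ennreal (r powr s) \<le> liminf (\<lambda>n. ennreal (Q n y powr s))"
            by (rule Liminf_bounded)
          then show ?thesis using r by simp
        qed
      qed
      also have "\<dots> \<le> liminf (\<lambda>n. I n)"
        unfolding I_def by (rule nn_integral_liminf) measurable
      also have "\<dots> \<le> epowr K s"
        by (rule Liminf_le) (auto intro!: always_eventually I_le)
      finally show ?thesis by (simp add: P_def K_def B_def)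
    qed
  qed
qed

section \<open>Restriction to the circle\<close>

lemma sigma_finite_density_lborel:
  fixes w :: "'a::euclidean_space \<Rightarrow> real"
  assumes [measurable]: "w \<in> borel_measurable borel"
  shows "sigma_finite_measure (density lborel (\<lambda>x. ennreal (w x)))"
  by (subst sigma_finite_measure.sigma_finite_iff_density_finite[OF sigma_finite_lborel]) auto

lemma sets_triangles:
  "{z :: real \<times> real. snd z < fst z} \<in> sets (lborel \<Otimes>\<^sub>M lborel)"
  "{z :: real \<times> real. fst z < snd z} \<in> sets (lborel \<Otimes>\<^sub>M lborel)"
  unfolding lborel_prod sets_lborel by (intro borel_open open_Collect_less continuous_intros)+

lemma AE_lborel_pair_off_diagonal:
  "AE z in (lborel :: real measure) \<Otimes>\<^sub>M (lborel :: real measure). fst z \<noteq> snd z"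
proof (rule lborel_pair.AE_pair_measure)
  show "{x \<in> space (lborel \<Otimes>\<^sub>M lborel). fst x \<noteq> snd x} \<in> sets ((lborel :: real measure) \<Otimes>\<^sub>M (lborel :: real measure))"
    by measurable
  show "AE x in lborel. AE y in lborel. fst (x, y) \<noteq> snd (x, y :: real)"
    using AE_lborel_singleton by (auto simp: eq_commute)
qed

text \<open>The diagonal is null and the swap exchanges the two triangles. Passing to one triangle
  is what makes the sum map injective.\<close>

lemma integral_symmetric_triangle:
  fixes h :: "real \<times> real \<Rightarrow> complex"
  assumes h: "integrable (lborel \<Otimes>\<^sub>M lborel) h" and sym: "\<And>s t. h (s, t) = h (t, s)"
  shows "(LINT z|(lborel \<Otimes>\<^sub>M lborel). h z) = 2 * (LINT z|(lborel \<Otimes>\<^sub>M lborel). indicator {z. snd z < fst z} z *\<^sub>R h z)"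
proof -
  have [measurable]: "h \<in> borel_measurable (lborel \<Otimes>\<^sub>M lborel)" using h by simp
  have A: "{z. snd z < fst z} \<in> sets ((lborel :: real measure) \<Otimes>\<^sub>M (lborel :: real measure))" "{z. fst z < snd z} \<in> sets ((lborel :: real measure) \<Otimes>\<^sub>M (lborel :: real measure))"
    by (rule sets_triangles)+
  note [measurable] = A
  have "(LINT z|(lborel \<Otimes>\<^sub>M lborel). h z) = (LINT z|(lborel \<Otimes>\<^sub>M lborel). indicator {z. snd z < fst z} z *\<^sub>R h z + indicator {z. fst z < snd z} z *\<^sub>R h z)"
  proof (rule integral_cong_AE)
    show "AE z in lborel \<Otimes>\<^sub>M lborel. h z = indicator {z. snd z < fst z} z *\<^sub>R h z + indicator {z. fst z < snd z} z *\<^sub>R h z"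
      using AE_lborel_pair_off_diagonal by eventually_elim (auto simp: indicator_def)
  qed measurable
  also have "\<dots> = (LINT z|(lborel \<Otimes>\<^sub>M lborel). indicator {z. snd z < fst z} z *\<^sub>R h z) + (LINT z|(lborel \<Otimes>\<^sub>M lborel). indicator {z. fst z < snd z} z *\<^sub>R h z)"
    by (intro Bochner_Integration.integral_add integrable_mult_indicator A h)
  also have "(LINT z|(lborel \<Otimes>\<^sub>M lborel). indicator {z. fst z < snd z} z *\<^sub>R h z) = (LINT z|(lborel \<Otimes>\<^sub>M lborel). indicator {z. snd z < fst z} z *\<^sub>R h z)"
  proof -
    have "(\<lambda>(x, y). indicator {z. snd z < fst z} (y, x) *\<^sub>R h (y, x)) = (\<lambda>z. indicator {z. fst z < snd z} z *\<^sub>R h z)"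
      by (auto simp: fun_eq_iff indicator_def sym)
    then show ?thesis
      using lborel_pair.integral_product_swap[of "\<lambda>z. indicator {z. snd z < fst z} z *\<^sub>R h z"] by simp
  qed
  finally show ?thesis by simp
qed

text \<open>The transpose of the restriction operator for the bilinear pairing, hence with the same
  kernel as \<open>fourier_transform\<close> and without a conjugate. The parameter runs over the
  whole line; the support of \<open>g\<close> selects the arc.\<close>

definition extension :: "(real \<Rightarrow> complex) \<Rightarrow> real^2 \<Rightarrow> complex" where
  "extension g x = (LINT t|lborel. g t * cis (- (2 * pi * (x \<bullet> circ t))))"

lemma integrable_mult_cis:
  assumes "integrable M g" and [measurable]: "a \<in> borel_measurable M"
  shows "integrable M (\<lambda>t. g t * cis (a t))"
  by (rule Bochner_Integration.integrable_bound[OF assms(1)]) (use assms(1) in \<open>auto simp: norm_mult\<close>)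

text \<open>The square of the extension is the Fourier transform of a density on \<open>circ s + circ t\<close>;
  the factor \<open>x $ 1 - x $ 2\<close> stands in for the Jacobian.\<close>
lemma extension_squared:
  assumes g: "integrable lborel g" and supp: "\<And>t. t \<notin> {c..<c+1/8} \<Longrightarrow> g t = 0"
  defines "M \<equiv> density lborel (\<lambda>x::real^2. ennreal ((x $ 1 - x $ 2) * indicator (arc_pairs c) x))"
  shows "integrable M (\<lambda>x. g (x $ 1) * g (x $ 2) / complex_of_real (x $ 1 - x $ 2))"
    and "(extension g x)\<^sup>2 = 2 * (LINT z|M. g (z $ 1) * g (z $ 2) / complex_of_real (z $ 1 - z $ 2) * cis (- (2 * pi * (x \<bullet> (circ (z $ 1) + circ (z $ 2))))))"
proof -
  have [measurable]: "g \<in> borel_measurable borel" using g by simp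
  define w where "w x = (x $ 1 - x $ 2) * indicator (arc_pairs c) x" for x :: "real^2"
  have w0: "0 \<le> w x" for x by (auto simp: w_def arc_pairs_def indicator_def)
  have [measurable]: "w \<in> borel_measurable borel" unfolding w_def by measurable
  have M: "M = density lborel (\<lambda>x. ennreal (w x))" by (simp add: M_def w_def)
  define F where "F x = g (x $ 1) * g (x $ 2) / complex_of_real (x $ 1 - x $ 2)" for x :: "real^2"
  have [measurable]: "F \<in> borel_measurable borel" unfolding F_def by measurable
  let ?T = "{z. snd z < fst z} :: (real \<times> real) set"
  have T: "?T \<in> sets (lborel \<Otimes>\<^sub>M lborel)" by (rule sets_triangles)
  \<comment> \<open>The weight cancels the denominator on the triangle, and the support of
    \<open>g\<close> takes care of the restriction to the arc.\<close>
  have wF: "w (pt z) *\<^sub>R F (pt z) = indicator ?T z *\<^sub>R (g (fst z) * g (snd z))" for z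
    using supp[of "fst z"] supp[of "snd z"]
    by (cases "snd z < fst z") (auto simp: w_def F_def arc_pairs_def indicator_def scaleR_conv_of_real)
  have gg: "integrable (lborel \<Otimes>\<^sub>M lborel) (\<lambda>z. g (fst z) * g (snd z))"
    using lborel_pair.integrable_mult_fst_snd[OF g g] by (simp add: case_prod_beta')
  have "integrable lborel (\<lambda>x. w x *\<^sub>R F x)"
    by (subst integrable_real2, measurable) (simp only: wF, intro integrable_mult_indicator T gg)
  then show "integrable M (\<lambda>x. g (x $ 1) * g (x $ 2) / complex_of_real (x $ 1 - x $ 2))"
    unfolding M F_def[symmetric] by (subst integrable_density) (auto simp: w0)
  define e where "e t = cis (- (2 * pi * (x \<bullet> circ t)))" for t
  have [measurable]: "e \<in> borel_measurable borel" unfolding e_def by measurable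
  have ge: "integrable lborel (\<lambda>t. g t * e t)" unfolding e_def by (intro integrable_mult_cis g) measurable
  have "(extension g x)\<^sup>2 = (LINT z|(lborel \<Otimes>\<^sub>M lborel). (case z of (s, t) \<Rightarrow> (g s * e s) * (g t * e t)))"
    unfolding lborel_pair.integral_mult_fst_snd[OF ge ge] by (simp add: extension_def e_def power2_eq_square)
  also have "\<dots> = 2 * (LINT z|(lborel \<Otimes>\<^sub>M lborel). indicator ?T z *\<^sub>R (case z of (s, t) \<Rightarrow> (g s * e s) * (g t * e t)))"
    by (rule integral_symmetric_triangle[OF lborel_pair.integrable_mult_fst_snd[OF ge ge]]) simp
  also have "(LINT z|(lborel \<Otimes>\<^sub>M lborel). indicator ?T z *\<^sub>R (case z of (s, t) \<Rightarrow> (g s * e s) * (g t * e t))) = (LINT z|(lborel \<Otimes>\<^sub>M lborel). w (pt z) *\<^sub>R (F (pt z) * cis (- (2 * pi * (x \<bullet> (circ (pt z $ 1) + circ (pt z $ 2)))))))"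
  proof (rule Bochner_Integration.integral_cong)
    fix z :: "real \<times> real"
    have "cis (- (2 * pi * (x \<bullet> (circ (pt z $ 1) + circ (pt z $ 2))))) = e (fst z) * e (snd z)"
      by (simp add: e_def cis_mult inner_add_right algebra_simps)
    then have "w (pt z) *\<^sub>R (F (pt z) * cis (- (2 * pi * (x \<bullet> (circ (pt z $ 1) + circ (pt z $ 2)))))) = (w (pt z) *\<^sub>R F (pt z)) * (e (fst z) * e (snd z))"
      by simp
    then show "indicator ?T z *\<^sub>R (case z of (s, t) \<Rightarrow> (g s * e s) * (g t * e t)) = w (pt z) *\<^sub>R (F (pt z) * cis (- (2 * pi * (x \<bullet> (circ (pt z $ 1) + circ (pt z $ 2))))))"
      unfolding wF by (simp add: case_prod_beta mult_ac)
  qed simp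
  also have "\<dots> = (LINT z|lborel. w z *\<^sub>R (F z * cis (- (2 * pi * (x \<bullet> (circ (z $ 1) + circ (z $ 2)))))))"
    by (rule integral_real2[symmetric]) measurable
  also have "\<dots> = (LINT z|M. F z * cis (- (2 * pi * (x \<bullet> (circ (z $ 1) + circ (z $ 2))))))"
    unfolding M by (rule integral_density[symmetric]) (auto simp: w0)
  finally show "(extension g x)\<^sup>2 = 2 * (LINT z|M. g (z $ 1) * g (z $ 2) / complex_of_real (z $ 1 - z $ 2) * cis (- (2 * pi * (x \<bullet> (circ (z $ 1) + circ (z $ 2))))))"
    unfolding F_def .
qed

text \<open>Squaring doubles the Hausdorff-Young exponent \<open>m / (m - 1)\<close>. The potential
  estimate with \<open>b = m - 1\<close> asks for \<open>cmod (g t) powr m\<close> in the space of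
  exponent \<open>2 / (3 - m)\<close>, whence the exponent of \<open>g\<close>. The constant does
  not depend on the position \<open>c\<close> of the arc.\<close>

lemma extension_arc_bound:
  fixes m :: real
  assumes m: "1 < m" "m < 2"
  shows "\<exists>K>0. \<forall>c g A. integrable lborel g \<longrightarrow> (\<forall>t. t \<notin> {c..<c+1/8} \<longrightarrow> g t = 0) \<longrightarrow> 0 < A \<longrightarrow>
    (\<integral>\<^sup>+t. ennreal (cmod (g t) powr (2 * m / (3 - m))) \<partial>lborel) \<le> ennreal A \<longrightarrow>
    (\<integral>\<^sup>+x. ennreal (cmod (extension g x) powr (2 * m / (m - 1))) \<partial>lborel) \<le> ennreal (K * A powr ((3 - m) / (m - 1)))"
proof -
  define r where "r = m / (m - 1)"
  have r: "2 < r" "r - 1 = 1 / (m - 1)" using m by (auto simp: r_def field_simps)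
  define K1 where "K1 = 4 * r * 1 * (2 powr (r - 2) / (r - 2))"
  define K2 where "K2 = 2 * (2 / (1 - (m - 1)) + 3)"
  have K1: "0 < K1" using r by (simp add: K1_def)
  have K2: "0 < K2" using m by (simp add: K2_def add_pos_pos)
  define K where "K = 2 powr r * (K1 * K2 powr (r - 1))"
  have K: "0 < K" using K1 K2 by (simp add: K_def)
  show ?thesis
  proof (intro exI[of _ K] conjI K allI impI)
    fix c A :: real and g :: "real \<Rightarrow> complex"
    assume g: "integrable lborel g" and supp: "\<forall>t. t \<notin> {c..<c+1/8} \<longrightarrow> g t = 0" and A: "0 < A"
      and gA: "(\<integral>\<^sup>+t. ennreal (cmod (g t) powr (2 * m / (3 - m))) \<partial>lborel) \<le> ennreal A"
    have [measurable]: "g \<in> borel_measurable borel" using g by simp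
    define w where "w x = (x $ 1 - x $ 2) * indicator (arc_pairs c) x" for x :: "real^2"
    have w0: "0 \<le> w x" for x by (auto simp: w_def arc_pairs_def indicator_def)
    have [measurable]: "w \<in> borel_measurable borel" unfolding w_def by measurable
    define M where "M = density lborel (\<lambda>x. ennreal (w x))"
    have sM [measurable_cong]: "sets M = sets borel" by (simp add: M_def)
    interpret M: sigma_finite_measure M
      unfolding M_def by (rule sigma_finite_density_lborel) measurable
    define \<Phi> where "\<Phi> x = circ (x $ 1) + circ (x $ 2)" for x :: "real^2"
    have [measurable]: "\<Phi> \<in> borel_measurable borel" unfolding \<Phi>_def by measurable
    define F where "F x = g (x $ 1) * g (x $ 2) / complex_of_real (x $ 1 - x $ 2)" for x :: "real^2"
    have [measurable]: "F \<in> borel_measurable borel" unfolding F_def by measurable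
    have FM: "integrable M F" and E2: "(extension g x)\<^sup>2 = 2 * (LINT z|M. F z * cis (- (2 * pi * (x \<bullet> \<Phi> z))))" for x
      using extension_squared[OF g, of c] supp unfolding M_def F_def \<Phi>_def w_def by auto
    \<comment> \<open>The change of variables compares the kernel integral against \<open>M\<close>
      with the integral over the whole plane, which is 1.\<close>
    have schur: "(\<integral>\<^sup>+z. ennreal (gauss_hat e ((2 * pi) *\<^sub>R (\<Phi> z - y))) \<partial>M) \<le> ennreal 1" if "0 < e" for e y
    proof -
      have "(\<integral>\<^sup>+z. ennreal (gauss_hat e ((2 * pi) *\<^sub>R (\<Phi> z - y))) \<partial>M) = (\<integral>\<^sup>+z. ennreal (w z) * ennreal (gauss_hat e ((2 * pi) *\<^sub>R (\<Phi> z - y))) \<partial>lborel)"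
        unfolding M_def by (rule nn_integral_density) measurable
      also have "\<dots> = (\<integral>\<^sup>+x. ennreal ((x $ 1 - x $ 2) * gauss_hat e ((2 * pi) *\<^sub>R (circ (x $ 1) + circ (x $ 2) - y))) * indicator (arc_pairs c) x \<partial>lborel)"
        by (intro nn_integral_cong) (auto simp: w_def \<Phi>_def indicator_def arc_pairs_def ennreal_mult'[symmetric])
      also have "\<dots> \<le> (\<integral>\<^sup>+x. ennreal (gauss_hat e ((2 * pi) *\<^sub>R (x - y))) \<partial>lborel)"
        using nn_integral_gauss_hat[OF that, of y] gauss_hat_nonneg
        by (intro nn_integral_circ_sum_le) auto
      also have "\<dots> = 1" by (rule nn_integral_gauss_hat[OF that])
      finally show ?thesis by simp
    qed
    define A' where "A' = K2 * A powr (3 - m)"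
    have A': "0 < A'" using K2 A by (simp add: A'_def)
    \<comment> \<open>The weight has power 1 and the denominator power \<open>m\<close>, which
      leaves the kernel exponent \<open>-(m - 1)\<close>, strictly between -1 and 0.\<close>
    have FA: "(\<integral>\<^sup>+z. ennreal (cmod (F z) powr m) \<partial>M) \<le> ennreal A'"
    proof -
      define h where "h t = cmod (g t) powr m" for t
      have [measurable]: "h \<in> borel_measurable borel" unfolding h_def by measurable
      have "(\<integral>\<^sup>+z. ennreal (cmod (F z) powr m) \<partial>M) = (\<integral>\<^sup>+z. ennreal (w z) * ennreal (cmod (F z) powr m) \<partial>lborel)"
        unfolding M_def by (rule nn_integral_density) measurable
      also have "\<dots> = (\<integral>\<^sup>+s. \<integral>\<^sup>+t. ennreal (w (pt (s,t))) * ennreal (cmod (F (pt (s,t))) powr m) \<partial>lborel \<partial>lborel)"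
        by (rule nn_integral_real2) measurable
      also have "\<dots> \<le> (\<integral>\<^sup>+s. \<integral>\<^sup>+t. ennreal (h s * h t * \<bar>s - t\<bar> powr (-(m-1))) \<partial>lborel \<partial>lborel)"
      proof (intro nn_integral_mono)
        fix s t :: real
        show "ennreal (w (pt (s,t))) * ennreal (cmod (F (pt (s,t))) powr m) \<le> ennreal (h s * h t * \<bar>s - t\<bar> powr (-(m-1)))"
        proof (cases "pt (s,t) \<in> arc_pairs c")
          case True
          then have ts: "t < s" by (simp add: arc_pairs_def)
          then have "cmod (complex_of_real s - complex_of_real t) = s - t"
            by (simp flip: of_real_diff)
          then have "w (pt (s,t)) * cmod (F (pt (s,t))) powr m = (s - t) powr 1 * (h s * h t / (s - t) powr m)"
            using ts True by (simp add: w_def F_def h_def norm_mult norm_divide powr_mult powr_divide)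
          also have "\<dots> = h s * h t * (s - t) powr (1 - m)"
            using ts by (simp add: powr_diff)
          finally show ?thesis using ts w0 by (simp add: ennreal_mult[symmetric])
        qed (simp add: w_def)
      qed
      also have "\<dots> \<le> ennreal (2 * (2 / (1 - (m - 1)) + 3) * A powr (2 - (m - 1)))"
      proof (rule HLS_diagonal)
        show "(\<integral>\<^sup>+t. ennreal (h t powr (2 / (2 - (m - 1)))) \<partial>lborel) \<le> ennreal A"
          using gA by (simp add: h_def powr_powr mult.commute)
      qed (use m A in \<open>auto simp: h_def\<close>)
      finally show ?thesis by (simp add: A'_def K2_def)
    qed
    define T where "T x = (LINT z|M. F z * cis (- (2 * pi * (x \<bullet> \<Phi> z))))" for x
    have [measurable]: "T \<in> borel_measurable borel" unfolding T_def by measurable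
    have HY: "(\<integral>\<^sup>+x. ennreal (cmod (T x) powr r) \<partial>lborel) \<le> ennreal (K1 * A' powr (r - 1))"
      unfolding T_def K1_def r_def
    proof (rule interpolated_Hausdorff_Young[where N = lborel and M = M and k = "\<lambda>x z. cis (- (2 * pi * (x \<bullet> \<Phi> z)))"])
      show "(\<integral>\<^sup>+x. ennreal ((cmod (LINT z|M. G z * cis (- (2 * pi * (x \<bullet> \<Phi> z)))))\<^sup>2) \<partial>lborel) \<le> ennreal 1 * (\<integral>\<^sup>+z. ennreal ((cmod (G z))\<^sup>2) \<partial>M)"
        if "integrable M G" for G
        by (rule fourier_L2_bound[OF M.sigma_finite_measure_axioms _ that]) (auto intro: schur[simplified])
      show "(\<lambda>(x, z). cis (- (2 * pi * (x \<bullet> \<Phi> z)))) \<in> borel_measurable (lborel \<Otimes>\<^sub>M M)"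
        by measurable
    qed (use m A' FA FM in \<open>auto intro: M.sigma_finite_measure_axioms lborel.sigma_finite_measure_axioms\<close>)
    have "(\<integral>\<^sup>+x. ennreal (cmod (extension g x) powr (2 * m / (m - 1))) \<partial>lborel) = (\<integral>\<^sup>+x. ennreal (2 powr r) * ennreal (cmod (T x) powr r) \<partial>lborel)"
    proof (rule nn_integral_cong)
      fix x
      have "cmod (extension g x) powr (2 * m / (m - 1)) = (cmod (extension g x) powr 2) powr r"
        by (simp add: powr_powr r_def del: powr_numeral)
      also have "cmod (extension g x) powr 2 = cmod ((extension g x)\<^sup>2)"
        by (simp add: norm_power)
      also have "\<dots> = 2 * cmod (T x)" unfolding E2 by (simp add: T_def norm_mult)
      finally show "ennreal (cmod (extension g x) powr (2 * m / (m - 1))) = ennreal (2 powr r) * ennreal (cmod (T x) powr r)"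
        by (simp add: powr_mult ennreal_mult)
    qed
    also have "\<dots> = ennreal (2 powr r) * (\<integral>\<^sup>+x. ennreal (cmod (T x) powr r) \<partial>lborel)"
      by (rule nn_integral_cmult) measurable
    also have "\<dots> \<le> ennreal (2 powr r) * ennreal (K1 * A' powr (r - 1))"
      by (intro mult_left_mono HY) simp
    also have "\<dots> = ennreal (K * A powr ((3 - m) / (m - 1)))"
    proof -
      have "A' powr (r - 1) = K2 powr (r - 1) * A powr ((3 - m) * (r - 1))"
        using K2 A by (simp add: A'_def powr_mult powr_powr)
      moreover have "(3 - m) * (r - 1) = (3 - m) / (m - 1)" unfolding r(2) by simp
      ultimately show ?thesis using K1 K2 by (simp add: K_def ennreal_mult[symmetric] mult_ac)
    qed
    finally show "(\<integral>\<^sup>+x. ennreal (cmod (extension g x) powr (2 * m / (m - 1))) \<partial>lborel) \<le> \<dots>" .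
  qed
qed

section \<open>Duality: from extension to restriction\<close>

lemma fourier_transform_cis: "fourier_transform f \<xi> = (LINT x|lborel. cis (- (2 * pi * (x \<bullet> \<xi>))) * f x)"
  by (simp add: fourier_transform_def cis_conv_exp mult_ac)

lemma measurable_fourier_transform [measurable]:
  fixes f :: "'a::euclidean_space \<Rightarrow> complex"
  assumes [measurable]: "f \<in> borel_measurable borel"
  shows "fourier_transform f \<in> borel_measurable borel"
  unfolding fourier_transform_cis[abs_def] by measurable

lemma norm_fourier_transform_le:
  "cmod (fourier_transform f \<xi>) \<le> (LINT x|lborel. cmod (f x))"
  unfolding fourier_transform_cis by (rule order_trans[OF integral_norm_bound]) (simp add: norm_mult)

text \<open>Testing the transform \<open>\<phi>\<close> against a dual function \<open>g\<close> on
  the arc moves the pairing over to \<open>f\<close> and \<open>extension g\<close>. Hoelder's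
  inequality and the extension bound then estimate the integral of
  \<open>cmod (\<phi> t) powr q\<close> by a lower power of itself.\<close>

lemma restriction_arc:
  fixes p :: real
  assumes p: "1 < p" "p < 4/3"
  defines "q \<equiv> p / (3 * (p - 1))"
  shows "\<exists>K>0. \<forall>c. \<forall>f :: real^2 \<Rightarrow> complex. integrable lborel f \<longrightarrow>
    (\<integral>\<^sup>+t. ennreal (cmod (fourier_transform f (circ t)) powr q) * indicator {c..<c+1/8} t \<partial>lborel)
      \<le> ennreal K * epowr (\<integral>\<^sup>+x. ennreal (cmod (f x) powr p) \<partial>lborel) (q / p)"
proof -
  \<comment> \<open>The value for which \<open>2 * m / (m - 1)\<close> is the conjugate exponent of
    \<open>p\<close>. The exponent \<open>2 * m / (3 - m)\<close> of the extension bound is then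
    conjugate to \<open>q = p' / 3\<close>, which is how the factor 3 arises.\<close>
  define m where "m = p / (2 - p)"
  have m: "1 < m" "m < 2" using p by (auto simp: m_def field_simps)
  have q1: "1 < q" using p by (simp add: q_def field_simps)
  have m1: "m - 1 = 2 * (p - 1) / (2 - p)" and m3: "3 - m = 2 * (3 - 2 * p) / (2 - p)"
    using p by (auto simp: m_def field_simps)
  have p': "2 * m / (m - 1) = p / (p - 1)" 
  proof -
    have "2 * m * (p - 1) = p * (m - 1)" unfolding m1 by (simp add: m_def mult_ac)
    then show ?thesis using p m by (subst frac_eq_eq) auto
  qed
  have m31: "(3 - m) / (m - 1) = (3 - 2 * p) / (p - 1)"
  proof -
    have "(3 - m) * (p - 1) = (3 - 2 * p) * (m - 1)" unfolding m1 m3 by (simp, simp add: algebra_simps)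
    then show ?thesis using p m by (subst frac_eq_eq) auto
  qed
  have q': "2 * m / (3 - m) = q / (q - 1)" 
  proof -
    have "2 * m / (3 - m) = p / (3 - 2 * p)" 
    proof -
      have "2 * m * (3 - 2 * p) = p * (3 - m)" unfolding m3 by (simp add: m_def mult_ac)
      then show ?thesis using p m by (subst frac_eq_eq) auto
    qed
    moreover have "q / (q - 1) = p / (3 - 2 * p)"
    proof -
      have "q - 1 = (3 - 2 * p) / (3 * (p - 1))" using p by (simp add: q_def field_simps)
      then have "q * (3 - 2 * p) = p * (q - 1)" by (simp add: q_def mult_ac)
      then show ?thesis using p q1 by (subst frac_eq_eq) auto
    qed
    ultimately show ?thesis by simp
  qed
  \<comment> \<open>The power with which the left side \<open>x\<close> reappears on the right after
    Hoelder's inequality; dividing by it leaves \<open>x powr (1 / q)\<close>.\<close>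
  have ex: "(3 - m) / (m - 1) * ((p - 1) / p) = 1 - 1 / q"
    using p by (simp add: m31 q_def divide_simps)
  obtain K0 where K0: "0 < K0" and ext: "\<And>c g A. integrable lborel g \<Longrightarrow> (\<And>t. t \<notin> {c..<c+1/8} \<Longrightarrow> g t = 0) \<Longrightarrow> 0 < A \<Longrightarrow>
    (\<integral>\<^sup>+t. ennreal (cmod (g t) powr (q / (q - 1))) \<partial>lborel) \<le> ennreal A \<Longrightarrow>
    (\<integral>\<^sup>+x. ennreal (cmod (extension g x) powr (p / (p - 1))) \<partial>lborel) \<le> ennreal (K0 * A powr ((3 - m) / (m - 1)))"
    using extension_arc_bound[OF m] unfolding p' q' by blast
  define K where "K = (K0 powr ((p - 1) / p)) powr q"
  have K: "0 < K" using K0 by (simp add: K_def)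
  show ?thesis
  proof (intro exI[of _ K] conjI K allI impI)
    fix c :: real and f :: "real^2 \<Rightarrow> complex"
    assume f: "integrable lborel f"
    have [measurable]: "f \<in> borel_measurable borel" using f by simp
    define \<phi> where "\<phi> t = fourier_transform f (circ t)" for t
    have [measurable]: "\<phi> \<in> borel_measurable borel" unfolding \<phi>_def by measurable
    define L where "L = (LINT x|lborel. cmod (f x))"
    have \<phi>L: "cmod (\<phi> t) \<le> L" for t unfolding \<phi>_def L_def by (rule norm_fourier_transform_le)
    let ?I = "{c..<c+1/8}"
    define X where "X = (\<integral>\<^sup>+t. ennreal (cmod (\<phi> t) powr q) * indicator ?I t \<partial>lborel)"
    define Fp where "Fp = (\<integral>\<^sup>+x. ennreal (cmod (f x) powr p) \<partial>lborel)"
    have int_I: "integrable lborel (\<lambda>t. indicator ?I t * b :: real)" for b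
      by simp
    \<comment> \<open>Finiteness of \<open>X\<close>, which the division below relies on: the
      transform is bounded and the arc has finite length.\<close>
    have "X \<le> (\<integral>\<^sup>+t. ennreal (L powr q) * indicator ?I t \<partial>lborel)"
      unfolding X_def using \<phi>L q1 by (intro nn_integral_mono mult_right_mono ennreal_leI powr_mono2) auto
    also have "\<dots> < \<infinity>" by (subst nn_integral_cmult_indicator) (auto simp: ennreal_mult[symmetric])
    finally obtain x where x: "X = ennreal x" "0 \<le> x" by (cases X) auto
    show "(\<integral>\<^sup>+t. ennreal (cmod (fourier_transform f (circ t)) powr q) * indicator ?I t \<partial>lborel)
      \<le> ennreal K * epowr (\<integral>\<^sup>+x. ennreal (cmod (f x) powr p) \<partial>lborel) (q / p)"
      unfolding \<phi>_def[symmetric] X_def[symmetric] Fp_def[symmetric]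
    proof (cases "x = 0 \<or> Fp = \<infinity>")
      case True then show "X \<le> ennreal K * epowr Fp (q / p)" using x K by (auto simp: ennreal_mult_top)
    next
      case False
      then have x0: "0 < x" using x by simp
      from False obtain a where a: "Fp = ennreal a" "0 \<le> a" by (cases Fp) auto
      \<comment> \<open>The extremal function of Hoelder's inequality: on the arc both
        \<open>\<phi> t * g t\<close> and \<open>cmod (g t)\<close> to the power
        \<open>q / (q - 1)\<close> equal \<open>cmod (\<phi> t) powr q\<close>.\<close>
      define g where "g t = indicator ?I t *\<^sub>R (cnj (\<phi> t) * complex_of_real (cmod (\<phi> t) powr (q - 2)))" for t
      have [measurable]: "g \<in> borel_measurable borel" unfolding g_def by measurable
      have gn: "cmod (g t) = indicator ?I t * cmod (\<phi> t) powr (q - 1)" for t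
        using powr_add[of "cmod (\<phi> t)" 1 "q - 2"] by (cases "\<phi> t = 0") (auto simp: g_def norm_mult)
      have g\<phi>: "\<phi> t * g t = complex_of_real (indicator ?I t * cmod (\<phi> t) powr q)" for t
      proof (cases "\<phi> t = 0")
        case False
        have "cmod (\<phi> t) powr 2 * cmod (\<phi> t) powr (q - 2) = cmod (\<phi> t) powr q" unfolding powr_add[symmetric] by simp
        then have "(cmod (\<phi> t))\<^sup>2 * cmod (\<phi> t) powr (q - 2) = cmod (\<phi> t) powr q" using False by simp
        moreover have "\<phi> t * g t = indicator ?I t *\<^sub>R ((\<phi> t * cnj (\<phi> t)) * complex_of_real (cmod (\<phi> t) powr (q - 2)))"
          by (simp add: g_def)
        ultimately show ?thesis unfolding complex_norm_square[symmetric]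
          by (simp add: scaleR_conv_of_real of_real_mult[symmetric] del: of_real_mult of_real_power)
      qed (simp add: g_def)
      have gi: "integrable lborel g"
      proof (rule Bochner_Integration.integrable_bound[OF int_I[of "L powr (q - 1)"]])
        show "AE t in lborel. norm (g t) \<le> norm (indicator ?I t * L powr (q - 1))"
          unfolding gn using \<phi>L q1 by (auto simp: indicator_def intro!: powr_mono2)
      qed measurable
      have gX: "(\<integral>\<^sup>+t. ennreal (cmod (g t) powr (q / (q - 1))) \<partial>lborel) = ennreal x"
        unfolding x(1)[symmetric] X_def gn using q1
        by (intro nn_integral_cong) (auto simp: indicator_def powr_powr)
      have E: "(\<integral>\<^sup>+y. ennreal (cmod (extension g y) powr (p / (p - 1))) \<partial>lborel) \<le> ennreal (K0 * x powr ((3 - m) / (m - 1)))"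
      proof (rule ext[where c = c, OF gi _ x0])
        show "(\<integral>\<^sup>+t. ennreal (cmod (g t) powr (q / (q - 1))) \<partial>lborel) \<le> ennreal x" by (simp only: gX order_refl)
      qed (auto simp: g_def)
      have fg: "integrable (lborel \<Otimes>\<^sub>M lborel) (\<lambda>(t, y). g t * (cis (- (2 * pi * (y \<bullet> circ t))) * f y))"
      proof (rule Bochner_Integration.integrable_bound[OF lborel_pair.integrable_mult_fst_snd[OF gi f]])
      qed (auto simp: norm_mult)
      have [measurable]: "extension g \<in> borel_measurable borel" unfolding extension_def[abs_def] by measurable
      have "complex_of_real x = (LINT t|lborel. \<phi> t * g t)"
      proof -
        have "x = (LINT t|lborel. indicator ?I t * cmod (\<phi> t) powr q)"
        proof -
          have "ennreal x = (\<integral>\<^sup>+t. ennreal (indicator ?I t * cmod (\<phi> t) powr q) \<partial>lborel)"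
            unfolding x(1)[symmetric] X_def by (intro nn_integral_cong) (auto simp: indicator_def)
          then have "(LINT t|lborel. indicator ?I t * cmod (\<phi> t) powr q) = enn2real (ennreal x)"
            by (subst integral_eq_nn_integral) auto
          then show ?thesis using x by simp
        qed
        then show ?thesis unfolding g\<phi> by (metis integral_complex_of_real)
      qed
      also have "\<dots> = (LINT t|lborel. (LINT y|lborel. g t * (cis (- (2 * pi * (y \<bullet> circ t))) * f y)))"
        by (simp add: \<phi>_def fourier_transform_cis mult.commute)
      also have "\<dots> = (LINT y|lborel. (LINT t|lborel. g t * (cis (- (2 * pi * (y \<bullet> circ t))) * f y)))"
        by (rule lborel_pair.Fubini_integral[OF fg, symmetric])
      also have "\<dots> = (LINT y|lborel. extension g y * f y)"
        unfolding extension_def by (simp add: mult.assoc[symmetric])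
      also have "\<dots> = (LINT y|lborel. f y * extension g y)"
        by (simp only: mult.commute)
      finally have "x = cmod (LINT y|lborel. f y * extension g y)"
        using x by (metis norm_of_real abs_of_nonneg)
      then have "ennreal x \<le> (\<integral>\<^sup>+y. ennreal (cmod (f y * extension g y)) \<partial>lborel)"
        by (cases "integrable lborel (\<lambda>y. f y * extension g y)") (auto simp: not_integrable_integral_eq intro: integral_norm_bound_ennreal)
      also have "\<dots> = (\<integral>\<^sup>+y. ennreal (cmod (f y) * cmod (extension g y)) \<partial>lborel)"
        by (simp add: norm_mult)
      also have "\<dots> \<le> epowr Fp (1 / p) * epowr (\<integral>\<^sup>+y. ennreal (cmod (extension g y) powr (p / (p - 1))) \<partial>lborel) (1 / (p / (p - 1)))"
        unfolding Fp_def using p by (intro nn_integral_Holder) (auto simp: field_simps)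
      also have "\<dots> \<le> epowr Fp (1 / p) * epowr (ennreal (K0 * x powr ((3 - m) / (m - 1)))) (1 / (p / (p - 1)))"
        using p by (intro mult_left_mono epowr_mono E) auto
      also have "\<dots> = ennreal (a powr (1 / p) * (K0 powr ((p - 1) / p) * x powr (1 - 1 / q)))"
        unfolding a using a K0 x0 ex by (simp add: ennreal_mult[symmetric] powr_mult powr_powr)
      finally have "x \<le> a powr (1 / p) * (K0 powr ((p - 1) / p) * x powr (1 - 1 / q))"
        using K0 by (subst (asm) ennreal_le_iff) auto
      then have "x * x powr (1 / q - 1) \<le> (a powr (1 / p) * (K0 powr ((p - 1) / p) * x powr (1 - 1 / q))) * x powr (1 / q - 1)"
        by (intro mult_right_mono) auto
      moreover have "x * x powr (1 / q - 1) = x powr (1 / q)" using x0 powr_add[of x 1 "1 / q - 1"] by simp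
      moreover have "x powr (1 - 1 / q) * x powr (1 / q - 1) = 1" using x0 by (simp add: powr_add[symmetric])
      ultimately have "x powr (1 / q) \<le> a powr (1 / p) * K0 powr ((p - 1) / p)"
        by (simp add: mult.assoc)
      then have "(x powr (1 / q)) powr q \<le> (a powr (1 / p) * K0 powr ((p - 1) / p)) powr q"
        using q1 by (intro powr_mono2) auto
      then have "x \<le> K * a powr (q / p)"
        using x0 q1 a K0 by (simp add: powr_powr powr_mult K_def mult.commute)
      then show "X \<le> ennreal K * epowr Fp (q / p)"
        unfolding x a using a K by (simp add: ennreal_mult[symmetric] ennreal_leI)
    qed
  qed
qed

section \<open>Tensor products\<close>

text \<open>\<open>C\<close> bounds the \<open>q\<close>-th power of the operator norm, so constants
  multiply under tensor products without roots. Requiring the bound for every integrable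
  \<open>f\<close> keeps slices of integrable functions admissible.\<close>

definition bounded_kernel_op ::
  "'x measure \<Rightarrow> 'y measure \<Rightarrow> ('x \<Rightarrow> 'y \<Rightarrow> complex) \<Rightarrow> real \<Rightarrow> real \<Rightarrow> real \<Rightarrow> bool" where
  "bounded_kernel_op M N k p q C \<longleftrightarrow>
     (\<forall>f. integrable M f \<longrightarrow>
       (\<integral>\<^sup>+y. ennreal (cmod (LINT x|M. k x y * f x) powr q) \<partial>N)
         \<le> ennreal C * epowr (\<integral>\<^sup>+x. ennreal (cmod (f x) powr p) \<partial>M) (q / p))"

text \<open>The first bound is applied for fixed \<open>y2\<close>, the second for fixed
  \<open>x1\<close>. In between, the inner \<open>p\<close>-norm in \<open>x1\<close> and the outer
  \<open>q\<close>-norm in \<open>y2\<close> have to trade places, which is Minkowski's inequality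
  for the exponent \<open>s = q / p \<ge> 1\<close>.\<close>

lemma bounded_kernel_op_tensor:
  fixes k1 :: "'x1 \<Rightarrow> 'y1 \<Rightarrow> complex" and k2 :: "'x2 \<Rightarrow> 'y2 \<Rightarrow> complex"
  assumes sf: "sigma_finite_measure M1" "sigma_finite_measure M2" "finite_measure N1" "finite_measure N2"
    and [measurable]: "(\<lambda>(x, y). k1 x y) \<in> borel_measurable (M1 \<Otimes>\<^sub>M N1)" "(\<lambda>(x, y). k2 x y) \<in> borel_measurable (M2 \<Otimes>\<^sub>M N2)"
    and k: "\<And>x y. cmod (k1 x y) \<le> 1" "\<And>x y. cmod (k2 x y) \<le> 1"
    and pq: "1 \<le> p" "p \<le> q" and C: "0 \<le> C1" "0 \<le> C2"
    and b1: "bounded_kernel_op M1 N1 k1 p q C1" and b2: "bounded_kernel_op M2 N2 k2 p q C2"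
    and f: "integrable (M1 \<Otimes>\<^sub>M M2) (\<lambda>(x1, x2). f x1 x2)"
  shows "(\<integral>\<^sup>+y1. \<integral>\<^sup>+y2. ennreal (cmod (LINT x1|M1. LINT x2|M2. k1 x1 y1 * k2 x2 y2 * f x1 x2) powr q) \<partial>N2 \<partial>N1)
     \<le> ennreal (C1 * C2) * epowr (\<integral>\<^sup>+x1. \<integral>\<^sup>+x2. ennreal (cmod (f x1 x2) powr p) \<partial>M2 \<partial>M1) (q / p)"
proof -
  interpret M1: sigma_finite_measure M1 by fact
  interpret M2: sigma_finite_measure M2 by fact
  interpret N1: finite_measure N1 by fact
  interpret N2: finite_measure N2 by fact
  interpret M: pair_sigma_finite M1 M2 ..
  interpret N: pair_sigma_finite N1 N2 ..
  have [measurable]: "(\<lambda>(x1, x2). f x1 x2) \<in> borel_measurable (M1 \<Otimes>\<^sub>M M2)" using f by simp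
  define s where "s = q / p"
  have s: "1 \<le> s" "0 < s" "p * s = q" using pq by (auto simp: s_def)
  define F where "F x1 y2 = (LINT x2|M2. k2 x2 y2 * f x1 x2)" for x1 y2
  have [measurable]: "(\<lambda>(x1, y2). F x1 y2) \<in> borel_measurable (M1 \<Otimes>\<^sub>M N2)"
    unfolding F_def by measurable
  have Fint: "integrable M1 (\<lambda>x1. F x1 y2)" if y2[measurable]: "y2 \<in> space N2" for y2
  proof -
    have "integrable (M1 \<Otimes>\<^sub>M M2) (\<lambda>(x1, x2). k2 x2 y2 * f x1 x2)"
    proof (rule Bochner_Integration.integrable_bound[OF f])
      show "AE z in M1 \<Otimes>\<^sub>M M2. norm (case z of (x1, x2) \<Rightarrow> k2 x2 y2 * f x1 x2) \<le> norm (case z of (x1, x2) \<Rightarrow> f x1 x2)"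
        using mult_right_mono[OF k(2)] by (auto simp: norm_mult)
    qed measurable
    from M.integrable_fst[OF this] show ?thesis by (simp add: F_def)
  qed
  have "(\<integral>\<^sup>+y1. \<integral>\<^sup>+y2. ennreal (cmod (LINT x1|M1. LINT x2|M2. k1 x1 y1 * k2 x2 y2 * f x1 x2) powr q) \<partial>N2 \<partial>N1)
     = (\<integral>\<^sup>+y1. \<integral>\<^sup>+y2. ennreal (cmod (LINT x1|M1. k1 x1 y1 * F x1 y2) powr q) \<partial>N2 \<partial>N1)"
    by (simp add: F_def mult.assoc)
  also have "\<dots> = (\<integral>\<^sup>+y2. \<integral>\<^sup>+y1. ennreal (cmod (LINT x1|M1. k1 x1 y1 * F x1 y2) powr q) \<partial>N1 \<partial>N2)"
    by (rule N.Fubini'[symmetric]) measurable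
  also have "\<dots> \<le> (\<integral>\<^sup>+y2. ennreal C1 * epowr (\<integral>\<^sup>+x1. ennreal (cmod (F x1 y2) powr p) \<partial>M1) s \<partial>N2)"
    using b1 Fint unfolding bounded_kernel_op_def s_def by (intro nn_integral_mono) auto
  also have "\<dots> = ennreal C1 * (\<integral>\<^sup>+y2. epowr (\<integral>\<^sup>+x1. ennreal (cmod (F x1 y2) powr p) \<partial>M1) s \<partial>N2)"
    by (rule nn_integral_cmult) measurable
  also have "\<dots> \<le> ennreal C1 * epowr (\<integral>\<^sup>+x1. epowr (\<integral>\<^sup>+y2. ennreal ((cmod (F x1 y2) powr p) powr s) \<partial>N2) (1/s) \<partial>M1) s"
    by (intro mult_left_mono nn_integral_Minkowski sf s) (auto, measurable)
  \<comment> \<open>Fubini's theorem makes the slices of \<open>f\<close> integrable only for almost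
    every \<open>x1\<close>, so the second bound is used almost everywhere.\<close>
  also have "\<dots> \<le> ennreal C1 * epowr (\<integral>\<^sup>+x1. epowr (ennreal C2 * epowr (\<integral>\<^sup>+x2. ennreal (cmod (f x1 x2) powr p) \<partial>M2) s) (1/s) \<partial>M1) s"
  proof (intro mult_left_mono epowr_mono nn_integral_mono_AE)
    show "AE x1 in M1. epowr (\<integral>\<^sup>+y2. ennreal ((cmod (F x1 y2) powr p) powr s) \<partial>N2) (1/s) \<le> epowr (ennreal C2 * epowr (\<integral>\<^sup>+x2. ennreal (cmod (f x1 x2) powr p) \<partial>M2) s) (1/s)"
      using M.AE_integrable_fst[OF f]
    proof eventually_elim
      case (elim x1)
      then show ?case using b2 s unfolding bounded_kernel_op_def F_def
        by (intro epowr_mono) (use pq in \<open>auto simp: powr_powr s_def\<close>)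
    qed
  qed (use s in auto)
  also have "\<dots> = ennreal C1 * epowr (\<integral>\<^sup>+x1. ennreal (C2 powr (1/s)) * (\<integral>\<^sup>+x2. ennreal (cmod (f x1 x2) powr p) \<partial>M2) \<partial>M1) s"
    using C s by (simp add: epowr_cmult epowr_epowr)
  also have "(\<integral>\<^sup>+x1. ennreal (C2 powr (1/s)) * (\<integral>\<^sup>+x2. ennreal (cmod (f x1 x2) powr p) \<partial>M2) \<partial>M1) = ennreal (C2 powr (1/s)) * (\<integral>\<^sup>+x1. \<integral>\<^sup>+x2. ennreal (cmod (f x1 x2) powr p) \<partial>M2 \<partial>M1)"
    by (rule nn_integral_cmult) measurable
  also have "ennreal C1 * epowr \<dots> s = ennreal (C1 * C2) * epowr (\<integral>\<^sup>+x1. \<integral>\<^sup>+x2. ennreal (cmod (f x1 x2) powr p) \<partial>M2 \<partial>M1) s"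
    using C s by (simp add: epowr_cmult powr_powr ennreal_mult mult.assoc)
  finally show ?thesis by (simp add: s_def)
qed

lemma bounded_kernel_op_PiM:
  fixes k :: "'x \<Rightarrow> 'y \<Rightarrow> complex" and I :: "'i set"
  assumes sf: "sigma_finite_measure M" "prob_space N"
    and km: "(\<lambda>(x, y). k x y) \<in> borel_measurable (M \<Otimes>\<^sub>M N)"
    and k: "\<And>x y. cmod (k x y) \<le> 1"
    and pq: "1 \<le> p" "p \<le> q" and C: "0 \<le> C"
    and b: "bounded_kernel_op M N k p q C" and I: "finite I"
  shows "bounded_kernel_op (PiM I (\<lambda>_. M)) (PiM I (\<lambda>_. N)) (\<lambda>x y. \<Prod>i\<in>I. k (x i) (y i)) p q (C ^ card I)"
  using I
proof induction
  \<comment> \<open>The product over no index is a one-point space; there both sides equal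
    \<open>cmod (f x) powr q\<close> at its point.\<close>
  case empty
  show ?case
    unfolding bounded_kernel_op_def using pq
    by (auto simp: PiM_empty nn_integral_count_space_finite lebesgue_integral_count_space_finite powr_powr)
next
  case (insert i I)
  interpret M: product_sigma_finite "\<lambda>_::'i. M" using sf by (simp add: product_sigma_finite_def)
  interpret N0: prob_space N by fact
  interpret N: product_prob_space "\<lambda>_::'i. N" UNIV using sf by (intro product_prob_spaceI)
  interpret MI: finite_product_sigma_finite "\<lambda>_::'i. M" I by standard fact
  interpret NI: finite_product_sigma_finite "\<lambda>_::'i. N" I by standard fact
  interpret Mp: pair_sigma_finite "PiM I (\<lambda>_. M)" M by (simp add: pair_sigma_finite_def MI.sigma_finite_measure_axioms sf)
  have fN: "finite_measure (PiM I (\<lambda>_. N))"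
    using prob_space_PiM[of I "\<lambda>_. N"] sf by (simp add: prob_space_def)
  note [measurable] = km
  have meas [measurable]: "(\<lambda>(x, y). \<Prod>j\<in>J. k (x j) (y j)) \<in> borel_measurable (PiM J (\<lambda>_. M) \<Otimes>\<^sub>M PiM J (\<lambda>_. N))" for J :: "'i set"
    unfolding case_prod_beta'
  proof (rule borel_measurable_prod)
    fix j assume [measurable]: "j \<in> J"
    have "(\<lambda>z. (fst z j, snd z j)) \<in> PiM J (\<lambda>_. M) \<Otimes>\<^sub>M PiM J (\<lambda>_. N) \<rightarrow>\<^sub>M M \<Otimes>\<^sub>M N" by measurable
    from measurable_compose[OF this km]
    show "(\<lambda>z. k (fst z j) (snd z j)) \<in> borel_measurable (PiM J (\<lambda>_. M) \<Otimes>\<^sub>M PiM J (\<lambda>_. N))" by simp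
  qed
  define k1 where "k1 x y = (\<Prod>j\<in>I. k (x j) (y j))" for x y
  have [measurable]: "(\<lambda>(x, y). k1 x y) \<in> borel_measurable (PiM I (\<lambda>_. M) \<Otimes>\<^sub>M PiM I (\<lambda>_. N))"
    unfolding k1_def by measurable
  have prod_le: "cmod (\<Prod>j\<in>J. k (x j) (y j)) \<le> 1" for x y and J :: "'i set"
    unfolding prod_norm[symmetric] using k by (intro prod_le_1) auto
  show ?case
    unfolding bounded_kernel_op_def
  proof (intro allI impI)
    fix f :: "('i \<Rightarrow> 'x) \<Rightarrow> complex" assume f: "integrable (PiM (insert i I) (\<lambda>_. M)) f"
    have [measurable]: "f \<in> borel_measurable (PiM (insert i I) (\<lambda>_. M))" using f by simp
    let ?K = "\<lambda>x y. \<Prod>j\<in>insert i I. k (x j) (y j)"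
    have K: "?K (x(i := a)) (y(i := b)) = k1 x y * k a b" for x y a b
    proof -
      have "(\<Prod>j\<in>I. k ((x(i := a)) j) ((y(i := b)) j)) = k1 x y"
        unfolding k1_def using insert by (intro prod.cong) auto
      then show ?thesis using insert by (simp add: mult.commute)
    qed
    have Kf: "integrable (PiM (insert i I) (\<lambda>_. M)) (\<lambda>x. ?K x y * f x)" if [measurable]: "y \<in> space (PiM (insert i I) (\<lambda>_. N))" for y
    proof (rule Bochner_Integration.integrable_bound[OF f])
      show "AE x in PiM (insert i I) (\<lambda>_. M). norm (?K x y * f x) \<le> norm (f x)"
        using mult_right_mono[OF prod_le] by (fastforce simp: norm_mult)
    qed measurable
    have upd: "(\<lambda>(x, a). x(i := a)) \<in> PiM I (\<lambda>_. M) \<Otimes>\<^sub>M M \<rightarrow>\<^sub>M PiM (insert i I) (\<lambda>_. M)"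
      by (rule measurable_add_dim)
    have [measurable]: "(\<lambda>(x, a). f (x(i := a))) \<in> borel_measurable (PiM I (\<lambda>_. M) \<Otimes>\<^sub>M M)"
      using measurable_compose[OF upd, of f borel] by (simp add: case_prod_beta')
    have f2: "integrable (PiM I (\<lambda>_. M) \<Otimes>\<^sub>M M) (\<lambda>(x, a). f (x(i := a)))"
    proof (rule integrableI_bounded)
      have "(\<integral>\<^sup>+z. ennreal (norm (case z of (x, a) \<Rightarrow> f (x(i := a)))) \<partial>(PiM I (\<lambda>_. M) \<Otimes>\<^sub>M M)) = (\<integral>\<^sup>+x. \<integral>\<^sup>+a. ennreal (norm (f (x(i := a)))) \<partial>M \<partial>PiM I (\<lambda>_. M))"
        by (subst sigma_finite_measure.nn_integral_fst[OF sf(1), symmetric]) auto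
      also have "\<dots> = (\<integral>\<^sup>+x. ennreal (norm (f x)) \<partial>PiM (insert i I) (\<lambda>_. M))"
        using insert by (subst M.product_nn_integral_insert) auto
      also have "\<dots> < \<infinity>" using f by (simp add: integrable_iff_bounded)
      finally show "(\<integral>\<^sup>+z. ennreal (norm (case z of (x, a) \<Rightarrow> f (x(i := a)))) \<partial>(PiM I (\<lambda>_. M) \<Otimes>\<^sub>M M)) < \<infinity>" .
    qed measurable
    interpret MiI: finite_product_sigma_finite "\<lambda>_::'i. M" "insert i I" by standard (use insert in simp)
    have "(\<lambda>(x, y). ?K x y * f x) \<in> borel_measurable (PiM (insert i I) (\<lambda>_. M) \<Otimes>\<^sub>M PiM (insert i I) (\<lambda>_. N))"
      using borel_measurable_times[OF meas[of "insert i I"] measurable_compose[OF measurable_fst, of f]]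
      by (simp add: case_prod_beta')
    from measurable_pair_swap[OF this]
    have [measurable]: "(\<lambda>y. LINT x|PiM (insert i I) (\<lambda>_. M). ?K x y * f x) \<in> borel_measurable (PiM (insert i I) (\<lambda>_. N))"
      by (intro MiI.borel_measurable_lebesgue_integral) simp
    have "(\<integral>\<^sup>+y. ennreal (cmod (LINT x|PiM (insert i I) (\<lambda>_. M). ?K x y * f x) powr q) \<partial>PiM (insert i I) (\<lambda>_. N))
      = (\<integral>\<^sup>+y. ennreal (cmod (LINT x|PiM I (\<lambda>_. M). LINT a|M. ?K (x(i := a)) y * f (x(i := a))) powr q) \<partial>PiM (insert i I) (\<lambda>_. N))"
      using M.product_integral_insert[OF insert(1,2) Kf] by (intro nn_integral_cong) simp
    also have "\<dots> = (\<integral>\<^sup>+y. \<integral>\<^sup>+b. ennreal (cmod (LINT x|PiM I (\<lambda>_. M). LINT a|M. ?K (x(i := a)) (y(i := b)) * f (x(i := a))) powr q) \<partial>N \<partial>PiM I (\<lambda>_. N))"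
    proof (rule N.product_nn_integral_insert[OF insert(1,2)])
      \<comment> \<open>Measurability is available for the integral over the full product and is
        transferred to the iterated integral, which has the same value.\<close>
      have "(\<lambda>y. ennreal (cmod (LINT x|PiM (insert i I) (\<lambda>_. M). ?K x y * f x) powr q)) \<in> borel_measurable (PiM (insert i I) (\<lambda>_. N))"
        by measurable
      then show "(\<lambda>y. ennreal (cmod (LINT x|PiM I (\<lambda>_. M). LINT a|M. ?K (x(i := a)) y * f (x(i := a))) powr q)) \<in> borel_measurable (PiM (insert i I) (\<lambda>_. N))"
        by (subst measurable_cong[where g = "\<lambda>y. ennreal (cmod (LINT x|PiM (insert i I) (\<lambda>_. M). ?K x y * f x) powr q)"])
           (simp_all add: M.product_integral_insert[OF insert(1,2) Kf])
    qed
    also have "\<dots> = (\<integral>\<^sup>+y. \<integral>\<^sup>+b. ennreal (cmod (LINT x|PiM I (\<lambda>_. M). LINT a|M. k1 x y * k a b * f (x(i := a))) powr q) \<partial>N \<partial>PiM I (\<lambda>_. N))"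
      unfolding K ..
    also have "\<dots> \<le> ennreal (C ^ card I * C) * epowr (\<integral>\<^sup>+x. \<integral>\<^sup>+a. ennreal (cmod (f (x(i := a))) powr p) \<partial>M \<partial>PiM I (\<lambda>_. M)) (q / p)"
    proof (rule bounded_kernel_op_tensor[OF MI.sigma_finite_measure_axioms sf(1) fN _ _ _ _ k pq _ C _ b f2])
      show "bounded_kernel_op (PiM I (\<lambda>_. M)) (PiM I (\<lambda>_. N)) k1 p q (C ^ card I)"
        using insert.IH by (simp add: k1_def[abs_def])
      show "cmod (k1 x y) \<le> 1" for x y using prod_le by (simp add: k1_def)
      show "finite_measure N" by (rule N0.finite_measure_axioms)
    qed (use C in \<open>auto simp: km\<close>)
    also have "(\<integral>\<^sup>+x. \<integral>\<^sup>+a. ennreal (cmod (f (x(i := a))) powr p) \<partial>M \<partial>PiM I (\<lambda>_. M)) = (\<integral>\<^sup>+x. ennreal (cmod (f x) powr p) \<partial>PiM (insert i I) (\<lambda>_. M))"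
      using insert by (intro M.product_nn_integral_insert[symmetric]) auto
    finally show "(\<integral>\<^sup>+y. ennreal (cmod (LINT x|PiM (insert i I) (\<lambda>_. M). ?K x y * f x) powr q) \<partial>PiM (insert i I) (\<lambda>_. N))
      \<le> ennreal (C ^ card (insert i I)) * epowr (\<integral>\<^sup>+x. ennreal (cmod (f x) powr p) \<partial>PiM (insert i I) (\<lambda>_. M)) (q / p)"
      using insert by (simp add: mult.commute)
  qed
qed

text \<open>Eight arcs starting at the points \<open>j / 8\<close> cover the parameter interval;
  adding the \<open>q\<close>-th powers costs a factor 8.\<close>

lemma restriction_circle:
  fixes p :: real
  assumes p: "1 < p" "p < 4/3"
  defines "q \<equiv> p / (3 * (p - 1))"
  shows "\<exists>K>0. bounded_kernel_op lborel circle_measure (\<lambda>x \<xi>. cis (- (2 * pi * (x \<bullet> \<xi>)))) p q K"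
proof -
  obtain K where K: "0 < K" and arc: "\<And>c f. integrable lborel f \<Longrightarrow>
    (\<integral>\<^sup>+t. ennreal (cmod (fourier_transform f (circ t)) powr q) * indicator {c..<c+1/8} t \<partial>lborel)
      \<le> ennreal K * epowr (\<integral>\<^sup>+x. ennreal (cmod (f x) powr p) \<partial>lborel) (q / p)"
    using restriction_arc[OF p] unfolding q_def by blast
  show ?thesis
  proof (intro exI[of _ "8 * K"] conjI)
    show "bounded_kernel_op lborel circle_measure (\<lambda>x \<xi>. cis (- (2 * pi * (x \<bullet> \<xi>)))) p q (8 * K)"
      unfolding bounded_kernel_op_def fourier_transform_cis[symmetric]
    proof (intro allI impI)
      fix f :: "real^2 \<Rightarrow> complex" assume f: "integrable lborel f"
      have [measurable]: "f \<in> borel_measurable borel" using f by simp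
      define F where "F t = ennreal (cmod (fourier_transform f (circ t)) powr q)" for t
      have [measurable]: "F \<in> borel_measurable borel" unfolding F_def by measurable
      let ?I = "\<lambda>j::nat. {real j / 8..<real j / 8 + 1/8}"
      have "(\<integral>\<^sup>+\<xi>. ennreal (cmod (fourier_transform f \<xi>) powr q) \<partial>circle_measure) = (\<integral>\<^sup>+t. F t * indicator {0..<1} t \<partial>lborel)"
        unfolding F_def by (rule nn_integral_circle) measurable
      also have "\<dots> \<le> (\<integral>\<^sup>+t. (\<Sum>j<8. F t * indicator (?I j) t) \<partial>lborel)"
      proof (rule nn_integral_mono)
        fix t :: real
        show "F t * indicator {0..<1} t \<le> (\<Sum>j<8. F t * indicator (?I j) t)"
        proof (cases "t \<in> {0..<1}")
          case True
          define j where "j = nat \<lfloor>8 * t\<rfloor>"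
          have "real j = of_int \<lfloor>8 * t\<rfloor>" using True by (simp add: j_def)
          then have j: "real j \<le> 8 * t" "8 * t < real j + 1" by linarith+
          then have "j < 8" using True by simp
          then have "F t * indicator (?I j) t \<le> (\<Sum>j<8. F t * indicator (?I j) t)"
            by (intro member_le_sum) auto
          then show ?thesis using j True by (simp add: indicator_def)
        qed simp
      qed
      also have "\<dots> = (\<Sum>j<8. \<integral>\<^sup>+t. F t * indicator (?I j) t \<partial>lborel)"
        by (rule nn_integral_sum) measurable
      also have "\<dots> \<le> (\<Sum>j<8::nat. ennreal K * epowr (\<integral>\<^sup>+x. ennreal (cmod (f x) powr p) \<partial>lborel) (q / p))"
        unfolding F_def by (intro sum_mono arc f)
      also have "\<dots> = ennreal (8 * K) * epowr (\<integral>\<^sup>+x. ennreal (cmod (f x) powr p) \<partial>lborel) (q / p)"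
        using K by (simp add: ennreal_mult mult.assoc)
      finally show "(\<integral>\<^sup>+\<xi>. ennreal (cmod (fourier_transform f \<xi>) powr q) \<partial>circle_measure) \<le> \<dots>" .
    qed
  qed (use K in simp)
qed

lemma cis_sum: "finite A \<Longrightarrow> cis (\<Sum>i\<in>A. a i) = (\<Prod>i\<in>A. cis (a i))"
  by (induction A rule: finite_induct) (auto simp: cis_mult[symmetric])

lemma fourier_transform_vec:
  fixes f :: "real^2^'n::finite \<Rightarrow> complex"
  assumes [measurable]: "f \<in> borel_measurable borel"
  shows "fourier_transform f (vec_lambda y) = (LINT x|PiM UNIV (\<lambda>_. lborel). (\<Prod>i\<in>UNIV. cis (- (2 * pi * (x i \<bullet> y i)))) * f (vec_lambda x))"
proof -
  have "fourier_transform f (vec_lambda y) = (LINT x|PiM UNIV (\<lambda>_. lborel). cis (- (2 * pi * (vec_lambda x \<bullet> vec_lambda y))) * f (vec_lambda x))"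
    unfolding fourier_transform_cis by (rule integral_vec) measurable
  also have "(\<lambda>x. cis (- (2 * pi * (vec_lambda x \<bullet> vec_lambda y)))) = (\<lambda>x. \<Prod>i\<in>UNIV. cis (- (2 * pi * (x i \<bullet> y i))))"
    by (simp add: inner_vec_def sum_distrib_left sum_negf[symmetric] cis_sum)
  finally show ?thesis by simp
qed

lemma restriction_torus_endpoint:
  fixes p :: real
  assumes p: "1 < p" "p < 4/3"
  defines "q \<equiv> p / (3 * (p - 1))"
  shows "\<exists>K>0. \<forall>f :: real^2^'n::finite \<Rightarrow> complex. integrable lborel f \<longrightarrow>
    (\<integral>\<^sup>+\<xi>. ennreal (cmod (fourier_transform f \<xi>) powr q) \<partial>torus_measure)
      \<le> ennreal K * epowr (\<integral>\<^sup>+x. ennreal (cmod (f x) powr p) \<partial>lborel) (q / p)"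
proof -
  obtain K where K: "0 < K" and b: "bounded_kernel_op lborel circle_measure (\<lambda>x \<xi>. cis (- (2 * pi * (x \<bullet> \<xi>)))) p q K"
    using restriction_circle[OF p] unfolding q_def by blast
  \<comment> \<open>\<open>p < 4/3\<close> says \<open>3 * (p - 1) < 1\<close>; the tensor product
    lemma needs this order of the exponents.\<close>
  have pq: "p \<le> q"
  proof -
    have "p * (3 * (p - 1)) \<le> p * 1" using p by (intro mult_left_mono) auto
    then show ?thesis using p by (simp add: q_def field_simps)
  qed
  have "(\<lambda>x. x) \<in> circle_measure \<rightarrow>\<^sub>M borel"
    by (auto simp: measurable_restrict_space1 cong: measurable_cong_sets)
  note [measurable] = measurable_compose[OF measurable_snd this]
  have m: "(\<lambda>(x, \<xi>). cis (- (2 * pi * (x \<bullet> \<xi>)))) \<in> borel_measurable (lborel \<Otimes>\<^sub>M circle_measure)"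
    unfolding case_prod_beta' by measurable
  have B: "bounded_kernel_op (PiM UNIV (\<lambda>_::'n. lborel)) (PiM UNIV (\<lambda>_. circle_measure))
     (\<lambda>x y. \<Prod>i\<in>UNIV. cis (- (2 * pi * (x i \<bullet> y i)))) p q (K ^ card (UNIV :: 'n set))"
    by (rule bounded_kernel_op_PiM[OF sigma_finite_lborel prob_space_circle m _ _ pq _ b]) (use p K in auto)
  show ?thesis
  proof (intro exI[of _ "K ^ card (UNIV :: 'n set)"] conjI allI impI)
    fix f :: "real^2^'n \<Rightarrow> complex" assume f: "integrable lborel f"
    have [measurable]: "f \<in> borel_measurable borel" using f by simp
    have "(\<integral>\<^sup>+\<xi>. ennreal (cmod (fourier_transform f \<xi>) powr q) \<partial>torus_measure) = (\<integral>\<^sup>+y. ennreal (cmod (fourier_transform f (vec_lambda y)) powr q) \<partial>PiM UNIV (\<lambda>_. circle_measure))"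
      by (rule nn_integral_torus) measurable
    also have "\<dots> \<le> ennreal (K ^ card (UNIV :: 'n set)) * epowr (\<integral>\<^sup>+x. ennreal (cmod (f (vec_lambda x)) powr p) \<partial>PiM UNIV (\<lambda>_. lborel)) (q / p)"
      using B f unfolding bounded_kernel_op_def by (simp add: fourier_transform_vec integrable_vec)
    also have "(\<integral>\<^sup>+x. ennreal (cmod (f (vec_lambda x)) powr p) \<partial>PiM UNIV (\<lambda>_. lborel)) = (\<integral>\<^sup>+x. ennreal (cmod (f x) powr p) \<partial>lborel)"
      by (rule nn_integral_vec[symmetric]) measurable
    finally show "(\<integral>\<^sup>+\<xi>. ennreal (cmod (fourier_transform f \<xi>) powr q) \<partial>torus_measure)
      \<le> ennreal (K ^ card (UNIV :: 'n set)) * epowr (\<integral>\<^sup>+x. ennreal (cmod (f x) powr p) \<partial>lborel) (q / p)" .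
  qed (use K in simp)
qed

text \<open>Hoelder's inequality against the constant function 1, whose norm is 1 on a probability
  space.\<close>

lemma (in prob_space) nn_integral_powr_mono_exponent:
  fixes h :: "'a \<Rightarrow> real"
  assumes [measurable]: "h \<in> borel_measurable M" and h: "\<And>x. 0 \<le> h x" and q: "0 < q" "q \<le> r"
  shows "(\<integral>\<^sup>+x. ennreal (h x powr q) \<partial>M) \<le> epowr (\<integral>\<^sup>+x. ennreal (h x powr r) \<partial>M) (q / r)"
proof (cases "q = r")
  case True then show ?thesis using q by simp
next
  case False
  then have qr: "1 < r / q" using q by simp
  define s where "s = (r / q) / (r / q - 1)"
  have "(\<integral>\<^sup>+x. ennreal (h x powr q) \<partial>M) = (\<integral>\<^sup>+x. ennreal (h x powr q * 1) \<partial>M)" by simp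
  also have "\<dots> \<le> epowr (\<integral>\<^sup>+x. ennreal ((h x powr q) powr (r / q)) \<partial>M) (1 / (r / q)) * epowr (\<integral>\<^sup>+x. ennreal (1 powr s) \<partial>M) (1 / s)"
  proof (rule nn_integral_Holder)
    have "q < r" using False q by simp
    then show "1 < s" "1 / (r / q) + 1 / s = 1" using q by (simp_all add: s_def field_simps)
  qed (use qr in auto)
  also have "(\<integral>\<^sup>+x. ennreal (1 powr s) \<partial>M) = ennreal 1" by (simp add: emeasure_space_1)
  finally show ?thesis using q by (simp add: powr_powr del: ennreal_1) simp
qed

lemma measurable_torus_measure: "f \<in> borel_measurable borel \<Longrightarrow> f \<in> borel_measurable torus_measure"
  by (simp add: torus_measure_def measurable_restrict_space1)

text \<open>For \<open>p = 1\<close> the pointwise bound of the transform by the L1 norm serves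
  every \<open>q\<close>. Otherwise the hypothesis on \<open>q\<close> says that it is at most the
  endpoint exponent \<open>r\<close>, and lowering the exponent on a probability space is
  free.\<close>

lemma restriction_torus:
  fixes p q :: real
  assumes p: "1 \<le> p" "p < 4/3" and q: "1 \<le> q" "ereal q \<le> conjugate_exponent p / 3"
  shows "\<exists>K>0. \<forall>f :: real^2^'n::finite \<Rightarrow> complex. integrable lborel f \<longrightarrow>
    (\<integral>\<^sup>+\<xi>. ennreal (cmod (fourier_transform f \<xi>) powr q) \<partial>torus_measure)
      \<le> ennreal K * epowr (\<integral>\<^sup>+x. ennreal (cmod (f x) powr p) \<partial>lborel) (q / p)"
proof (cases "p = 1")
  case True
  show ?thesis
  proof (intro exI[of _ 1] conjI allI impI)
    interpret prob_space "torus_measure :: (real^2^'n) measure" by (rule prob_space_torus)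
    fix f :: "real^2^'n \<Rightarrow> complex" assume f: "integrable lborel f"
    have "(\<integral>\<^sup>+\<xi>. ennreal (cmod (fourier_transform f \<xi>) powr q) \<partial>torus_measure) \<le> (\<integral>\<^sup>+(\<xi>::real^2^'n). ennreal ((LINT x|lborel. cmod (f x)) powr q) \<partial>torus_measure)"
      using q norm_fourier_transform_le by (intro nn_integral_mono ennreal_leI powr_mono2) auto
    also have "\<dots> = ennreal ((LINT x|lborel. cmod (f x)) powr q)" by (simp add: emeasure_space_1)
    also have "\<dots> = epowr (\<integral>\<^sup>+x. ennreal (cmod (f x) powr p) \<partial>lborel) (q / p)"
      using True f by (simp add: nn_integral_eq_integral)
    finally show "(\<integral>\<^sup>+\<xi>. ennreal (cmod (fourier_transform f \<xi>) powr q) \<partial>torus_measure) \<le> ennreal 1 * epowr (\<integral>\<^sup>+x. ennreal (cmod (f x) powr p) \<partial>lborel) (q / p)"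
      by simp
  qed simp
next
  case False
  then have p1: "1 < p" using p by simp
  define r where "r = p / (3 * (p - 1))"
  have qr: "q \<le> r"
    using q(2) False by (simp add: conjugate_exponent_def r_def mult.commute)
  obtain K where K: "0 < K" and b: "\<And>f :: real^2^'n \<Rightarrow> complex. integrable lborel f \<Longrightarrow>
    (\<integral>\<^sup>+\<xi>. ennreal (cmod (fourier_transform f \<xi>) powr r) \<partial>torus_measure)
      \<le> ennreal K * epowr (\<integral>\<^sup>+x. ennreal (cmod (f x) powr p) \<partial>lborel) (r / p)"
    using restriction_torus_endpoint[OF p1 p(2)] unfolding r_def by blast
  show ?thesis
  proof (intro exI[of _ "K powr (q / r)"] conjI allI impI)
    interpret prob_space "torus_measure :: (real^2^'n) measure" by (rule prob_space_torus)
    fix f :: "real^2^'n \<Rightarrow> complex" assume f: "integrable lborel f"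
    have [measurable]: "f \<in> borel_measurable borel" using f by simp
    have "(\<integral>\<^sup>+\<xi>. ennreal (cmod (fourier_transform f \<xi>) powr q) \<partial>torus_measure) \<le> epowr (\<integral>\<^sup>+\<xi>. ennreal (cmod (fourier_transform f \<xi>) powr r) \<partial>torus_measure) (q / r)"
      using q qr by (intro nn_integral_powr_mono_exponent measurable_torus_measure) auto
    also have "\<dots> \<le> epowr (ennreal K * epowr (\<integral>\<^sup>+x. ennreal (cmod (f x) powr p) \<partial>lborel) (r / p)) (q / r)"
      using q qr by (intro epowr_mono b f) auto
    also have "\<dots> = ennreal (K powr (q / r)) * epowr (\<integral>\<^sup>+x. ennreal (cmod (f x) powr p) \<partial>lborel) (q / p)"
      using K q qr by (simp add: epowr_cmult epowr_epowr)
    finally show "(\<integral>\<^sup>+\<xi>. ennreal (cmod (fourier_transform f \<xi>) powr q) \<partial>torus_measure) \<le> \<dots>" .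
  qed (use K in simp)
qed

section \<open>Density of test functions\<close>

text \<open>The powers of \<open>inverse t\<close> are carried along so that the linear span of the
  family is closed under differentiation.\<close>

definition bump :: "nat \<Rightarrow> real \<Rightarrow> real" where
  "bump j t = (if 0 < t then exp (- inverse t) * inverse t ^ j else 0)"

text \<open>In the variable \<open>inverse t\<close> the exponential beats every power.\<close>

lemma bump_tendsto_0: "(bump j \<longlongrightarrow> 0) (at_right 0)"
proof -
  have "((\<lambda>t. inverse t ^ j / exp (inverse t)) \<longlongrightarrow> 0) (at_right (0::real))"
    by (rule filterlim_compose[OF tendsto_power_div_exp_0 filterlim_inverse_at_top_right])
  moreover have "\<forall>\<^sub>F t in at_right (0::real). inverse t ^ j / exp (inverse t) = bump j t"
    by (auto simp: eventually_at_right_field bump_def exp_minus divide_inverse mult.commute intro!: exI[of _ 1])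
  ultimately show ?thesis by (rule Lim_transform_eventually)
qed

lemma bump_deriv:
  "(bump j has_real_derivative (bump (j + 2) t - real j * bump (j + 1) t)) (at t)"
proof -
  consider "t < 0" | "t = 0" | "0 < t" by linarith
  then show ?thesis
  proof cases
    case 1
    have "((\<lambda>_. 0) has_real_derivative 0) (at t)" by simp
    then have "(bump j has_real_derivative 0) (at t)"
      by (rule has_field_derivative_transform_within_open[of _ _ _ "{..<0}"]) (use 1 in \<open>auto simp: bump_def\<close>)
    then show ?thesis using 1 by (simp add: bump_def)
  next
    case 2
    \<comment> \<open>From the right, the difference quotient of \<open>bump j\<close> at 0 is
      \<open>bump (j + 1) h\<close>, which again tends to 0.\<close>
    have "((\<lambda>h. (bump j (0 + h) - bump j 0) / h) \<longlongrightarrow> 0) (at 0)"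
    proof (rule filterlim_split_at_real)
      have "\<forall>\<^sub>F h in at_left (0::real). 0 = (bump j (0 + h) - bump j 0) / h"
        by (auto simp: eventually_at_left_field bump_def intro!: exI[of _ "-1"])
      then show "((\<lambda>h. (bump j (0 + h) - bump j 0) / h) \<longlongrightarrow> 0) (at_left 0)"
        by (rule Lim_transform_eventually[OF tendsto_const])
      have "\<forall>\<^sub>F h in at_right (0::real). bump (j + 1) h = (bump j (0 + h) - bump j 0) / h"
        by (auto simp: eventually_at_right_field bump_def divide_inverse intro!: exI[of _ 1])
      then show "((\<lambda>h. (bump j (0 + h) - bump j 0) / h) \<longlongrightarrow> 0) (at_right 0)"
        by (rule Lim_transform_eventually[OF bump_tendsto_0])
    qed
    then show ?thesis using 2 by (simp add: DERIV_def bump_def)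
  next
    case 3
    have "((\<lambda>t. exp (- inverse t) * inverse t ^ j) has_real_derivative (bump (j + 2) t - real j * bump (j + 1) t)) (at t)"
      using 3 by (auto intro!: derivative_eq_intros simp: bump_def power2_eq_square)
         (cases j; simp add: field_simps power2_eq_square)
    then show ?thesis
      by (rule has_field_derivative_transform_within_open[of _ _ _ "{0<..}"]) (use 3 in \<open>auto simp: bump_def\<close>)
  qed
qed

lemma real_polynomial_function_derivative:
  fixes p :: "'a::euclidean_space \<Rightarrow> real"
  assumes "real_polynomial_function p"
  shows "\<exists>p'. (\<forall>x. (p has_derivative p' x) (at x)) \<and> (\<forall>v. real_polynomial_function (\<lambda>x. p' x v))"
  using assms
proof induction
  case (linear f)
  then show ?case
    by (intro exI[of _ "\<lambda>_. f"]) (auto intro: bounded_linear_imp_has_derivative)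
next
  case (const c)
  show ?case by (intro exI[of _ "\<lambda>_ _. 0"]) auto
next
  case (add f g)
  then obtain f' g' where "\<forall>x. (f has_derivative f' x) (at x)" "\<forall>v. real_polynomial_function (\<lambda>x. f' x v)"
    "\<forall>x. (g has_derivative g' x) (at x)" "\<forall>v. real_polynomial_function (\<lambda>x. g' x v)" by blast
  then show ?case
    by (intro exI[of _ "\<lambda>x v. f' x v + g' x v"]) (auto intro: has_derivative_add real_polynomial_function.intros)
next
  case (mult f g)
  then obtain f' g' where "\<forall>x. (f has_derivative f' x) (at x)" "\<forall>v. real_polynomial_function (\<lambda>x. f' x v)"
    "\<forall>x. (g has_derivative g' x) (at x)" "\<forall>v. real_polynomial_function (\<lambda>x. g' x v)" by blast
  moreover from this have "real_polynomial_function (\<lambda>x. f x * g' x v + f' x v * g x)" for v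
    using mult.hyps by (intro real_polynomial_function.intros(3)[OF real_polynomial_function.intros(4) real_polynomial_function.intros(4)]) auto
  ultimately show ?case
    by (intro exI[of _ "\<lambda>x v. f x * g' x v + f' x v * g x"]) (auto intro: has_derivative_mult)
qed

lemma polynomial_function_derivative_complex:
  fixes p :: "'a::euclidean_space \<Rightarrow> complex"
  assumes "polynomial_function p"
  shows "\<exists>p'. (\<forall>x. (p has_derivative p' x) (at x)) \<and> (\<forall>v. polynomial_function (\<lambda>x. p' x v))"
proof -
  have "real_polynomial_function (\<lambda>x. Re (p x))" "real_polynomial_function (\<lambda>x. Im (p x))"
    using assms bounded_linear_Re bounded_linear_Im unfolding polynomial_function_def by (auto simp: o_def)
  then obtain a b where ab: "\<And>x. ((\<lambda>x. Re (p x)) has_derivative a x) (at x)" "\<And>v. real_polynomial_function (\<lambda>x. a x v)"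
    "\<And>x. ((\<lambda>x. Im (p x)) has_derivative b x) (at x)" "\<And>v. real_polynomial_function (\<lambda>x. b x v)"
    using real_polynomial_function_derivative by metis
  have "((\<lambda>x. Re (p x) *\<^sub>R 1 + Im (p x) *\<^sub>R \<i>) has_derivative (\<lambda>v. a x v *\<^sub>R 1 + b x v *\<^sub>R \<i>)) (at x)" for x
    by (intro has_derivative_add has_derivative_scaleR_left ab)
  moreover have "(\<lambda>x. Re (p x) *\<^sub>R 1 + Im (p x) *\<^sub>R \<i>) = p"
    by (simp add: fun_eq_iff complex_eq_iff)
  moreover have "polynomial_function (\<lambda>x. a x v *\<^sub>R 1 + b x v *\<^sub>R \<i> :: complex)" for v
    using ab by (intro polynomial_function_add polynomial_function_mult) (auto simp: real_polynomial_function_eq)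
  ultimately show ?thesis by (intro exI[of _ "\<lambda>x v. a x v *\<^sub>R 1 + b x v *\<^sub>R \<i>"]) auto
qed

text \<open>The smallest convenient class that contains polynomial multiples of a smooth bump on the
  ball of radius \<open>R\<close> and is stable under directional derivatives; stability is what
  \<open>C_class\<close> asks for at every order. The sums are needed for the product rule.\<close>

inductive_set bump_class :: "real \<Rightarrow> ('a::euclidean_space \<Rightarrow> complex) set" for R :: real where
  bump: "polynomial_function P \<Longrightarrow> (\<lambda>x. bump j (R\<^sup>2 - x \<bullet> x) *\<^sub>R P x) \<in> bump_class R"
| add: "f \<in> bump_class R \<Longrightarrow> g \<in> bump_class R \<Longrightarrow> (\<lambda>x. f x + g x) \<in> bump_class R"

lemma bump_class_derivative:
  assumes "f \<in> bump_class R"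
  shows "\<exists>f'. (\<forall>x. (f has_derivative f' x) (at x)) \<and> (\<forall>v. (\<lambda>x. f' x v) \<in> bump_class R)"
  using assms
proof induction
  case (bump P j)
  then obtain P' where P': "\<And>x. (P has_derivative P' x) (at x)" "\<And>v. polynomial_function (\<lambda>x. P' x v)"
    using polynomial_function_derivative_complex by blast
  let ?u = "\<lambda>x. R\<^sup>2 - x \<bullet> x"
  \<comment> \<open>Product rule, where the gradient \<open>-2 *\<^sub>R x\<close> of
    \<open>R\<^sup>2 - x \<bullet> x\<close> is a polynomial and \<open>bump_deriv\<close> produces
    the indices \<open>j + 2\<close> and \<open>j + 1\<close>.\<close>
  define f' where "f' x v = bump j (?u x) *\<^sub>R P' x v + (bump (j + 2) (?u x) *\<^sub>R ((- (2 * (x \<bullet> v))) *\<^sub>R P x) +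
     bump (j + 1) (?u x) *\<^sub>R ((2 * real j * (x \<bullet> v)) *\<^sub>R P x))" for x v
  have "((\<lambda>x. bump j (?u x) *\<^sub>R P x) has_derivative f' x) (at x)" for x
  proof -
    have u: "(?u has_derivative (\<lambda>v. - (2 * (x \<bullet> v)))) (at x)"
      by (auto intro!: derivative_eq_intros simp: inner_commute)
    have "((\<lambda>x. bump j (?u x)) has_derivative (\<lambda>v. - (2 * (x \<bullet> v)) * (bump (j + 2) (?u x) - real j * bump (j + 1) (?u x)))) (at x)"
      using DERIV_compose_FDERIV[OF bump_deriv u] by simp
    from has_derivative_scaleR[OF this P'(1)[of x]] show ?thesis
      by (rule has_derivative_eq_rhs) (auto simp: fun_eq_iff f'_def algebra_simps scaleR_conv_of_real)
  qed
  moreover have "(\<lambda>x. f' x v) \<in> bump_class R" for v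
  proof -
    have l: "polynomial_function (\<lambda>x::'a. x \<bullet> v)"
      using bounded_linear_inner_left[of v] by (auto simp: real_polynomial_function_eq[symmetric] intro: real_polynomial_function.intros)
    have l1: "polynomial_function (\<lambda>x. c * (x \<bullet> v))" for c
      using polynomial_function_mult[OF polynomial_function_const[of c] l] by simp
    have "polynomial_function (\<lambda>x. (- 2 * (x \<bullet> v)) *\<^sub>R P x)" "polynomial_function (\<lambda>x. (2 * real j * (x \<bullet> v)) *\<^sub>R P x)"
      using polynomial_function_mult[OF l1[of "- 2"] bump] polynomial_function_mult[OF l1[of "2 * real j"] bump] by simp_all
    then show ?thesis unfolding f'_def by (intro bump_class.intros P') simp_all
  qed
  ultimately show ?case by blast
next
  case (add f g)
  then obtain f' g' where "\<forall>x. (f has_derivative f' x) (at x)" "\<forall>v. (\<lambda>x. f' x v) \<in> bump_class R"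
    "\<forall>x. (g has_derivative g' x) (at x)" "\<forall>v. (\<lambda>x. g' x v) \<in> bump_class R" by blast
  then show ?case
    by (intro exI[of _ "\<lambda>x v. f' x v + g' x v"]) (auto intro: has_derivative_add bump_class.add)
qed

lemma C_class_bump_class: "f \<in> bump_class R \<Longrightarrow> C_class k f"
proof (induction k arbitrary: f)
  case 0
  obtain f' where "\<forall>x. (f has_derivative f' x) (at x)" using bump_class_derivative[OF 0] by blast
  then show ?case by (auto intro!: continuous_at_imp_continuous_on has_derivative_continuous)
next
  case (Suc k)
  obtain f' where f': "\<And>x. (f has_derivative f' x) (at x)" "\<And>v. (\<lambda>x. f' x v) \<in> bump_class R"
    using bump_class_derivative[OF Suc.prems] by blast
  have "frechet_derivative f (at x) = f' x" for x
    using frechet_derivative_at[OF f'(1)] by simp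
  then show ?case using f' Suc.IH by (auto simp: differentiable_def)
qed

lemma bump_class_eq_0: "f \<in> bump_class R \<Longrightarrow> R \<le> norm x \<Longrightarrow> 0 \<le> R \<Longrightarrow> f x = 0"
proof (induction rule: bump_class.induct)
  case (bump P j)
  then have "R\<^sup>2 \<le> (norm x)\<^sup>2" by (intro power_mono) auto
  then show ?case by (simp add: bump_def dot_square_norm)
qed simp

lemma compact_support_norm:
  fixes f :: "'a::euclidean_space \<Rightarrow> complex"
  assumes "\<And>x. R \<le> norm x \<Longrightarrow> f x = 0"
  shows "compact (closure {x. f x \<noteq> 0})"
proof -
  have "{x. f x \<noteq> 0} \<subseteq> cball 0 R" using assms by (auto simp: not_le[symmetric]) (meson le_cases)
  then have "bounded {x. f x \<noteq> 0}" using bounded_cball bounded_subset by blast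
  then show ?thesis by (simp add: compact_closure)
qed

text \<open>Instead of mollifying, \<open>f\<close> is divided by a bump that is positive on its
  support, the quotient is approximated by a polynomial on a ball, and the bump is multiplied back.
  The bump is at most 1, so the uniform error does not grow.\<close>

lemma test_functions_approx:
  fixes f :: "'a::euclidean_space \<Rightarrow> complex"
  assumes f: "continuous_on UNIV f" and supp: "\<And>x. R \<le> norm x \<Longrightarrow> f x = 0" and R: "0 \<le> R" and e: "0 < e"
  shows "\<exists>g\<in>test_functions. (\<forall>x. cmod (f x - g x) \<le> e) \<and> (\<forall>x. R + 1 \<le> norm x \<longrightarrow> g x = 0)"
proof -
  define \<eta> where "\<eta> x = bump 0 ((R + 1)\<^sup>2 - x \<bullet> x)" for x :: 'a
  have c\<eta>: "continuous_on UNIV \<eta>"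
  proof -
    have "continuous_on UNIV (bump 0)"
      by (intro continuous_at_imp_continuous_on ballI DERIV_isCont[OF bump_deriv])
    then show ?thesis unfolding \<eta>_def
      by (rule continuous_on_compose2) (auto intro!: continuous_intros)
  qed
  have \<eta>1: "0 \<le> \<eta> x" "\<eta> x \<le> 1" for x by (auto simp: \<eta>_def bump_def)
  \<comment> \<open>The least value of \<open>\<eta>\<close> on the ball of radius \<open>R\<close>.
    Dividing by \<open>max (\<eta> x) c\<close> leaves the quotient unchanged there and keeps it
    continuous outside, where \<open>f\<close> vanishes.\<close>
  define c where "c = bump 0 ((R + 1)\<^sup>2 - R\<^sup>2)"
  have RR: "0 < (R + 1)\<^sup>2 - R\<^sup>2" using R by (simp add: power2_eq_square algebra_simps)
  then have c: "0 < c" by (simp add: c_def bump_def)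
  define h where "h x = f x / complex_of_real (max (\<eta> x) c)" for x
  have ch: "continuous_on UNIV h"
    unfolding h_def using c by (intro continuous_intros f c\<eta>) (auto simp: max_def)
  have fh: "f x = \<eta> x *\<^sub>R h x" for x
  proof (cases "R \<le> norm x")
    case True then show ?thesis using supp by (simp add: h_def)
  next
    case False
    then have "x \<bullet> x \<le> R\<^sup>2" by (simp add: dot_square_norm power_mono)
    then have "c \<le> \<eta> x"
      using RR by (auto simp: c_def \<eta>_def bump_def le_imp_inverse_le)
    then show ?thesis using c by (simp add: h_def max_def scaleR_conv_of_real)
  qed
  obtain P where P: "polynomial_function P" "\<And>x. x \<in> cball 0 (R + 1) \<Longrightarrow> norm (h x - P x) < e"
    using Stone_Weierstrass_polynomial_function[of "cball 0 (R + 1)" h e] e continuous_on_subset[OF ch] by auto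
  define g where "g x = \<eta> x *\<^sub>R P x" for x
  have g: "g \<in> bump_class (R + 1)" unfolding g_def \<eta>_def by (rule bump_class.bump[OF P(1)])
  have g0: "g x = 0" if "R + 1 \<le> norm x" for x using bump_class_eq_0[OF g that] R by simp
  have "g \<in> test_functions"
    unfolding test_functions_def using C_class_bump_class[OF g] compact_support_norm[of "R + 1" g] g0 by blast
  moreover have "cmod (f x - g x) \<le> e" for x
  proof (cases "R + 1 \<le> norm x")
    case True then show ?thesis using g0 supp[of x] e by simp
  next
    case False
    have "cmod (f x - g x) = \<eta> x * cmod (h x - P x)"
      unfolding fh g_def scaleR_diff_right[symmetric] using \<eta>1 by simp
    also have "\<dots> \<le> 1 * e" using P(2)[of x] False \<eta>1 e by (intro mult_mono) (auto simp: less_imp_le)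
    finally show ?thesis by simp
  qed
  ultimately show ?thesis using g0 by blast
qed

lemma emeasure_cball_less_top: "emeasure lborel (cball c r :: 'a::euclidean_space set) < top"
  using emeasure_bounded_finite[OF bounded_cball, of c r] unfolding infinity_ennreal_def .

lemma power_powr_commute: "0 \<le> x \<Longrightarrow> (x ^ n) powr a = (x powr a) ^ n" for x a :: real
  by (induction n) (auto simp: powr_mult)

lemma
  fixes f :: "'a::euclidean_space \<Rightarrow> complex"
  assumes f: "continuous_on UNIV f" and supp: "\<And>x. R \<le> norm x \<Longrightarrow> f x = 0"
  shows integrable_Cc: "integrable lborel f"
    and integrable_Cc_powr: "0 < p \<Longrightarrow> integrable lborel (\<lambda>x. cmod (f x) powr p)"
    and bounded_Cc: "\<exists>B. \<forall>x. cmod (f x) \<le> B"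
proof -
  have [measurable]: "f \<in> borel_measurable borel" using f by (rule borel_measurable_continuous_onI)
  have "compact (f ` cball 0 R)" using continuous_on_subset[OF f] by (intro compact_continuous_image) auto
  then obtain B where B: "\<And>x. x \<in> cball 0 R \<Longrightarrow> cmod (f x) \<le> B" 
    by (meson bounded_iff compact_imp_bounded imageI)
  then have B': "cmod (f x) \<le> max 0 B" for x
    using supp[of x] by (cases "R \<le> norm x") (auto simp: le_max_iff_disj)
  then show "\<exists>B. \<forall>x. cmod (f x) \<le> B" by blast
  have int: "integrable lborel (\<lambda>x::'a. indicator (cball 0 R) x * c)" for c :: real
    by (intro integrable_mult_left impI integrable_real_indicator) (auto simp: emeasure_cball_less_top)
  show "integrable lborel f"
  proof (rule Bochner_Integration.integrable_bound[OF int[of "max 0 B"]])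
    show "AE x in lborel. norm (f x) \<le> norm (indicator (cball 0 R) x * max 0 B)"
      using B' supp by (auto simp: indicator_def not_le)
  qed measurable
  show "integrable lborel (\<lambda>x. cmod (f x) powr p)" if "0 < p"
  proof (rule Bochner_Integration.integrable_bound[OF int[of "max 0 B powr p"]])
    show "AE x in lborel. norm (cmod (f x) powr p) \<le> norm (indicator (cball 0 R) x * max 0 B powr p)"
      using B' supp that by (auto simp: indicator_def not_le intro!: powr_mono2)
  qed measurable
qed

lemma test_functions_support:
  assumes "f \<in> test_functions"
  obtains R where "0 \<le> R" "\<And>x. R \<le> norm x \<Longrightarrow> f x = 0" "continuous_on UNIV f"
proof -
  have c: "continuous_on UNIV f" using assms C_class.simps(1)[of f] by (auto simp: test_functions_def)
  have "bounded (closure {x. f x \<noteq> 0})" using assms compact_imp_bounded by (auto simp: test_functions_def)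
  then obtain B where "\<And>x. x \<in> closure {x. f x \<noteq> 0} \<Longrightarrow> norm x \<le> B"
    by (auto simp: bounded_iff)
  then have B: "norm x \<le> B" if "f x \<noteq> 0" for x
    using that closure_subset[of "{x. f x \<noteq> 0}"] by blast
  show ?thesis
  proof (rule that[of "max 0 B + 1"])
    show "f x = 0" if "max 0 B + 1 \<le> norm x" for x using B[of x] that by (cases "f x = 0") auto
  qed (use c in auto)
qed

text \<open>\<open>Lp_norm\<close> takes the value 0 when the integral diverges. Integrability of
  the right-hand function makes its norm genuine, and the finite bound then carries over to the
  left.\<close>

lemma nn_integral_le_imp_Lp_norm_le:
  fixes f :: "'a \<Rightarrow> complex" and g :: "'b \<Rightarrow> complex"
  assumes [measurable]: "f \<in> borel_measurable M" and g: "integrable N (\<lambda>x. cmod (g x) powr p)"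
    and K: "0 < K" and p: "0 < p" and q: "0 < q"
    and le: "(\<integral>\<^sup>+x. ennreal (cmod (f x) powr q) \<partial>M) \<le> ennreal K * epowr (\<integral>\<^sup>+x. ennreal (cmod (g x) powr p) \<partial>N) (q / p)"
  shows "Lp_norm M q f \<le> K powr (1 / q) * Lp_norm N p g"
proof -
  let ?g = "LINT x|N. cmod (g x) powr p"
  have g0: "0 \<le> ?g" by (intro Bochner_Integration.integral_nonneg) auto
  have "(\<integral>\<^sup>+x. ennreal (cmod (f x) powr q) \<partial>M) \<le> ennreal (K * ?g powr (q / p))"
    using le g g0 K by (simp add: nn_integral_eq_integral ennreal_mult)
  then have "(LINT x|M. cmod (f x) powr q) \<le> K * ?g powr (q / p)"
    by (subst integral_eq_nn_integral) (use K g0 in \<open>auto intro!: enn2real_leI\<close>)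
  then have "(LINT x|M. cmod (f x) powr q) powr (1 / q) \<le> (K * ?g powr (q / p)) powr (1 / q)"
    using q by (intro powr_mono2 Bochner_Integration.integral_nonneg) auto
  also have "\<dots> = K powr (1 / q) * ?g powr (1 / p)"
    using K g0 p q by (simp add: powr_mult powr_powr)
  finally show ?thesis by (simp add: Lp_norm_def)
qed

lemma torus_restriction_sufficient:
  fixes p q :: real
  assumes p: "1 \<le> p" "p < 4/3" and q: "1 \<le> q" "ereal q \<le> conjugate_exponent p / 3"
  shows "\<exists>C>0. \<forall>f \<in> (test_functions :: ((real^2^'n::finite) \<Rightarrow> complex) set).
            Lp_norm torus_measure q (fourier_transform f) \<le> C * Lp_norm lborel p f"
proof -
  obtain K where K: "0 < K" and b: "\<And>f :: real^2^'n \<Rightarrow> complex. integrable lborel f \<Longrightarrow>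
    (\<integral>\<^sup>+\<xi>. ennreal (cmod (fourier_transform f \<xi>) powr q) \<partial>torus_measure)
      \<le> ennreal K * epowr (\<integral>\<^sup>+x. ennreal (cmod (f x) powr p) \<partial>lborel) (q / p)"
    using restriction_torus[OF p q] by blast
  show ?thesis
  proof (intro exI[of _ "K powr (1 / q)"] conjI ballI)
    fix f :: "real^2^'n \<Rightarrow> complex" assume "f \<in> test_functions"
    then obtain R where R: "\<And>x. R \<le> norm x \<Longrightarrow> f x = 0" "continuous_on UNIV f"
      using test_functions_support by metis
    have [measurable]: "f \<in> borel_measurable borel" using R(2) by (rule borel_measurable_continuous_onI)
    show "Lp_norm torus_measure q (fourier_transform f) \<le> K powr (1 / q) * Lp_norm lborel p f"
      using p q K integrable_Cc_powr[OF R(2,1)] integrable_Cc[OF R(2,1)]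
      by (intro nn_integral_le_imp_Lp_norm_le b measurable_torus_measure) auto
  qed (use K in simp)
qed

section \<open>Extending an estimate to continuous functions and passing from the torus to the
  circle\<close>

lemma Lp_norm_tendsto:
  fixes f :: "'a \<Rightarrow> complex"
  assumes p: "0 < p" and [measurable]: "\<And>n. F n \<in> borel_measurable M" "f \<in> borel_measurable M"
    and lim: "\<And>x. (\<lambda>n. F n x) \<longlonglongrightarrow> f x"
    and w: "integrable M w" and bd: "\<And>n x. cmod (F n x) powr p \<le> w x"
  shows "(\<lambda>n. Lp_norm M p (F n)) \<longlonglongrightarrow> Lp_norm M p f"
proof -
  have "(\<lambda>n. LINT x|M. cmod (F n x) powr p) \<longlonglongrightarrow> (LINT x|M. cmod (f x) powr p)"
  proof (rule integral_dominated_convergence[where w = w])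
    show "AE x in M. (\<lambda>n. cmod (F n x) powr p) \<longlonglongrightarrow> cmod (f x) powr p"
      using p by (intro AE_I2 tendsto_powr' tendsto_norm lim tendsto_const) auto
  qed (use w bd in auto)
  then show ?thesis unfolding Lp_norm_def
    using p by (intro tendsto_powr' tendsto_const) (auto intro!: Bochner_Integration.integral_nonneg)
qed

text \<open>Test functions converge to \<open>f\<close> uniformly with supports in one ball.
  Dominated convergence then applies on both sides: the functions are bounded on that ball, and
  their transforms are bounded by a constant on a probability space.\<close>

lemma estimate_extends_to_Cc:
  fixes f :: "real^2^'n::finite \<Rightarrow> complex"
  assumes p: "1 \<le> p" and q: "1 \<le> q" and C: "0 < C"
    and est: "\<And>g. g \<in> (test_functions :: ((real^2^'n) \<Rightarrow> complex) set) \<Longrightarrow> Lp_norm torus_measure q (fourier_transform g) \<le> C * Lp_norm lborel p g"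
    and f: "continuous_on UNIV f" and supp: "\<And>x. R \<le> norm x \<Longrightarrow> f x = 0"
  shows "Lp_norm torus_measure q (fourier_transform f) \<le> C * Lp_norm lborel p f"
proof -
  interpret T: prob_space "torus_measure :: (real^2^'n) measure" by (rule prob_space_torus)
  define R' where "R' = max 0 R"
  have R': "0 \<le> R'" "\<And>x. R' \<le> norm x \<Longrightarrow> f x = 0" using supp by (auto simp: R'_def)
  obtain B where B: "\<And>x. cmod (f x) \<le> B" using bounded_Cc[OF f R'(2)] by blast
  have B0: "0 \<le> B" using B[of 0] norm_ge_zero order_trans by blast
  have "\<exists>g\<in>test_functions. (\<forall>x. cmod (f x - g x) \<le> 1 / real (Suc n)) \<and> (\<forall>x. R' + 1 \<le> norm x \<longrightarrow> g x = 0)" for n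
    by (rule test_functions_approx[OF f R'(2,1)]) auto
  then obtain G where G: "\<And>n. G n \<in> test_functions" "\<And>n x. cmod (f x - G n x) \<le> 1 / real (Suc n)"
    "\<And>n x. R' + 1 \<le> norm x \<Longrightarrow> G n x = 0" by metis
  have Gc: "continuous_on UNIV (G n)" for n using G(1)[of n] test_functions_support by metis
  have [measurable]: "G n \<in> borel_measurable borel" "f \<in> borel_measurable borel" for n
    using Gc f by (auto intro: borel_measurable_continuous_onI)
  have Glim: "(\<lambda>n. G n x) \<longlonglongrightarrow> f x" for x
  proof (rule LIM_zero_cancel)
    show "(\<lambda>n. G n x - f x) \<longlonglongrightarrow> 0"
      by (rule Lim_null_comparison[OF always_eventually LIMSEQ_Suc[OF lim_1_over_n]]) (use G(2) in \<open>auto simp: norm_minus_commute\<close>)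
  qed
  define w where "w x = indicator (cball 0 (R' + 1)) x * (B + 1)" for x :: "real^2^'n"
  have wi: "integrable lborel (\<lambda>x::real^2^'n. indicator (cball 0 (R' + 1)) x * c)" for c :: real
    by (intro integrable_mult_left impI integrable_real_indicator) (auto simp: emeasure_cball_less_top)
  have Gw: "cmod (G n x) \<le> w x" for n x
  proof (cases "R' + 1 \<le> norm x")
    case True then show ?thesis using G(3) B0 by (simp add: w_def)
  next
    case False
    have "cmod (G n x) \<le> cmod (f x) + cmod (f x - G n x)"
      using norm_triangle_sub[of "G n x" "f x"] by (simp add: norm_minus_commute)
    also have "\<dots> \<le> B + 1" using B[of x] G(2)[of x n] by (smt (verit) divide_le_eq_1 of_nat_Suc of_nat_0_le_iff)
    finally show ?thesis using False by (simp add: w_def)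
  qed
  have L1: "(\<lambda>n. Lp_norm lborel p (G n)) \<longlonglongrightarrow> Lp_norm lborel p f"
  proof (rule Lp_norm_tendsto[OF _ _ _ Glim wi[of "(B + 1) powr p"]])
    show "cmod (G n x) powr p \<le> indicator (cball 0 (R' + 1)) x * (B + 1) powr p" for n x
    proof -
      have "cmod (G n x) powr p \<le> w x powr p" using Gw p by (intro powr_mono2) auto
      then show ?thesis by (auto simp: w_def indicator_def split: if_splits)
    qed
  qed (use p in auto)
  have wint: "integrable lborel w" unfolding w_def by (rule wi)
  define W where "W = (LINT x|lborel. w x)"
  have Gi: "integrable lborel (G n)" for n using integrable_Cc[OF Gc G(3)] .
  have hatW: "cmod (fourier_transform (G n) \<xi>) \<le> W" for n \<xi>
  proof -
    have "(LINT x|lborel. cmod (G n x)) \<le> W"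
      unfolding W_def using Gi wint Gw by (intro integral_mono) auto
    then show ?thesis using norm_fourier_transform_le order_trans by blast
  qed
  have hatlim: "(\<lambda>n. fourier_transform (G n) \<xi>) \<longlonglongrightarrow> fourier_transform f \<xi>" for \<xi>
    unfolding fourier_transform_cis
  proof (rule integral_dominated_convergence[where w = w])
    show "AE x in lborel. (\<lambda>n. cis (- (2 * pi * (x \<bullet> \<xi>))) * G n x) \<longlonglongrightarrow> cis (- (2 * pi * (x \<bullet> \<xi>))) * f x"
      by (intro AE_I2 tendsto_intros Glim)
    show "AE x in lborel. norm (cis (- (2 * pi * (x \<bullet> \<xi>))) * G n x) \<le> w x" for n
      using Gw by (simp add: norm_mult)
  qed (use wint in measurable)
  have L2: "(\<lambda>n. Lp_norm torus_measure q (fourier_transform (G n))) \<longlonglongrightarrow> Lp_norm torus_measure q (fourier_transform f)"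
  proof (rule Lp_norm_tendsto[OF _ _ _ hatlim])
    show "integrable torus_measure (\<lambda>\<xi>::real^2^'n. W powr q)" by simp
    show "cmod (fourier_transform (G n) \<xi>) powr q \<le> W powr q" for n \<xi>
      using hatW q by (intro powr_mono2) auto
  qed (use q in \<open>auto intro!: measurable_torus_measure\<close>)
  show ?thesis
    by (rule LIMSEQ_le[OF L2 tendsto_mult[OF tendsto_const L1]]) (use est G(1) in auto)
qed

text \<open>For the tensor power of \<open>f\<close> both norms become \<open>n\<close>-th powers of
  the norms of \<open>f\<close>, so taking the \<open>n\<close>-th root keeps the exponents and
  changes only the constant.\<close>

lemma circle_estimate:
  fixes f :: "real^2 \<Rightarrow> complex"
  assumes p: "1 \<le> p" and q: "1 \<le> q" and C: "0 < C"
    and est: "\<And>g. g \<in> (test_functions :: ((real^2^'n::finite) \<Rightarrow> complex) set) \<Longrightarrow> Lp_norm torus_measure q (fourier_transform g) \<le> C * Lp_norm lborel p g"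
    and f: "continuous_on UNIV f" and supp: "\<And>x. R \<le> norm x \<Longrightarrow> f x = 0"
  shows "Lp_norm circle_measure q (fourier_transform f) \<le> C powr (1 / CARD('n)) * Lp_norm lborel p f"
proof -
  interpret P: product_sigma_finite "\<lambda>_::'n. lborel :: (real^2) measure" by standard
  interpret C: prob_space circle_measure by (rule prob_space_circle)
  interpret CP: product_sigma_finite "\<lambda>_::'n. circle_measure" by standard
  define n where "n = CARD('n)"
  have n: "0 < n" by (simp add: n_def)
  define F where "F x = (\<Prod>i\<in>UNIV. f (x $ i))" for x :: "real^2^'n"
  have fi: "integrable lborel f" and fp: "integrable lborel (\<lambda>x. cmod (f x) powr p)"
    using integrable_Cc[OF f supp] integrable_Cc_powr[OF f supp] p by auto
  have [measurable]: "f \<in> borel_measurable borel" using fi by simp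
  have Fc: "continuous_on UNIV F"
    unfolding F_def by (intro continuous_on_prod continuous_on_compose2[OF f]) (auto intro!: continuous_intros)
  then have [measurable]: "F \<in> borel_measurable borel" by (rule borel_measurable_continuous_onI)
  have fn [measurable]: "(\<lambda>x::real^2^'n. f (x $ i)) \<in> borel_measurable borel" for i
    by (intro borel_measurable_continuous_onI continuous_on_compose2[OF f]) (auto intro!: continuous_intros)
  \<comment> \<open>The norm is at most the sum of the \<open>n\<close> block norms, each of which
    is at most \<open>\<bar>R\<bar>\<close> where \<open>F\<close> does not vanish; the summand 1
    makes the contradiction strict.\<close>
  have Fs: "F x = 0" if "real n * \<bar>R\<bar> + 1 \<le> norm x" for x
  proof (rule ccontr)
    assume "F x \<noteq> 0"
    then have "norm (x $ i) \<le> \<bar>R\<bar>" for i using supp[of "x $ i"] by (force simp: F_def)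
    then have "(\<Sum>i\<in>UNIV. norm (x $ i)) \<le> (\<Sum>i\<in>(UNIV::'n set). \<bar>R\<bar>)"
      by (intro sum_mono)
    moreover have "norm x \<le> (\<Sum>i\<in>UNIV. norm (x $ i))"
      unfolding norm_vec_def by (rule L2_set_le_sum) simp
    ultimately have "norm x \<le> (\<Sum>i\<in>(UNIV::'n set). \<bar>R\<bar>)" by linarith
    then show False using that by (simp add: n_def)
  qed
  have hat: "fourier_transform F (vec_lambda y) = (\<Prod>i\<in>UNIV. fourier_transform f (y i))" for y
  proof -
    have "fourier_transform F (vec_lambda y) = (LINT x|PiM UNIV (\<lambda>_. lborel). (\<Prod>i\<in>UNIV. cis (- (2 * pi * (x i \<bullet> y i))) * f (x i)))"
      by (subst fourier_transform_vec) (simp_all add: F_def prod.distrib)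
    also have "\<dots> = (\<Prod>i\<in>UNIV. LINT x|lborel. cis (- (2 * pi * (x \<bullet> y i))) * f x)"
      using integrable_mult_cis[OF fi] by (intro P.product_integral_prod) (auto simp: mult.commute)
    finally show ?thesis by (simp add: fourier_transform_cis)
  qed
  have 1: "Lp_norm lborel p F = Lp_norm lborel p f ^ n"
  proof -
    have "(LINT x|lborel. cmod (F x) powr p) = (LINT x|PiM UNIV (\<lambda>_. lborel). (\<Prod>i\<in>(UNIV::'n set). cmod (f (x i)) powr p))"
      by (subst integral_vec) (simp_all add: F_def prod_norm[symmetric] prod_powr_distrib)
    also have "\<dots> = (LINT x|lborel. cmod (f x) powr p) ^ n"
      using fp by (subst P.product_integral_prod) (auto simp: n_def)
    finally show ?thesis by (simp add: Lp_norm_def power_powr_commute)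
  qed
  have fhb: "cmod (fourier_transform f \<xi>) powr q \<le> (LINT x|lborel. cmod (f x)) powr q" for \<xi>
    using q norm_fourier_transform_le by (intro powr_mono2) auto
  have mc: "g \<in> borel_measurable circle_measure" if "g \<in> borel_measurable borel" for g :: "real^2 \<Rightarrow> real"
    using that by (simp add: measurable_restrict_space1 cong: measurable_cong_sets)
  have fq: "integrable circle_measure (\<lambda>\<xi>. cmod (fourier_transform f \<xi>) powr q)"
    by (rule C.integrable_const_bound[where B = "(LINT x|lborel. cmod (f x)) powr q"]) (use fhb in \<open>auto intro!: mc\<close>)
  have 2: "Lp_norm torus_measure q (fourier_transform F) = Lp_norm circle_measure q (fourier_transform f) ^ n"
  proof -
    have "(LINT \<xi>|torus_measure. cmod (fourier_transform F \<xi>) powr q) = (LINT y|PiM UNIV (\<lambda>_. circle_measure). cmod (fourier_transform F (vec_lambda y)) powr q)"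
      unfolding torus_measure_def
      by (subst integral_distr[OF measurable_vec_lambda_torus]) (auto simp: measurable_restrict_space1)
    also have "\<dots> = (LINT y|PiM UNIV (\<lambda>_. circle_measure). (\<Prod>i\<in>(UNIV::'n set). cmod (fourier_transform f (y i)) powr q))"
      by (simp add: hat prod_norm[symmetric] prod_powr_distrib)
    also have "\<dots> = (LINT \<xi>|circle_measure. cmod (fourier_transform f \<xi>) powr q) ^ n"
      using fq by (subst CP.product_integral_prod) (auto simp: n_def)
    finally show ?thesis by (simp add: Lp_norm_def power_powr_commute)
  qed
  have "Lp_norm circle_measure q (fourier_transform f) ^ n \<le> (C powr (1 / n) * Lp_norm lborel p f) ^ n"
  proof -
    have "(C powr (1 / n)) ^ n = C" using n C by (simp add: powr_power)
    then show ?thesis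
      using estimate_extends_to_Cc[OF p q C est Fc Fs] unfolding 1 2 by (simp add: power_mult_distrib)
  qed
  moreover obtain k where "n = Suc k" using n by (cases n) auto
  moreover have "0 \<le> C powr (1 / n) * Lp_norm lborel p f" by (simp add: Lp_norm_def)
  ultimately have "Lp_norm circle_measure q (fourier_transform f) \<le> C powr (1 / n) * Lp_norm lborel p f"
    using power_le_imp_le_base by blast
  then show ?thesis by (simp add: n_def)
qed

section \<open>Knapp's example\<close>

text \<open>Only the arc of length \<open>d\<close> is kept. The bound \<open>L\<close> guarantees
  integrability, so that \<open>Lp_norm\<close> is not its default value 0.\<close>

lemma Lp_norm_circle_ge:
  fixes F :: "real^2 \<Rightarrow> complex"
  assumes [measurable]: "F \<in> borel_measurable borel" and bd: "\<And>\<xi>. cmod (F \<xi>) \<le> L" and q: "1 \<le> q"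
    and d: "0 < d" "d \<le> 1" and A: "0 \<le> A" and lower: "\<And>t. 0 \<le> t \<Longrightarrow> t < d \<Longrightarrow> A \<le> cmod (F (circ t))"
  shows "A * d powr (1 / q) \<le> Lp_norm circle_measure q F"
proof -
  interpret prob_space circle_measure by (rule prob_space_circle)
  have mc: "(\<lambda>\<xi>. cmod (F \<xi>) powr q) \<in> borel_measurable circle_measure"
    by (simp add: measurable_restrict_space1 cong: measurable_cong_sets)
  have int: "integrable circle_measure (\<lambda>\<xi>. cmod (F \<xi>) powr q)"
    by (rule integrable_const_bound[OF _ mc, where B = "L powr q"]) (use bd q in \<open>auto intro!: powr_mono2\<close>)
  have "ennreal (A powr q * d) = (\<integral>\<^sup>+t. ennreal (A powr q) * indicator {0..<d} t \<partial>lborel)"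
    using d by (subst nn_integral_cmult_indicator) (auto simp: ennreal_mult)
  also have "\<dots> \<le> (\<integral>\<^sup>+t. ennreal (cmod (F (circ t)) powr q) * indicator {0..<1} t \<partial>lborel)"
    using d q A lower by (intro nn_integral_mono) (auto simp: indicator_def intro!: ennreal_leI powr_mono2)
  also have "\<dots> = (\<integral>\<^sup>+\<xi>. ennreal (cmod (F \<xi>) powr q) \<partial>circle_measure)"
    by (rule nn_integral_circle[symmetric]) measurable
  also have "\<dots> = ennreal (LINT \<xi>|circle_measure. cmod (F \<xi>) powr q)"
    by (rule nn_integral_eq_integral[OF int]) simp
  finally have "A powr q * d \<le> (LINT \<xi>|circle_measure. cmod (F \<xi>) powr q)"
    by (subst (asm) ennreal_le_iff) (auto intro!: Bochner_Integration.integral_nonneg)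
  then have "(A powr q * d) powr (1 / q) \<le> Lp_norm circle_measure q F"
    unfolding Lp_norm_def using q d by (intro powr_mono2) auto
  then show ?thesis using A d q by (simp add: powr_mult powr_powr)
qed

lemma emeasure_rectangle:
  assumes "0 \<le> a" "0 \<le> b"
  shows "emeasure lborel {x::real^2. \<bar>x $ 1\<bar> \<le> a \<and> \<bar>x $ 2\<bar> \<le> b} = ennreal (4 * a * b)"
proof -
  let ?R = "{x::real^2. \<bar>x $ 1\<bar> \<le> a \<and> \<bar>x $ 2\<bar> \<le> b}"
  have [measurable]: "?R \<in> sets borel" by measurable
  have "emeasure lborel ?R = (\<integral>\<^sup>+x. indicator ?R x \<partial>lborel)" by simp
  also have "\<dots> = (\<integral>\<^sup>+s. \<integral>\<^sup>+t. indicator ?R (pt (s, t)) \<partial>lborel \<partial>lborel)"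
    by (rule nn_integral_real2) measurable
  also have "\<dots> = (\<integral>\<^sup>+s. \<integral>\<^sup>+t. indicator {-a..a} s * indicator {-b..b} t \<partial>lborel \<partial>lborel)"
    by (intro nn_integral_cong) (auto simp: indicator_def abs_le_iff)
  also have "\<dots> = (\<integral>\<^sup>+s. indicator {-a..a} s * ennreal (2 * b) \<partial>lborel)"
    using assms by (intro nn_integral_cong) (simp add: nn_integral_cmult)
  also have "\<dots> = ennreal (2 * a) * ennreal (2 * b)"
    using assms by (simp add: nn_integral_multc)
  finally show ?thesis using assms by (simp add: ennreal_mult[symmetric])
qed

text \<open>Chosen so that the phase in the lemma \<open>knapp_phase\<close> below stays within \<open>[-1, 1]\<close>.\<close>
definition knapp_scale :: real where "knapp_scale = 1 / (4 * pi\<^sup>2 * (pi + 1))"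

lemma knapp_scale_pos: "0 < knapp_scale"
  by (simp add: knapp_scale_def add_pos_pos)

lemma one_minus_cos_le: "1 - cos x \<le> x\<^sup>2 / 2" for x :: real
proof -
  have "1 - cos x = 2 * (sin (x / 2))\<^sup>2" using cos_double_sin[of "x / 2"] by simp
  also have "(sin (x / 2))\<^sup>2 \<le> (x / 2)\<^sup>2"
    using abs_sin_x_le_abs_x[of "x / 2"] by (simp only: abs_le_square_iff)
  finally show ?thesis by (simp add: power_divide)
qed

text \<open>For \<open>0 \<le> t < d\<close> the point \<open>circ t\<close> differs from
  \<open>circ 0\<close> by order \<open>d\<^sup>2\<close> in the first and by order \<open>d\<close>
  in the second coordinate. On the rectangle with the reciprocal sides the phase stays within 1,
  which is below \<open>pi / 3\<close>.\<close>

lemma knapp_phase: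
  fixes d t :: real and x :: "real^2"
  assumes d: "0 < d" "d \<le> 1" and t: "0 \<le> t" "t < d"
    and x: "\<bar>x $ 1\<bar> \<le> knapp_scale / d\<^sup>2" "\<bar>x $ 2\<bar> \<le> knapp_scale / d"
  shows "1 / 2 \<le> cos (2 * pi * (x $ 1) - 2 * pi * (x \<bullet> circ t))"
proof -
  let ?b = knapp_scale
  have b: "0 < ?b" by (rule knapp_scale_pos)
  have "1 - cos (2 * pi * t) \<le> 2 * pi\<^sup>2 * t\<^sup>2" using one_minus_cos_le[of "2 * pi * t"] by (simp add: power_mult_distrib)
  also have "\<dots> \<le> 2 * pi\<^sup>2 * d\<^sup>2" using t by (intro mult_left_mono power_mono) auto
  finally have "\<bar>1 - cos (2 * pi * t)\<bar> \<le> 2 * pi\<^sup>2 * d\<^sup>2" by simp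
  then have 1: "\<bar>x $ 1\<bar> * \<bar>1 - cos (2 * pi * t)\<bar> \<le> ?b / d\<^sup>2 * (2 * pi\<^sup>2 * d\<^sup>2)"
    using x b d by (intro mult_mono) auto
  have "\<bar>sin (2 * pi * t)\<bar> \<le> \<bar>2 * pi * t\<bar>" by (rule abs_sin_x_le_abs_x)
  also have "\<dots> \<le> 2 * pi * d" using t by (simp add: abs_mult)
  finally have 2: "\<bar>x $ 2\<bar> * \<bar>sin (2 * pi * t)\<bar> \<le> ?b / d * (2 * pi * d)"
    using x b d by (intro mult_mono) auto
  have "x $ 1 - x \<bullet> circ t = x $ 1 * (1 - cos (2 * pi * t)) - x $ 2 * sin (2 * pi * t)"
    by (simp add: inner_real2 algebra_simps)
  then have "\<bar>x $ 1 - x \<bullet> circ t\<bar> \<le> \<bar>x $ 1\<bar> * \<bar>1 - cos (2 * pi * t)\<bar> + \<bar>x $ 2\<bar> * \<bar>sin (2 * pi * t)\<bar>"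
    unfolding abs_mult[symmetric] by linarith
  also have "\<dots> \<le> ?b * (2 * pi\<^sup>2) + ?b * (2 * pi)" using 1 2 d by simp
  also have "\<dots> = 1 / (2 * pi)"
  proof -
    have "?b * (2 * pi\<^sup>2) + ?b * (2 * pi) = (2 * pi * (pi + 1)) / (4 * pi\<^sup>2 * (pi + 1))"
      by (simp add: knapp_scale_def power2_eq_square algebra_simps add_divide_distrib[symmetric])
    also have "\<dots> = (2 * pi) / (4 * pi\<^sup>2)"
      using pi_gt_zero by (intro mult_divide_mult_cancel_right) linarith
    also have "\<dots> = 1 / (2 * pi)" by (simp add: power2_eq_square)
    finally show ?thesis .
  qed
  finally have "2 * pi * \<bar>x $ 1 - x \<bullet> circ t\<bar> \<le> 1" by (simp add: field_simps)
  then have a: "\<bar>2 * pi * (x $ 1) - 2 * pi * (x \<bullet> circ t)\<bar> \<le> 1"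
    unfolding right_diff_distrib[symmetric] by (simp add: abs_mult)
  have "cos (pi / 3) \<le> cos \<bar>2 * pi * (x $ 1) - 2 * pi * (x \<bullet> circ t)\<bar>"
    using a pi_gt3 by (intro cos_monotone_0_pi_le) auto
  then show ?thesis by (simp add: cos_60)
qed

text \<open>The phases nearly agree for all \<open>x\<close> in the rectangle, so on an arc of
  length \<open>d\<close> the transform has the size of the area, \<open>d powr (-3)\<close>. The
  estimate then compares \<open>d powr (-3 + 1 / q)\<close> with \<open>d powr (-3 / p)\<close> as
  \<open>d\<close> tends to 0.\<close>

lemma knapp_necessary:
  fixes p q D :: real
  assumes p: "1 \<le> p" and q: "1 \<le> q"
    and est: "\<And>f R. continuous_on UNIV f \<Longrightarrow> (\<And>x. R \<le> norm x \<Longrightarrow> f x = 0) \<Longrightarrow>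
      Lp_norm circle_measure q (fourier_transform f) \<le> D * Lp_norm lborel p f"
  shows "3 - 1 / q \<le> 3 / p"
proof -
  let ?b = knapp_scale
  have b: "0 < ?b" by (rule knapp_scale_pos)
  have main: "?b\<^sup>2 / 8 * (d powr (-3) * d powr (1 / q)) \<le> D * ((4 * ?b\<^sup>2) powr (1 / p) * d powr (-3 / p))" if d: "0 < d" "d \<le> 1" for d
  proof -
    \<comment> \<open>A product of two tents; continuity is enough, and the modulation in
      \<open>f\<close> moves the peak of the transform to \<open>circ 0\<close>.\<close>
    define k where "k x = max 0 (1 - \<bar>x $ 1\<bar> * d\<^sup>2 / ?b) * max 0 (1 - \<bar>x $ 2\<bar> * d / ?b)" for x :: "real^2"
    define f where "f x = k x *\<^sub>R cis (2 * pi * (x $ 1))" for x :: "real^2"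
    have d3: "d powr (-3) = 1 / d ^ 3" using d by (simp add: powr_minus_divide)
    have k01: "0 \<le> k x" "k x \<le> 1" for x
      using b d by (auto simp: k_def intro!: mult_le_one)
    let ?Q = "{x::real^2. \<bar>x $ 1\<bar> \<le> ?b / d\<^sup>2 \<and> \<bar>x $ 2\<bar> \<le> ?b / d}"
    have kQ: "x \<in> ?Q" if "k x \<noteq> 0" for x
      using that b d by (auto simp: k_def max_def field_simps split: if_splits)
    have kc: "continuous_on UNIV k" unfolding k_def by (intro continuous_intros) (use b in auto)
    have fc: "continuous_on UNIV f"
      unfolding f_def by (intro continuous_on_scaleR kc continuous_on_cis) (intro continuous_intros)
    have fs: "f x = 0" if "?b / d\<^sup>2 + ?b / d + 1 \<le> norm x" for x
    proof (rule ccontr)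
      assume "f x \<noteq> 0"
      then have "x \<in> ?Q" using kQ by (auto simp: f_def)
      moreover have "norm x \<le> \<bar>x $ 1\<bar> + \<bar>x $ 2\<bar>"
        using L2_set_le_sum[of UNIV "\<lambda>i. norm (x $ i)"] by (simp add: norm_vec_def UNIV_2)
      ultimately show False using that by auto
    qed
    have [measurable]: "k \<in> borel_measurable borel" "f \<in> borel_measurable borel"
      using kc fc by (auto intro: borel_measurable_continuous_onI)
    have Q: "emeasure lborel ?Q = ennreal (4 * ?b\<^sup>2 * d powr (-3))" "?Q \<in> sets borel"
    proof -
      have "4 * (?b / d\<^sup>2) * (?b / d) = 4 * ?b\<^sup>2 * d powr (-3)"
        unfolding d3 by (simp add: power2_eq_square power3_eq_cube)
      then show "emeasure lborel ?Q = ennreal (4 * ?b\<^sup>2 * d powr (-3))"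
        using emeasure_rectangle[of "?b / d\<^sup>2" "?b / d"] b d by simp
      show "?Q \<in> sets borel" by measurable
    qed
    have ki: "integrable lborel k"
    proof (rule Bochner_Integration.integrable_bound)
      show "integrable lborel (indicator ?Q :: _ \<Rightarrow> real)"
        using Q by (intro integrable_real_indicator) auto
      have "norm (k x) \<le> norm (indicator ?Q x :: real)" for x
        using k01[of x] kQ[of x] by (cases "k x = 0") auto
      then show "AE x in lborel. norm (k x) \<le> norm (indicator ?Q x :: real)" by blast
    qed measurable
    have fi: "integrable lborel f" by (rule integrable_Cc[OF fc fs])
    have kint: "?b\<^sup>2 / 4 * d powr (-3) \<le> (LINT x|lborel. k x)"
    proof -
      \<comment> \<open>On the rectangle of half the side lengths each tent is at least
        \<open>1 / 2\<close>, so \<open>k\<close> is at least \<open>1 / 4\<close>.\<close>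
      let ?H = "{x::real^2. \<bar>x $ 1\<bar> \<le> ?b / d\<^sup>2 / 2 \<and> \<bar>x $ 2\<bar> \<le> ?b / d / 2}"
      have H: "emeasure lborel ?H = ennreal (?b\<^sup>2 * d powr (-3))" "?H \<in> sets borel"
      proof -
        have "4 * (?b / d\<^sup>2 / 2) * (?b / d / 2) = ?b\<^sup>2 * d powr (-3)"
          unfolding d3 by (simp add: power2_eq_square power3_eq_cube)
        then show "emeasure lborel ?H = ennreal (?b\<^sup>2 * d powr (-3))"
          using emeasure_rectangle[of "?b / d\<^sup>2 / 2" "?b / d / 2"] b d by simp
        show "?H \<in> sets borel" by measurable
      qed
      have "(LINT x|lborel. 1 / 4 * indicator ?H x :: real) \<le> (LINT x|lborel. k x)"
      proof (rule integral_mono[OF _ ki])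
        show "integrable lborel (\<lambda>x. 1 / 4 * indicator ?H x :: real)"
          using H by (intro integrable_mult_right integrable_real_indicator) auto
        show "1 / 4 * indicator ?H x \<le> k x" for x
        proof (cases "x \<in> ?H")
          case True
          then have "1 / 2 \<le> 1 - \<bar>x $ 1\<bar> * d\<^sup>2 / ?b" "1 / 2 \<le> 1 - \<bar>x $ 2\<bar> * d / ?b"
            using b d by (auto simp: field_simps)
          then have "1 / 2 \<le> max 0 (1 - \<bar>x $ 1\<bar> * d\<^sup>2 / ?b)" "1 / 2 \<le> max 0 (1 - \<bar>x $ 2\<bar> * d / ?b)"
            by (blast intro: max.coboundedI2)+
          then have "1 / 2 * (1 / 2) \<le> max 0 (1 - \<bar>x $ 1\<bar> * d\<^sup>2 / ?b) * max 0 (1 - \<bar>x $ 2\<bar> * d / ?b)"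
            by (rule mult_mono) auto
          then show ?thesis using True by (simp add: k_def)
        qed (use k01 in simp)
      qed
      moreover have "(LINT x|lborel. 1 / 4 * indicator ?H x :: real) = 1 / 4 * (?b\<^sup>2 * d powr (-3))"
        using H b by (simp add: measure_def)
      ultimately show ?thesis by simp
    qed
    have lower: "?b\<^sup>2 / 8 * d powr (-3) \<le> cmod (fourier_transform f (circ t))" if t: "0 \<le> t" "t < d" for t
    proof -
      have ii: "integrable lborel (\<lambda>x. cis (- (2 * pi * (x \<bullet> circ t))) * f x)"
        using integrable_mult_cis[OF fi, of "\<lambda>x. - (2 * pi * (x \<bullet> circ t))"] by (simp add: mult.commute)
      have "(LINT x|lborel. 1 / 2 * k x) \<le> (LINT x|lborel. Re (cis (- (2 * pi * (x \<bullet> circ t))) * f x))"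
      proof (rule integral_mono)
        show "1 / 2 * k x \<le> Re (cis (- (2 * pi * (x \<bullet> circ t))) * f x)" for x
        proof -
          have "cis (- (2 * pi * (x \<bullet> circ t))) * f x = k x *\<^sub>R cis (2 * pi * (x $ 1) - 2 * pi * (x \<bullet> circ t))"
            by (simp add: f_def cis_mult)
          then have "Re (cis (- (2 * pi * (x \<bullet> circ t))) * f x) = k x * cos (2 * pi * (x $ 1) - 2 * pi * (x \<bullet> circ t))"
            by simp
          moreover have "k x * (1 / 2) \<le> k x * cos (2 * pi * (x $ 1) - 2 * pi * (x \<bullet> circ t))"
          proof (cases "k x = 0")
            case False
            then show ?thesis using kQ[OF False] k01 by (intro mult_left_mono knapp_phase[OF d t]) auto
          qed simp
          ultimately show ?thesis by simp
        qed
      next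
        show "integrable lborel (\<lambda>x. Re (cis (- (2 * pi * (x \<bullet> circ t))) * f x))"
          using ii by (rule integrable_Re)
      qed (use ki in simp)
      also have "\<dots> = Re (fourier_transform f (circ t))"
        unfolding fourier_transform_cis by (rule integral_Re[OF ii])
      also have "\<dots> \<le> cmod (fourier_transform f (circ t))" by (rule complex_Re_le_cmod)
      finally show ?thesis using kint by simp
    qed
    have "?b\<^sup>2 / 8 * d powr (-3) * d powr (1 / q) \<le> Lp_norm circle_measure q (fourier_transform f)"
      by (rule Lp_norm_circle_ge[where L = "LINT x|lborel. cmod (f x)"])
         (use q d lower norm_fourier_transform_le in auto)
    also have "\<dots> \<le> D * Lp_norm lborel p f" by (rule est[OF fc fs])
    finally have *: "?b\<^sup>2 / 8 * d powr (-3) * d powr (1 / q) \<le> D * Lp_norm lborel p f" .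
    have fp: "Lp_norm lborel p f \<le> (4 * ?b\<^sup>2 * d powr (-3)) powr (1 / p)"
    proof -
      have "(LINT x|lborel. cmod (f x) powr p) \<le> (LINT x|lborel. indicator ?Q x :: real)"
      proof (rule integral_mono)
        show "integrable lborel (\<lambda>x. cmod (f x) powr p)" using integrable_Cc_powr[OF fc fs] p by auto
        show "integrable lborel (indicator ?Q :: _ \<Rightarrow> real)" using Q by (intro integrable_real_indicator) auto
        show "cmod (f x) powr p \<le> indicator ?Q x" for x
          using k01[of x] kQ[of x] p powr_mono2[of p "k x" 1] by (cases "k x = 0") (auto simp: f_def indicator_def)
      qed
      also have "\<dots> = 4 * ?b\<^sup>2 * d powr (-3)" using Q b by (simp add: measure_def)
      finally show ?thesis unfolding Lp_norm_def using p
        by (intro powr_mono2) (auto intro!: Bochner_Integration.integral_nonneg)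
    qed
    \<comment> \<open>Replacing the norm of \<open>f\<close> by its upper bound needs
      \<open>D \<ge> 0\<close>; a negative \<open>D\<close> would contradict the positive lower
      bound in \<open>*\<close>.\<close>
    have D0: "0 \<le> D"
    proof (rule ccontr)
      assume "\<not> 0 \<le> D"
      then have "D * Lp_norm lborel p f \<le> 0" by (simp add: mult_le_0_iff Lp_norm_def)
      moreover have "0 < ?b\<^sup>2 / 8 * d powr (-3) * d powr (1 / q)" using b d by simp
      ultimately show False using * by linarith
    qed
    have "D * Lp_norm lborel p f \<le> D * (4 * ?b\<^sup>2 * d powr (-3)) powr (1 / p)"
      using fp D0 by (rule mult_left_mono)
    also have "(4 * ?b\<^sup>2 * d powr (-3)) powr (1 / p) = (4 * ?b\<^sup>2) powr (1 / p) * d powr (-3 / p)"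
      using b d by (simp add: powr_mult powr_powr)
    finally show ?thesis using * by (simp add: mult.assoc)
  qed
  define \<eta> where "\<eta> = 3 - 1 / q - 3 / p"
  show ?thesis
  proof (rule ccontr)
    assume "\<not> ?thesis"
    then have \<eta>: "0 < \<eta>" by (simp add: \<eta>_def)
    define K where "K = D * (4 * ?b\<^sup>2) powr (1 / p) / (?b\<^sup>2 / 8)"
    have bd: "d powr (- \<eta>) \<le> K" if d: "0 < d" "d \<le> 1" for d
    proof -
      have "?b\<^sup>2 / 8 * (d powr (-3) * d powr (1 / q)) * d powr (3 / p) \<le> D * ((4 * ?b\<^sup>2) powr (1 / p) * d powr (-3 / p)) * d powr (3 / p)"
        using main[OF d] by (intro mult_right_mono) auto
      then have "?b\<^sup>2 / 8 * (d powr (-3) * d powr (1 / q) * d powr (3 / p)) \<le> D * (4 * ?b\<^sup>2) powr (1 / p) * (d powr (-3 / p) * d powr (3 / p))"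
        by (simp only: mult.assoc)
      also have "d powr (-3 / p) * d powr (3 / p) = 1"
        using d unfolding powr_add[symmetric] by (simp add: add_divide_distrib[symmetric])
      also have "d powr (-3) * d powr (1 / q) * d powr (3 / p) = d powr (- \<eta>)"
        unfolding powr_add[symmetric] by (simp add: \<eta>_def algebra_simps)
      finally have "?b\<^sup>2 / 8 * d powr (- \<eta>) \<le> D * (4 * ?b\<^sup>2) powr (1 / p)" by simp
      then show ?thesis using b unfolding K_def by (simp add: field_simps)
    qed
    \<comment> \<open>Solves \<open>d powr (- \<eta>) = max 1 K + 1\<close>, which exceeds
      \<open>K\<close>; the maximum with 1 ensures \<open>d \<le> 1\<close>.\<close>
    define d where "d = (max 1 K + 1) powr (- 1 / \<eta>)"
    have "0 < d" by (simp add: d_def)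
    moreover have "d \<le> 1"
      using \<eta> powr_mono[of "- 1 / \<eta>" 0 "max 1 K + 1"] by (simp add: d_def)
    ultimately have "d powr (- \<eta>) \<le> K" by (rule bd)
    moreover have "d powr (- \<eta>) = max 1 K + 1" using \<eta> by (simp add: d_def powr_powr)
    ultimately show False by simp
  qed
qed

section \<open>Failure for exponents from 4/3 on\<close>

definition circle_hat :: "real^2 \<Rightarrow> complex" where
  "circle_hat x = (LINT t|unit_interval_measure. cis (- (2 * pi * (x \<bullet> circ t))))"

lemma sigma_finite_unit_interval: "sigma_finite_measure unit_interval_measure"
  using prob_space_unit_interval by (simp add: prob_space_imp_sigma_finite)

lemma measurable_circ_unit [measurable]: "circ \<in> borel_measurable unit_interval_measure"
  by (simp add: measurable_restrict_space1)

lemma circle_hat_le_1: "cmod (circle_hat x) \<le> 1"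
proof -
  interpret prob_space unit_interval_measure by (rule prob_space_unit_interval)
  have "cmod (circle_hat x) \<le> (LINT t|unit_interval_measure. cmod (cis (- (2 * pi * (x \<bullet> circ t)))))"
    unfolding circle_hat_def by (rule integral_norm_bound)
  then show ?thesis using prob_space by simp
qed

lemma continuous_circle_hat: "continuous_on UNIV circle_hat"
proof (rule continuous_at_imp_continuous_on, rule ballI)
  interpret prob_space unit_interval_measure by (rule prob_space_unit_interval)
  fix x :: "real^2"
  show "isCont circle_hat x"
    unfolding continuous_at_sequentially
  proof (intro allI impI)
    fix u assume u: "u \<longlonglongrightarrow> x"
    show "(circle_hat \<circ> u) \<longlonglongrightarrow> circle_hat x"
      unfolding circle_hat_def o_def
    proof (rule integral_dominated_convergence[where w = "\<lambda>_. 1"])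
      show "AE t in unit_interval_measure. (\<lambda>n. cis (- (2 * pi * (u n \<bullet> circ t)))) \<longlonglongrightarrow> cis (- (2 * pi * (x \<bullet> circ t)))"
        by (intro AE_I2 tendsto_intros u)
    qed auto
  qed
qed

lemma integral_fourier_transform_circ:
  assumes f: "integrable lborel f"
  shows "(LINT t|unit_interval_measure. fourier_transform f (circ t)) = (LINT x|lborel. f x * circle_hat x)"
proof -
  interpret U: prob_space unit_interval_measure by (rule prob_space_unit_interval)
  interpret pair_sigma_finite unit_interval_measure "lborel :: (real^2) measure"
    by (simp add: pair_sigma_finite_def sigma_finite_unit_interval sigma_finite_lborel)
  have [measurable]: "f \<in> borel_measurable borel" using f by simp
  have "integrable unit_interval_measure (\<lambda>_. 1 :: complex)" by simp
  from integrable_mult_fst_snd[OF this f]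
  have "integrable (unit_interval_measure \<Otimes>\<^sub>M lborel) (\<lambda>(t, x). cis (- (2 * pi * (x \<bullet> circ t))) * f x)"
    by (rule Bochner_Integration.integrable_bound) (auto simp: norm_mult)
  from Fubini_integral[OF this, symmetric]
  have "(LINT t|unit_interval_measure. fourier_transform f (circ t)) = (LINT x|lborel. (LINT t|unit_interval_measure. cis (- (2 * pi * (x \<bullet> circ t))) * f x))"
    by (simp add: fourier_transform_cis)
  also have "\<dots> = (LINT x|lborel. circle_hat x * f x)" by (simp add: circle_hat_def)
  also have "\<dots> = (LINT x|lborel. f x * circle_hat x)" by (simp only: mult.commute)
  finally show ?thesis .
qed

text \<open>The mean over a probability space is bounded by the norm of every exponent
  \<open>q \<ge> 1\<close>. The bound \<open>L\<close> keeps \<open>Lp_norm\<close> from being the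
  default value 0.\<close>

lemma norm_integral_le_Lp_norm_circle:
  fixes F :: "real^2 \<Rightarrow> complex"
  assumes [measurable]: "F \<in> borel_measurable borel" and bd: "\<And>\<xi>. cmod (F \<xi>) \<le> L" and q: "1 \<le> q"
  shows "cmod (LINT t|unit_interval_measure. F (circ t)) \<le> Lp_norm circle_measure q F"
proof -
  interpret prob_space unit_interval_measure by (rule prob_space_unit_interval)
  interpret C: prob_space circle_measure by (rule prob_space_circle)
  have mc: "F \<in> borel_measurable circle_measure"
    by (simp add: measurable_restrict_space1 cong: measurable_cong_sets)
  have mU [measurable]: "(\<lambda>t. F (circ t)) \<in> borel_measurable unit_interval_measure" by measurable
  have intq: "integrable circle_measure (\<lambda>\<xi>. cmod (F \<xi>) powr q)"
    by (rule C.integrable_const_bound[where B = "L powr q"]) (use bd q mc in \<open>auto intro!: powr_mono2\<close>)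
  have int: "integrable unit_interval_measure (\<lambda>t. F (circ t))"
    by (rule integrable_const_bound[where B = L]) (use bd in auto)
  have "ennreal (cmod (LINT t|unit_interval_measure. F (circ t))) \<le> (\<integral>\<^sup>+t. ennreal (cmod (F (circ t))) \<partial>unit_interval_measure)"
    by (rule integral_norm_bound_ennreal[OF int])
  also have "\<dots> = (\<integral>\<^sup>+\<xi>. ennreal (cmod (F \<xi>) powr 1) \<partial>circle_measure)"
    by (subst nn_integral_circle) (simp_all add: nn_integral_restrict_space)
  also have "\<dots> \<le> epowr (\<integral>\<^sup>+\<xi>. ennreal (cmod (F \<xi>) powr q) \<partial>circle_measure) (1 / q)"
    by (rule C.nn_integral_powr_mono_exponent) (use q mc in auto)
  also have "(\<integral>\<^sup>+\<xi>. ennreal (cmod (F \<xi>) powr q) \<partial>circle_measure) = ennreal (LINT \<xi>|circle_measure. cmod (F \<xi>) powr q)"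
    by (rule nn_integral_eq_integral[OF intq]) simp
  also have "epowr \<dots> (1 / q) = ennreal (Lp_norm circle_measure q F)"
    by (subst epowr_ennreal) (auto simp: Lp_norm_def intro!: Bochner_Integration.integral_nonneg)
  finally show ?thesis by (subst (asm) ennreal_le_iff) (auto simp: Lp_norm_def)
qed

text \<open>With a cutoff \<open>\<eta> n\<close>, pairing the test function with
  \<open>circle_hat\<close> gives the cut-off integral \<open>Y\<close> of the fourth power, and the
  estimate yields \<open>Y \<le> \<bar>D\<bar> * Y powr (1 / p)\<close>. Since \<open>p > 1\<close>,
  this bounds \<open>Y\<close> uniformly in the cutoff.\<close>

lemma circle_hat_L4_bound:
  fixes p q D :: real
  assumes p: "4 / 3 \<le> p" and q: "1 \<le> q"
    and est: "\<And>f R. continuous_on UNIV f \<Longrightarrow> (\<And>x. R \<le> norm x \<Longrightarrow> f x = 0) \<Longrightarrow>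
      Lp_norm circle_measure q (fourier_transform f) \<le> D * Lp_norm lborel p f"
  shows "integrable lborel (\<lambda>x. cmod (circle_hat x) ^ 4)"
proof -
  let ?G = circle_hat
  define \<eta> where "\<eta> n x = max 0 (min 1 (real n - norm x))" for n and x :: "real^2"
  have \<eta>01: "0 \<le> \<eta> n x" "\<eta> n x \<le> 1" for n x by (auto simp: \<eta>_def)
  have [measurable]: "?G \<in> borel_measurable borel" by (rule borel_measurable_continuous_onI[OF continuous_circle_hat])
  have [measurable]: "\<eta> n \<in> borel_measurable borel" for n unfolding \<eta>_def by measurable
  define s where "s = 1 - 1 / p"
  have s: "0 < s" using p by (simp add: s_def)
  define B where "B = \<bar>D\<bar> powr (1 / s)"
  have Y: "(\<integral>\<^sup>+x. ennreal (\<eta> n x * cmod (?G x) ^ 4) \<partial>lborel) \<le> ennreal B" for n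
  proof -
    define f where "f x = \<eta> n x *\<^sub>R (cnj (?G x) * complex_of_real ((cmod (?G x))\<^sup>2))" for x
    have fc: "continuous_on UNIV f"
      unfolding f_def \<eta>_def by (intro continuous_intros continuous_circle_hat)
    have fs: "f x = 0" if "real n \<le> norm x" for x using that by (simp add: f_def \<eta>_def)
    have fn: "cmod (f x) = \<eta> n x * cmod (?G x) ^ 3" for x
      using \<eta>01 by (simp add: f_def norm_mult power2_eq_square power3_eq_cube)
    have fG: "f x * ?G x = complex_of_real (\<eta> n x * cmod (?G x) ^ 4)" for x
    proof -
      have "f x * ?G x = \<eta> n x *\<^sub>R ((?G x * cnj (?G x)) * complex_of_real ((cmod (?G x))\<^sup>2))"
        by (simp add: f_def)
      also have "\<dots> = complex_of_real (\<eta> n x * ((cmod (?G x))\<^sup>2 * (cmod (?G x))\<^sup>2))"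
        unfolding complex_norm_square[symmetric] by (simp add: scaleR_conv_of_real)
      finally show ?thesis by (simp add: power2_eq_square power4_eq_xxxx mult.assoc)
    qed
    define Y where "Y = (LINT x|lborel. \<eta> n x * cmod (?G x) ^ 4)"
    have Yint: "integrable lborel (\<lambda>x. \<eta> n x * cmod (?G x) ^ 4)"
    proof -
      have "continuous_on UNIV (\<lambda>x. complex_of_real (\<eta> n x * cmod (?G x) ^ 4))"
        unfolding \<eta>_def by (intro continuous_intros continuous_circle_hat)
      then have "integrable lborel (\<lambda>x. complex_of_real (\<eta> n x * cmod (?G x) ^ 4))"
        by (rule integrable_Cc[of _ "real n"]) (simp add: \<eta>_def)
      then show ?thesis by (subst (asm) complex_of_real_integrable_eq)
    qed
    have Y0: "0 \<le> Y" unfolding Y_def using \<eta>01 by (intro Bochner_Integration.integral_nonneg) auto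
    have "complex_of_real Y = (LINT x|lborel. f x * ?G x)"
      unfolding fG Y_def by (simp only: integral_complex_of_real)
    also have "\<dots> = (LINT t|unit_interval_measure. fourier_transform f (circ t))"
      by (rule integral_fourier_transform_circ[symmetric, OF integrable_Cc[OF fc fs]])
    finally have "Y = cmod (LINT t|unit_interval_measure. fourier_transform f (circ t))"
      using Y0 by (metis norm_of_real abs_of_nonneg)
    also have "\<dots> \<le> Lp_norm circle_measure q (fourier_transform f)"
      using borel_measurable_continuous_onI[OF fc] q
      by (intro norm_integral_le_Lp_norm_circle[OF _ norm_fourier_transform_le]) auto
    also have "\<dots> \<le> D * Lp_norm lborel p f" by (rule est[OF fc fs])
    also have "\<dots> \<le> \<bar>D\<bar> * Y powr (1 / p)"
    proof (intro mult_mono)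
      have "(LINT x|lborel. cmod (f x) powr p) \<le> Y"
        unfolding Y_def
      proof (rule integral_mono[OF integrable_Cc_powr[OF fc fs] Yint])
        \<comment> \<open>Here \<open>p \<ge> 4/3\<close> enters: \<open>3 * p \<ge> 4\<close> and
          \<open>circle_hat\<close> is bounded by 1, so the power \<open>3 * p\<close> is at most
          the fourth power.\<close>
        show "cmod (f x) powr p \<le> \<eta> n x * cmod (?G x) ^ 4" for x
        proof (cases "cmod (f x) = 0")
          case True then show ?thesis using \<eta>01 by simp
        next
          case False
          then have pos: "0 < \<eta> n x" "0 < cmod (?G x)" using \<eta>01[where n=n and x=x] by (auto simp: fn less_le)
          have "cmod (f x) powr p = \<eta> n x powr p * cmod (?G x) powr (3 * p)"
            using pos by (simp add: fn powr_mult powr_powr flip: powr_numeral)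
          also have "\<dots> \<le> \<eta> n x powr 1 * cmod (?G x) powr 4"
            using pos \<eta>01[where n=n and x=x] circle_hat_le_1[of x] p by (intro mult_mono powr_mono') auto
          also have "\<dots> = \<eta> n x * cmod (?G x) ^ 4" using pos by simp
          finally show ?thesis .
        qed
      qed (use p in auto)
      then show "Lp_norm lborel p f \<le> Y powr (1 / p)"
        unfolding Lp_norm_def using p by (intro powr_mono2 Bochner_Integration.integral_nonneg) auto
    qed (auto simp: Lp_norm_def)
    finally have YD: "Y \<le> \<bar>D\<bar> * Y powr (1 / p)" .
    have "Y \<le> B"
    proof (cases "Y = 0")
      case False
      then have Yp: "0 < Y" using Y0 by simp
      have "Y * Y powr (- (1 / p)) \<le> \<bar>D\<bar> * Y powr (1 / p) * Y powr (- (1 / p))"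
        using YD by (intro mult_right_mono) auto
      moreover have "Y * Y powr (- (1 / p)) = Y powr s" using Yp powr_add[of Y 1 "- (1 / p)"] by (simp add: s_def)
      moreover have "Y powr (1 / p) * Y powr (- (1 / p)) = 1" using Yp by (simp add: powr_add[symmetric])
      ultimately have "Y powr s \<le> \<bar>D\<bar>" by (simp add: mult.assoc)
      then have "(Y powr s) powr (1 / s) \<le> B" unfolding B_def using s by (intro powr_mono2) auto
      then show ?thesis using Yp s by (simp add: powr_powr)
    qed (simp add: B_def)
    then show ?thesis
      using Yint \<eta>01 by (subst nn_integral_eq_integral) (auto simp: Y_def intro: ennreal_leI)
  qed
  \<comment> \<open>Fatou's lemma; at each point the cutoffs equal 1 from some \<open>n\<close>
    on.\<close>
  have "(\<integral>\<^sup>+x. ennreal (cmod (?G x) ^ 4) \<partial>lborel) \<le> (\<integral>\<^sup>+x. liminf (\<lambda>n. ennreal (\<eta> n x * cmod (?G x) ^ 4)) \<partial>lborel)"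
  proof (rule nn_integral_mono)
    fix x :: "real^2"
    obtain m :: nat where m: "norm x + 1 \<le> real m" using real_arch_simple by blast
    have "\<eta> n x = 1" if "m \<le> n" for n
    proof -
      have "norm x + 1 \<le> real n" using m that by linarith
      then show ?thesis by (simp add: \<eta>_def)
    qed
    then show "ennreal (cmod (?G x) ^ 4) \<le> liminf (\<lambda>n. ennreal (\<eta> n x * cmod (?G x) ^ 4))"
      by (intro Liminf_bounded) (auto simp: eventually_sequentially intro!: exI[of _ m])
  qed
  also have "\<dots> \<le> liminf (\<lambda>n. \<integral>\<^sup>+x. ennreal (\<eta> n x * cmod (?G x) ^ 4) \<partial>lborel)"
    by (rule nn_integral_liminf) measurable
  also have "\<dots> \<le> ennreal B"
    by (rule Liminf_le) (auto intro!: always_eventually Y)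
  finally have "(\<integral>\<^sup>+x. ennreal (cmod (?G x) ^ 4) \<partial>lborel) < \<infinity>"
    using ennreal_less_top le_less_trans by fastforce
  then show ?thesis by (intro integrableI_bounded) auto
qed

section \<open>Lower bound for the weighted square of the transform and failure of L4\<close>

lemma nn_integral_strip:
  fixes c e :: real
  assumes "0 \<le> c" "0 < e"
  shows "(\<integral>\<^sup>+s. (\<integral>\<^sup>+t. ennreal c * indicator {s..<s+e} t \<partial>lborel) * indicator {0..<1/2} s \<partial>lborel) = ennreal (c * (e / 2))"
proof -
  have "(\<integral>\<^sup>+s. (\<integral>\<^sup>+t. ennreal c * indicator {s..<s+e} t \<partial>lborel) * indicator {0..<1/2} s \<partial>lborel) = (\<integral>\<^sup>+s. ennreal (c * e) * indicator {0..<1/2::real} s \<partial>lborel)"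
    using assms by (intro nn_integral_cong) (simp add: nn_integral_cmult_indicator ennreal_mult)
  also have "\<dots> = ennreal (c * e) * ennreal (1/2)"
    by (subst nn_integral_cmult_indicator) auto
  also have "\<dots> = ennreal (c * (e / 2))"
    using assms by (subst ennreal_mult[symmetric]) auto
  finally show ?thesis .
qed

text \<open>The mass is the double integral of the Gaussian kernel over pairs of points of the
  circle. The kernel is at least a multiple of \<open>1 / e\<^sup>2\<close> for parameters less than
  \<open>e\<close> apart, and such pairs fill an area of order \<open>e\<close>.\<close>

lemma circle_hat_gauss_mass:
  fixes e :: real
  assumes e: "0 < e" "e \<le> 1/2"
  shows "integrable lborel (\<lambda>x. gauss e x * (cmod (circle_hat x))\<^sup>2)"
    and "pi * exp (- 8 * pi ^ 4) / e \<le> (LINT x|lborel. gauss e x * (cmod (circle_hat x))\<^sup>2)"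
proof -
  interpret U: prob_space unit_interval_measure by (rule prob_space_unit_interval)
  interpret UU: pair_prob_space unit_interval_measure unit_interval_measure ..
  have one: "integrable unit_interval_measure (\<lambda>_. 1 :: complex)" by simp
  note sq = gauss_weighted_square[OF sigma_finite_unit_interval measurable_circ_unit one e(1)]
  show "integrable lborel (\<lambda>x. gauss e x * (cmod (circle_hat x))\<^sup>2)"
    using sq(1) by (simp add: circle_hat_def)
  define H where "H z = gauss_hat e ((2 * pi) *\<^sub>R (circ (snd z) - circ (fst z)))" for z
  have H0: "0 \<le> H z" for z by (simp add: H_def gauss_hat_nonneg)
  have [measurable]: "H \<in> borel_measurable (unit_interval_measure \<Otimes>\<^sub>M unit_interval_measure)" unfolding H_def by measurable
  have Hb: "H z \<le> 2 * pi / e\<^sup>2" for z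
    unfolding H_def gauss_hat_def using e by (intro mult_left_le) auto
  have Hi: "integrable (unit_interval_measure \<Otimes>\<^sub>M unit_interval_measure) H"
    by (rule UU.P.integrable_const_bound[where B = "2 * pi / e\<^sup>2"]) (use H0 Hb in auto)
  have "complex_of_real (LINT x|lborel. gauss e x * (cmod (circle_hat x))\<^sup>2) = complex_of_real (LINT z|(unit_interval_measure \<Otimes>\<^sub>M unit_interval_measure). H z)"
    using sq(2) by (simp add: circle_hat_def H_def)
  then have eq: "(LINT x|lborel. gauss e x * (cmod (circle_hat x))\<^sup>2) = (LINT z|(unit_interval_measure \<Otimes>\<^sub>M unit_interval_measure). H z)"
    by (simp only: of_real_eq_iff)
  \<comment> \<open>The exponent is
    \<open>(2 * pi)\<^sup>2 * (2 * pi * e)\<^sup>2 / (2 * e\<^sup>2)\<close>: one factor from the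
    frequency scaling, one from the speed of \<open>circ\<close>.\<close>
  let ?c = "2 * pi / e\<^sup>2 * exp (- 8 * pi ^ 4)"
  have Hlow: "?c \<le> H (s, t)" if "s \<le> t" "t < s + e" for s t
  proof -
    have "(circ t - circ s) \<bullet> (circ t - circ s) = 2 * (1 - cos (2 * pi * t - 2 * pi * s))"
      using sin_cos_squared_add[of "2 * pi * t"] sin_cos_squared_add[of "2 * pi * s"]
      by (simp add: inner_real2 cos_diff power2_eq_square algebra_simps)
    also have "\<dots> \<le> (2 * pi * t - 2 * pi * s)\<^sup>2" using one_minus_cos_le[of "2 * pi * t - 2 * pi * s"] by simp
    also have "\<dots> = (2 * pi)\<^sup>2 * (t - s)\<^sup>2" by (simp add: power2_eq_square algebra_simps)
    also have "\<dots> \<le> (2 * pi)\<^sup>2 * e\<^sup>2" using that by (intro mult_left_mono power_mono) auto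
    finally have i: "(circ t - circ s) \<bullet> (circ t - circ s) \<le> (2 * pi)\<^sup>2 * e\<^sup>2" .
    have "(2 * pi)\<^sup>2 * ((circ t - circ s) \<bullet> (circ t - circ s)) / (2 * e\<^sup>2) \<le> (2 * pi)\<^sup>2 * ((2 * pi)\<^sup>2 * e\<^sup>2) / (2 * e\<^sup>2)"
      using i by (intro divide_right_mono mult_left_mono) auto
    also have "\<dots> = 8 * pi ^ 4" using e by (simp add: power2_eq_square power4_eq_xxxx)
    finally have "exp (- 8 * pi ^ 4) \<le> exp (- (((2 * pi) *\<^sub>R (circ t - circ s)) \<bullet> ((2 * pi) *\<^sub>R (circ t - circ s))) / (2 * e\<^sup>2))"
      by (simp add: power2_eq_square mult.assoc)
    then show ?thesis unfolding H_def gauss_hat_def using e by (intro mult_left_mono) auto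
  qed
  \<comment> \<open>Restricting to \<open>s < 1/2\<close> keeps \<open>t < s + e\<close> below 1
    because \<open>e \<le> 1/2\<close>.\<close>
  have "ennreal (?c * (e / 2)) = (\<integral>\<^sup>+s. (\<integral>\<^sup>+t. ennreal ?c * indicator {s..<s+e} t \<partial>lborel) * indicator {0..<1/2} s \<partial>lborel)"
    using e by (intro nn_integral_strip[symmetric]) auto
  also have "\<dots> \<le> (\<integral>\<^sup>+s. (\<integral>\<^sup>+t. ennreal (H (s, t)) * indicator {0..<1} t \<partial>lborel) * indicator {0..<1} s \<partial>lborel)"
  proof (rule nn_integral_mono)
    fix s :: real
    show "(\<integral>\<^sup>+t. ennreal ?c * indicator {s..<s+e} t \<partial>lborel) * indicator {0..<1/2} s \<le> (\<integral>\<^sup>+t. ennreal (H (s, t)) * indicator {0..<1} t \<partial>lborel) * indicator {0..<1} s"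
    proof (cases "s \<in> {0..<1/2}")
      case True
      have "(\<integral>\<^sup>+t. ennreal ?c * indicator {s..<s+e} t \<partial>lborel) \<le> (\<integral>\<^sup>+t. ennreal (H (s, t)) * indicator {0..<1} t \<partial>lborel)"
        using True e Hlow by (intro nn_integral_mono) (auto simp: indicator_def intro!: ennreal_leI)
      then show ?thesis using True by simp
    qed simp
  qed
  also have "\<dots> = (\<integral>\<^sup>+s. \<integral>\<^sup>+t. ennreal (H (s, t)) \<partial>unit_interval_measure \<partial>unit_interval_measure)"
    by (simp add: nn_integral_restrict_space)
  also have "\<dots> = (\<integral>\<^sup>+z. ennreal (H z) \<partial>(unit_interval_measure \<Otimes>\<^sub>M unit_interval_measure))"
    by (rule U.nn_integral_fst) measurable
  also have "\<dots> = ennreal (LINT z|(unit_interval_measure \<Otimes>\<^sub>M unit_interval_measure). H z)"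
    using H0 by (intro nn_integral_eq_integral Hi) auto
  finally have "?c * (e / 2) \<le> (LINT z|(unit_interval_measure \<Otimes>\<^sub>M unit_interval_measure). H z)"
    using H0 by (subst (asm) ennreal_le_iff) (auto intro!: Bochner_Integration.integral_nonneg)
  moreover have "?c * (e / 2) = pi * exp (- 8 * pi ^ 4) / e" using e by (simp add: power2_eq_square)
  ultimately show "pi * exp (- 8 * pi ^ 4) / e \<le> (LINT x|lborel. gauss e x * (cmod (circle_hat x))\<^sup>2)"
    unfolding eq by simp
qed

text \<open>The square is the Gaussian with parameter \<open>sqrt 2 * e\<close>, and its integral is
  its transform at 0.\<close>

lemma integral_gauss_squared:
  assumes e: "0 < e"
  shows "integrable lborel (\<lambda>x. (gauss e x)\<^sup>2)" and "(LINT x|lborel. (gauss e x)\<^sup>2) = pi / e\<^sup>2"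
proof -
  have e': "0 < sqrt 2 * e" using e by simp
  have eq: "(gauss e x)\<^sup>2 = gauss (sqrt 2 * e) x" for x
    by (simp add: gauss_def power_mult_distrib power2_eq_square exp_add[symmetric])
  have i: "integrable lborel (\<lambda>x. complex_of_real (gauss (sqrt 2 * e) x))"
    using integrable_gauss2[OF e', of 0] by simp
  then show "integrable lborel (\<lambda>x. (gauss e x)\<^sup>2)"
    unfolding eq by (simp add: complex_of_real_integrable_eq)
  have "complex_of_real (LINT x|lborel. gauss (sqrt 2 * e) x) = complex_of_real (gauss_hat (sqrt 2 * e) 0)"
    using integral_gauss2[OF e', of 0] by (simp add: integral_complex_of_real)
  then show "(LINT x|lborel. (gauss e x)\<^sup>2) = pi / e\<^sup>2"
    unfolding eq by (simp only: of_real_eq_iff) (simp add: gauss_hat_def power_mult_distrib)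
qed

text \<open>The \<open>L\<^sup>2\<close> mass of \<open>circle_hat\<close> at scale \<open>1 / e\<close> is of order \<open>1 / e\<close>, as for a decay of
  exactly \<open>\<bar>x\<bar> powr (-1/2)\<close>; this is too much for a function in \<open>L\<^sup>4\<close>.\<close>
lemma circle_hat_not_L4: "\<not> integrable lborel (\<lambda>x. cmod (circle_hat x) ^ 4)"
proof
  assume L4: "integrable lborel (\<lambda>x. cmod (circle_hat x) ^ 4)"
  let ?G = circle_hat
  have [measurable]: "?G \<in> borel_measurable borel" by (rule borel_measurable_continuous_onI[OF continuous_circle_hat])
  define c where "c = pi * exp (- 8 * pi ^ 4)"
  have c: "0 < c" by (simp add: c_def)
  \<comment> \<open>Makes the part of the mass not covered by \<open>h n\<close> equal to
    \<open>pi / (2 * K) = c / 2\<close>, half of the lower bound \<open>c\<close>.\<close>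
  define K where "K = pi / c"
  have K: "0 < K" using c by (simp add: K_def)
  define e where "e n = 1 / real (n + 2)" for n :: nat
  have e: "0 < e n" "e n \<le> 1/2" for n by (auto simp: e_def field_simps)
  \<comment> \<open>By the inequality of arithmetic and geometric means the first term is at most
    \<open>K / 2 * cmod (circle_hat x) ^ 4\<close> plus the subtracted square, whose integral does
    not depend on \<open>n\<close>. So \<open>h n\<close> has an integrable majorant under the
    assumption; being at most \<open>e n\<close>, it tends to 0, and so does its integral.\<close>
  define h where "h n x = max 0 (e n * (gauss (e n) x * (cmod (?G x))\<^sup>2) - (e n)\<^sup>2 / (2 * K) * (gauss (e n) x)\<^sup>2)" for n x
  have [measurable]: "h n \<in> borel_measurable borel" for n unfolding h_def by measurable
  have hle: "h n x \<le> K / 2 * cmod (?G x) ^ 4" for n x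
  proof -
    let ?a = "(cmod (?G x))\<^sup>2" and ?b = "e n * gauss (e n) x"
    have "0 \<le> (K * ?a - ?b)\<^sup>2" by simp
    then have "2 * K * (?a * ?b) \<le> K\<^sup>2 * ?a\<^sup>2 + ?b\<^sup>2" by (simp add: power2_eq_square algebra_simps)
    then have "?a * ?b \<le> (K\<^sup>2 * ?a\<^sup>2 + ?b\<^sup>2) / (2 * K)" using K by (simp add: pos_le_divide_eq mult.commute)
    also have "\<dots> = K / 2 * ?a\<^sup>2 + ?b\<^sup>2 / (2 * K)" using K by (simp add: field_simps power2_eq_square)
    also have "?a\<^sup>2 = cmod (?G x) ^ 4" by (simp add: power2_eq_square power4_eq_xxxx mult.assoc)
    finally have "e n * (gauss (e n) x * (cmod (?G x))\<^sup>2) - (e n)\<^sup>2 / (2 * K) * (gauss (e n) x)\<^sup>2 \<le> K / 2 * cmod (?G x) ^ 4"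
      by (simp add: power_mult_distrib mult_ac)
    moreover have "0 \<le> K / 2 * cmod (?G x) ^ 4" using K by simp
    ultimately show ?thesis unfolding h_def by (intro max.boundedI)
  qed
  have h0: "0 \<le> h n x" for n x by (simp add: h_def)
  have hle': "h n x \<le> e n" for n x
  proof -
    have "e n * (gauss (e n) x * (cmod (?G x))\<^sup>2) \<le> e n * (1 * 1)"
      using e[of n] gauss_le_1 gauss_pos[of "e n" x] circle_hat_le_1[of x]
      by (intro mult_left_mono mult_mono power_le_one) (auto simp: less_imp_le)
    moreover have "0 \<le> (e n)\<^sup>2 / (2 * K) * (gauss (e n) x)\<^sup>2" using K by simp
    ultimately have "e n * (gauss (e n) x * (cmod (?G x))\<^sup>2) - (e n)\<^sup>2 / (2 * K) * (gauss (e n) x)\<^sup>2 \<le> e n" by linarith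
    then show ?thesis unfolding h_def using e[of n] by simp
  qed
  have elim: "e \<longlonglongrightarrow> 0" unfolding e_def using LIMSEQ_ignore_initial_segment[OF lim_1_over_n, of 2] by simp
  have w: "integrable lborel (\<lambda>x. K / 2 * cmod (?G x) ^ 4)" using L4 by simp
  have hi: "integrable lborel (h n)" for n
    by (rule Bochner_Integration.integrable_bound[OF w]) (use hle h0 K in auto)
  have hlim: "(\<lambda>n. LINT x|lborel. h n x) \<longlonglongrightarrow> (LINT x|(lborel :: (real^2) measure). 0)"
  proof (rule integral_dominated_convergence[OF _ _ w])
    show "AE x in lborel. (\<lambda>n. h n x) \<longlonglongrightarrow> 0"
      by (intro AE_I2 tendsto_sandwich[OF _ _ tendsto_const elim] always_eventually allI h0 hle')
    show "AE x in lborel. norm (h n x) \<le> K / 2 * cmod (?G x) ^ 4" for n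
      using hle h0 by auto
  qed auto
  have "c \<le> (LINT x|lborel. h n x) + pi / (2 * K)" for n
  proof -
    note m = circle_hat_gauss_mass[OF e(1)[of n] e(2)[of n]] and g = integral_gauss_squared[OF e(1)[of n]]
    have "c = e n * (c / e n)" using e[of n] by simp
    also have "\<dots> \<le> e n * (LINT x|lborel. gauss (e n) x * (cmod (?G x))\<^sup>2)"
      using m(2) e[of n] unfolding c_def by (intro mult_left_mono) auto
    also have "\<dots> = (LINT x|lborel. e n * (gauss (e n) x * (cmod (?G x))\<^sup>2))" by simp
    also have "\<dots> \<le> (LINT x|lborel. h n x + (e n)\<^sup>2 / (2 * K) * (gauss (e n) x)\<^sup>2)"
      using m(1) g(1) hi by (intro integral_mono) (auto simp: h_def)
    also have "\<dots> = (LINT x|lborel. h n x) + (e n)\<^sup>2 / (2 * K) * (pi / (e n)\<^sup>2)"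
      using g hi by simp
    also have "(e n)\<^sup>2 / (2 * K) * (pi / (e n)\<^sup>2) = pi / (2 * K)" using e[of n] by simp
    finally show ?thesis .
  qed
  then have "c \<le> 0 + pi / (2 * K)"
    using tendsto_add[OF hlim tendsto_const[of "pi / (2 * K)"]] by (intro LIMSEQ_le_const) auto
  then show False using c by (simp add: K_def)
qed

theorem theorem1p3:
  fixes p q :: real
  assumes "CARD('n::finite) \<ge> 2" and "1 \<le> p" and "1 \<le> q"
  shows "(\<exists>C>0. \<forall>f \<in> (test_functions :: ((real^2^'n) \<Rightarrow> complex) set).
            Lp_norm torus_measure q (fourier_transform f) \<le> C * Lp_norm lborel p f)
         \<longleftrightarrow> (1 \<le> p \<and> p < 4 / 3 \<and> ereal q \<le> conjugate_exponent p / 3)"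
proof
  assume "1 \<le> p \<and> p < 4 / 3 \<and> ereal q \<le> conjugate_exponent p / 3"
  then show "\<exists>C>0. \<forall>f \<in> (test_functions :: ((real^2^'n) \<Rightarrow> complex) set).
            Lp_norm torus_measure q (fourier_transform f) \<le> C * Lp_norm lborel p f"
    using torus_restriction_sufficient assms by blast
next
  assume "\<exists>C>0. \<forall>f \<in> (test_functions :: ((real^2^'n) \<Rightarrow> complex) set).
            Lp_norm torus_measure q (fourier_transform f) \<le> C * Lp_norm lborel p f"
  then obtain C where C: "0 < C" and est: "\<And>f. f \<in> (test_functions :: ((real^2^'n) \<Rightarrow> complex) set) \<Longrightarrow>
            Lp_norm torus_measure q (fourier_transform f) \<le> C * Lp_norm lborel p f" by blast
  note circle = circle_estimate[OF assms(2,3) C est]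
  have "p < 4 / 3"
    using circle_hat_L4_bound[OF _ assms(3) circle] circle_hat_not_L4 by (meson not_le)
  moreover have "ereal q \<le> conjugate_exponent p / 3"
  proof (cases "p = 1")
    case False
    \<comment> \<open>For \<open>p > 1\<close> this inequality is \<open>q \<le> p' / 3\<close> in
      reciprocal form.\<close>
    have "3 - 1 / q \<le> 3 / p" by (rule knapp_necessary[OF assms(2,3) circle])
    then have "q * (3 * (p - 1)) \<le> p" using assms by (simp add: field_simps)
    then show ?thesis using False assms by (simp add: conjugate_exponent_def field_simps)
  qed (simp add: conjugate_exponent_def)
  ultimately show "1 \<le> p \<and> p < 4 / 3 \<and> ereal q \<le> conjugate_exponent p / 3" using assms by simp
qed

end
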